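(* Let $n\ge1$ and assume that $\beta$ satisfies $0\le\beta\le\frac{2(n+1)}{n-1}$ if $n\ge2$, or $\beta\ge0$ if $n=1$. Let $B_1(0)$ be the unit ball in $\mathbb{R}^{n+1}$. Then $$\mu_{n+1,\beta}(B_1(0))=\mu^*_{n+1,\beta}.$$ Moreover, $\mu_{n+1,\beta}(B_1(0))$ cannot be achieved by any function in $W^{1,2}_0(B_1(0))$.
   Context: For a domain $\Omega\subset\mathbb{R}^{n+1}$ let $\delta_\Omega(x)=\operatorname{dist}(x,\partial\Omega)$, and define $$J_{n+1,\beta,\Omega}[u]=\frac{\int_\Omega|\nabla u|^2\,dx}{\Big(\int_\Omega\delta_\Omega^{-2+\frac{n-1}{n+1}\beta}|u|^{2+\frac{2\beta}{n+1}}\,dx\Big)^{\frac{n+1}{n+\beta+1}}},\qquad \mu_{n+1,\beta}(\Omega)=\inf_{u\in C_0^\infty(\Omega)\setminus\{0\}}J_{n+1,\beta,\Omega}[u].$$ $\mu^*_{n+1,\beta}=\mu_{n+1,\beta}(\mathbb{R}^{n+1}_+)$, where $\mathbb{R}^{n+1}_+=\{(y,t):y\in\mathbb{R}^n,\ t>0\}$. "$\mu_{n+1,\beta}(\Omega)$ is achieved by $u\in W^{1,2}_0(\Omega)$" means that $u\neq0$ and $J_{n+1,\beta,\Omega}[u]=\mu_{n+1,\beta}(\Omega)$. *)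

theory Defs
  imports "HOL-Analysis.Analysis"
begin

section \<open>Smooth compactly supported functions\<close>

definition partial_deriv :: "'a::euclidean_space \<Rightarrow> ('a \<Rightarrow> real) \<Rightarrow> 'a \<Rightarrow> real" where
  "partial_deriv b f x = frechet_derivative f (at x) b"

definition grad :: "('a::euclidean_space \<Rightarrow> real) \<Rightarrow> 'a \<Rightarrow> 'a" where
  "grad f x = (\<Sum>b\<in>Basis. partial_deriv b f x *\<^sub>R b)"

primrec C_k :: "nat \<Rightarrow> ('a::euclidean_space \<Rightarrow> real) \<Rightarrow> bool" where
  "C_k 0 f \<longleftrightarrow> continuous_on UNIV f"
| "C_k (Suc k) f \<longleftrightarrow> (\<forall>x. f differentiable (at x)) \<and> (\<forall>b\<in>Basis. C_k k (partial_deriv b f))"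

text \<open>Elements of \<open>C\<^sub>0\<^sup>\<infinity>(\<Omega>)\<close> are represented by their extension by zero to the whole space.\<close>

definition test_functions :: "'a::euclidean_space set \<Rightarrow> ('a \<Rightarrow> real) set" where
  "test_functions \<Omega> =
     {u. (\<forall>k. C_k k u) \<and> compact (closure {x. u x \<noteq> 0}) \<and> closure {x. u x \<noteq> 0} \<subseteq> \<Omega>}"


section \<open>The Sobolev space \<open>W\<^sup>1\<^sup>,\<^sup>2\<^sub>0\<close>\<close>

definition L2_on :: "'a::euclidean_space set \<Rightarrow> ('a \<Rightarrow> 'b::euclidean_space) \<Rightarrow> bool" where
  "L2_on \<Omega> f \<longleftrightarrow> f \<in> borel_measurable (lebesgue_on \<Omega>) \<and>
     integrable (lebesgue_on \<Omega>) (\<lambda>x. (norm (f x))\<^sup>2)"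

text \<open>\<open>W12_gradient \<Omega> u G\<close>: \<open>u\<close> belongs to \<open>W\<^sup>1\<^sup>,\<^sup>2(\<Omega>)\<close> and \<open>G\<close> is its distributional gradient,
  which is determined only up to null sets. Functions are total; their values outside \<open>\<Omega>\<close> play
  no role.\<close>

definition W12_gradient :: "'a::euclidean_space set \<Rightarrow> ('a \<Rightarrow> real) \<Rightarrow> ('a \<Rightarrow> 'a) \<Rightarrow> bool" where
  "W12_gradient \<Omega> u G \<longleftrightarrow> L2_on \<Omega> u \<and> L2_on \<Omega> G \<and>
     (\<forall>\<phi>\<in>test_functions \<Omega>. \<forall>b\<in>Basis.
        (\<integral>x. u x * partial_deriv b \<phi> x \<partial>lebesgue_on \<Omega>) =
        - (\<integral>x. (G x \<bullet> b) * \<phi> x \<partial>lebesgue_on \<Omega>))"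

text \<open>The closure of \<open>C\<^sub>0\<^sup>\<infinity>(\<Omega>)\<close> in the norm of \<open>W\<^sup>1\<^sup>,\<^sup>2(\<Omega>)\<close>.\<close>

definition W12_0 :: "'a::euclidean_space set \<Rightarrow> ('a \<Rightarrow> real) set" where
  "W12_0 \<Omega> = {u. \<exists>G. W12_gradient \<Omega> u G \<and>
     (\<exists>\<phi>. (\<forall>k::nat. \<phi> k \<in> test_functions \<Omega>) \<and>
        (\<lambda>k. (\<integral>x. (\<phi> k x - u x)\<^sup>2 \<partial>lebesgue_on \<Omega>)
             + (\<integral>x. (norm (grad (\<phi> k) x - G x))\<^sup>2 \<partial>lebesgue_on \<Omega>)) \<longlonglongrightarrow> 0)}"


section \<open>The quotient and its infimum\<close>

text \<open>The ambient space \<open>\<real>\<^sup>n\<^sup>+\<^sup>1\<close> is the Euclidean space of pairs \<open>(y, t)\<close> with \<open>y\<close> in \<open>\<real>\<^sup>n\<close> and \<open>t\<close> real,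
  where \<open>n = CARD('n) \<ge> 1\<close>.\<close>

definition half_space :: "((real ^ 'n) \<times> real) set" where
  "half_space = {(y, t). t > 0}"

definition bdry_dist :: "'a::euclidean_space set \<Rightarrow> 'a \<Rightarrow> real" where
  "bdry_dist \<Omega> x = infdist x (frontier \<Omega>)"

text \<open>The gradient \<open>Du\<close> of \<open>u\<close> is an explicit argument, so that the same quotient serves the smooth
  functions (classical gradient) and the Sobolev functions (distributional gradient).
  If the integral in the denominator diverges, its value and hence the quotient are \<open>0\<close>,
  in agreement with the usual reading of a finite number divided by infinity.\<close>

definition J_quot ::
  "real \<Rightarrow> ((real ^ 'n) \<times> real) set \<Rightarrow> ((real ^ 'n) \<times> real \<Rightarrow> real) \<Rightarrow>
   ((real ^ 'n) \<times> real \<Rightarrow> (real ^ 'n) \<times> real) \<Rightarrow> real" where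
  "J_quot \<beta> \<Omega> u Du = (let n = real CARD('n) in
     (\<integral>x. (norm (Du x))\<^sup>2 \<partial>lebesgue_on \<Omega>) /
     (\<integral>x. bdry_dist \<Omega> x powr (- 2 + (n - 1) / (n + 1) * \<beta>)
            * \<bar>u x\<bar> powr (2 + 2 * \<beta> / (n + 1)) \<partial>lebesgue_on \<Omega>)
       powr ((n + 1) / (n + \<beta> + 1)))"

definition mu :: "real \<Rightarrow> ((real ^ 'n) \<times> real) set \<Rightarrow> real" where
  "mu \<beta> \<Omega> = (INF u \<in> test_functions \<Omega> - {\<lambda>x. 0}. J_quot \<beta> \<Omega> u (grad u))"

text \<open>Being nonzero is meant in \<open>W\<^sup>1\<^sup>,\<^sup>2\<^sub>0(\<Omega>)\<close>, hence modulo null sets.\<close>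

definition mu_achieved_by ::
  "real \<Rightarrow> ((real ^ 'n) \<times> real) set \<Rightarrow> ((real ^ 'n) \<times> real \<Rightarrow> real) \<Rightarrow> bool" where
  "mu_achieved_by \<beta> \<Omega> u \<longleftrightarrow>
     \<not> (AE x in lebesgue_on \<Omega>. u x = 0) \<and>
     (\<exists>Du. W12_gradient \<Omega> u Du \<and> J_quot \<beta> \<Omega> u Du = mu \<beta> \<Omega>)"

end

theory Submission
  imports Defs
begin

text \<open>
  Let \<open>N = n + 1\<close>, \<open>p = 2 + 2\<beta>/N\<close> and \<open>g = -2 + (n-1)\<beta>/(n+1) = (N-2)p/2 - N \<le> 0\<close>.

  The inversion \<open>x \<mapsto> x/|x|\<^sup>2\<close> maps the unit ball around a unit vector \<open>e\<close> onto the half-space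
  \<open>x \<bullet> e > 1/2\<close>, and the Kelvin transform preserves the Dirichlet integral and turns the weight
  \<open>t\<^sup>g\<close> of the half-space into \<open>((1 - |x|\<^sup>2)/2)\<^sup>g\<close> on the ball. As \<open>(1 - |x|\<^sup>2)/2 \<le> 1 - |x|\<close> and
  \<open>g \<le> 0\<close>, this gives \<open>\<mu>* \<le> \<mu>(B)\<close>. Conversely, a test function on the half-space is carried into
  the ball by a large dilation, under which distances to the boundary do not increase.

  Suppose that \<open>u\<close> attains \<open>\<mu>(B)\<close>. If \<open>g < 0\<close>, the two weights on the ball differ strictly and
  the inequality for \<open>((1 - |x|\<^sup>2)/2)\<^sup>g\<close> fails for \<open>u\<close>. If \<open>g = 0\<close>, there is no weight, and the inequality
  holds on the whole space. Replace \<open>u\<close> by \<open>|u| + \<epsilon>/2\<close> on the ball by means of a cutoff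
  \<open>\<zeta>\<close> that is constant there: the Dirichlet integral grows by \<open>O(\<epsilon>\<^sup>2)\<close> only, whereas
  \<open>\<integral>|u|\<^sup>p\<close> grows at rate \<open>\<epsilon> p/2 \<integral>|u|\<^sup>p\<^sup>-\<^sup>1\<close>, which must therefore vanish.

  Since a quotient with divergent denominator counts as \<open>0\<close>, one also needs \<open>\<mu>* > 0\<close>. With respect
  to the hyperbolic measure \<open>t\<^sup>-\<^sup>N dx\<close> and \<open>U = t\<^bsup>(N-2)/2\<^esup> u\<close> this is a Sobolev inequality, which follows
  from Hardy's inequality and Maz'ya's truncation of \<open>U\<close> at dyadic levels.
\<close>

text \<open>The bound on \<beta> says g \<le> 0, which is the same as p (N-2) \<le> 2N: the exponent
  p is at most critical. This one inequality orders the weights of the two models and also makes the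
  truncation argument work: a superlevel set of small hyperbolic measure m is probed by
  displacements of hyperbolic size r with r^N proportional to m, which gains a factor m^(2/N), and p
  (N-2) \<le> 2N means 1 - 2/p \<le> 2/N. The level l then cancels from the estimate, so that the
  dyadic levels can be summed.

  For g = 0 the two weights on the ball coincide and no strict inequality is left. Adding a constant
  on the ball is a direction in which the energy has no first-order term, while the potential
  strictly increases. Cutting the constant off leaves the ball, which is harmless because the
  unweighted inequality is translation invariant.

  A Sobolev function of energy E is reached only through test functions whose energies are
  eventually below any given c > E. Inequalities are therefore passed to the limit by Fatou's lemma
  for fixed c, and c tends to E afterwards.\<close>

abbreviation energy :: "('a::euclidean_space \<Rightarrow> real) \<Rightarrow> real" where
  "energy u \<equiv> (\<integral>x. (norm (grad u x))\<^sup>2 \<partial>lborel)"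

section \<open>Local smoothness\<close>

text \<open>A local form of \<open>C_k\<close>. Real powers and the Kelvin transform are smooth only
  off a singular set and are extended by zero afterwards. Derivatives are taken \<open>at x\<close>
  in the whole space, so the notion is meant for open sets.\<close>

primrec Ck_on :: "nat \<Rightarrow> 'a::euclidean_space set \<Rightarrow> ('a \<Rightarrow> real) \<Rightarrow> bool" where
  "Ck_on 0 S f \<longleftrightarrow> continuous_on S f"
| "Ck_on (Suc k) S f \<longleftrightarrow>
     (\<forall>x\<in>S. f differentiable (at x)) \<and> (\<forall>b\<in>Basis. Ck_on k S (partial_deriv b f))"

definition smooth_on :: "'a::euclidean_space set \<Rightarrow> ('a \<Rightarrow> real) \<Rightarrow> bool" where
  "smooth_on S f \<longleftrightarrow> (\<forall>k. Ck_on k S f)"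

lemma C_k_eq_Ck_on: "C_k k f = Ck_on k UNIV f"
  by (induction k arbitrary: f) auto

lemma partial_deriv_eq:
  assumes "(f has_derivative f') (at x)"
  shows "partial_deriv b f x = f' b"
  using assms by (simp add: partial_deriv_def frechet_derivative_at[symmetric])

lemma grad_inner_Basis: "b \<in> Basis \<Longrightarrow> grad f x \<bullet> b = partial_deriv b f x"
  by (simp add: grad_def inner_sum_left inner_Basis if_distrib cong: if_cong)

lemma has_derivative_imp_inner:
  fixes f :: "'a::euclidean_space \<Rightarrow> real"
  assumes "(f has_derivative f') (at x)"
  shows "f' h = grad f x \<bullet> h"
proof -
  interpret linear f' using assms by (rule has_derivative_linear)
  have "f' h = f' (\<Sum>b\<in>Basis. (h \<bullet> b) *\<^sub>R b)"
    by (simp add: euclidean_representation)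
  also have "\<dots> = (\<Sum>b\<in>Basis. (h \<bullet> b) * f' b)"
    by (simp add: sum scaleR)
  also have "\<dots> = grad f x \<bullet> h"
    using assms by (simp add: grad_def inner_sum_left inner_sum_right partial_deriv_eq inner_commute mult.commute)
  finally show ?thesis .
qed

lemma grad_eqI:
  fixes f :: "'a::euclidean_space \<Rightarrow> real"
  assumes "(f has_derivative (\<lambda>h. G \<bullet> h)) (at x)"
  shows "grad f x = G"
  using has_derivative_imp_inner[OF assms] by (metis vector_eq_rdot inner_commute)

lemma grad_eq_0_if_constant:
  assumes "open S" "x \<in> S" "\<And>y. y \<in> S \<Longrightarrow> u y = c"
  shows "grad u x = 0"
proof (rule grad_eqI)
  have "(u has_derivative (\<lambda>h. 0)) (at x)"
    by (rule has_derivative_transform_within_open[OF has_derivative_const[of c] assms(1,2)]) (use assms(3) in auto)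
  then show "(u has_derivative (\<lambda>h. 0 \<bullet> h)) (at x)" by simp
qed

lemma has_derivative_grad:
  fixes f :: "'a::euclidean_space \<Rightarrow> real"
  assumes "f differentiable (at x)"
  shows "(f has_derivative (\<lambda>h. grad f x \<bullet> h)) (at x)"
proof -
  obtain f' where f': "(f has_derivative f') (at x)" using assms by (auto simp: differentiable_def)
  then have "f' = (\<lambda>h. grad f x \<bullet> h)" by (auto dest: has_derivative_imp_inner)
  with f' show ?thesis by simp
qed

lemma Ck_on_SucD:
  "Ck_on (Suc k) S f \<Longrightarrow> x \<in> S \<Longrightarrow> (f has_derivative (\<lambda>h. grad f x \<bullet> h)) (at x)"
  "Ck_on (Suc k) S f \<Longrightarrow> b \<in> Basis \<Longrightarrow> Ck_on k S (partial_deriv b f)"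
  by (auto simp: has_derivative_grad)

lemma Ck_on_cong:
  assumes "open S" "\<And>x. x \<in> S \<Longrightarrow> f x = g x" "Ck_on k S f"
  shows "Ck_on k S g"
  using assms
proof (induction k arbitrary: f g)
  case 0
  then show ?case using continuous_on_cong by auto
next
  case (Suc k)
  have der: "(g has_derivative (\<lambda>h. grad f x \<bullet> h)) (at x)" if "x \<in> S" for x
    using has_derivative_transform_within_open[OF Ck_on_SucD(1)[OF Suc.prems(3) that] Suc.prems(1) that]
      Suc.prems(2) by auto
  have "Ck_on k S (partial_deriv b g)" if "b \<in> Basis" for b
  proof (rule Suc.IH[OF Suc.prems(1) _ Ck_on_SucD(2)[OF Suc.prems(3) that]])
    fix x assume "x \<in> S"
    then show "partial_deriv b f x = partial_deriv b g x"
      using partial_deriv_eq[OF der] that by (simp add: grad_inner_Basis)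
  qed
  then show ?case using der by (auto simp: differentiable_def)
qed

text \<open>Reduces each closure property below to a derivative formula on an open set: the formula
  replaces \<open>partial_deriv\<close>, which is defined through a choice of derivative.\<close>

lemma Ck_on_SucI:
  assumes S: "open S" and der: "\<And>x. x \<in> S \<Longrightarrow> (f has_derivative f' x) (at x)"
    and k: "\<And>b. b \<in> Basis \<Longrightarrow> Ck_on k S (\<lambda>x. f' x b)"
  shows "Ck_on (Suc k) S f"
  using der k by (auto simp: differentiable_def partial_deriv_eq[OF der] intro!: Ck_on_cong[OF S _ k])

lemma Ck_on_Suc_imp: "Ck_on (Suc k) S f \<Longrightarrow> Ck_on k S f"
proof (induction k arbitrary: f)
  case 0
  then show ?case
    by (auto intro!: continuous_at_imp_continuous_on differentiable_imp_continuous_within)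
qed auto

lemma Ck_on_subset: "Ck_on k S f \<Longrightarrow> T \<subseteq> S \<Longrightarrow> Ck_on k T f"
  by (induction k arbitrary: f) (auto intro: continuous_on_subset)

lemma Ck_on_Un:
  "open S \<Longrightarrow> open T \<Longrightarrow> Ck_on k S f \<Longrightarrow> Ck_on k T f \<Longrightarrow> Ck_on k (S \<union> T) f"
  by (induction k arbitrary: f) (auto intro: continuous_on_open_Un)

section \<open>Closure properties of C^k functions on open sets\<close>

lemma Ck_on_const: "open S \<Longrightarrow> Ck_on k S (\<lambda>x. c)"
proof (induction k arbitrary: c)
  case (Suc k)
  then show ?case by (intro Ck_on_SucI[where f'="\<lambda>x h. 0"]) auto
qed auto

lemma Ck_on_linear:
  assumes "open S" "bounded_linear f"
  shows "Ck_on k S f"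
proof (cases k)
  case 0
  then show ?thesis using assms(2) by (simp add: linear_continuous_on)
next
  case (Suc m)
  show ?thesis unfolding Suc
    using assms by (intro Ck_on_SucI[where f'="\<lambda>x. f"] bounded_linear_imp_has_derivative Ck_on_const)
qed

lemma Ck_on_add:
  assumes "open S" "Ck_on k S f" "Ck_on k S g"
  shows "Ck_on k S (\<lambda>x. f x + g x)"
  using assms
proof (induction k arbitrary: f g)
  case (Suc k)
  show ?case
  proof (rule Ck_on_SucI[OF Suc.prems(1)])
    show "((\<lambda>x. f x + g x) has_derivative (\<lambda>h. grad f x \<bullet> h + grad g x \<bullet> h)) (at x)" if "x \<in> S" for x
      by (intro has_derivative_add Ck_on_SucD(1)[OF Suc.prems(2) that] Ck_on_SucD(1)[OF Suc.prems(3) that])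
    show "Ck_on k S (\<lambda>x. grad f x \<bullet> b + grad g x \<bullet> b)" if "b \<in> Basis" for b
      using that Suc.IH[OF Suc.prems(1) Ck_on_SucD(2)[OF Suc.prems(2) that] Ck_on_SucD(2)[OF Suc.prems(3) that]]
      by (simp add: grad_inner_Basis)
  qed
qed (auto intro!: continuous_on_add continuous_on_mult)

lemma Ck_on_mult:
  assumes "open S" "Ck_on k S f" "Ck_on k S g"
  shows "Ck_on k S (\<lambda>x. f x * g x)"
  using assms
proof (induction k arbitrary: f g)
  case (Suc k)
  show ?case
  proof (rule Ck_on_SucI[OF Suc.prems(1)])
    show "((\<lambda>x. f x * g x) has_derivative (\<lambda>h. f x * (grad g x \<bullet> h) + (grad f x \<bullet> h) * g x)) (at x)"
      if "x \<in> S" for x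
      by (intro has_derivative_mult Ck_on_SucD(1)[OF Suc.prems(2) that] Ck_on_SucD(1)[OF Suc.prems(3) that])
    show "Ck_on k S (\<lambda>x. f x * (grad g x \<bullet> b) + (grad f x \<bullet> b) * g x)" if "b \<in> Basis" for b
      using that Suc.IH[OF Suc.prems(1) Ck_on_Suc_imp[OF Suc.prems(2)] Ck_on_SucD(2)[OF Suc.prems(3) that]]
        Suc.IH[OF Suc.prems(1) Ck_on_SucD(2)[OF Suc.prems(2) that] Ck_on_Suc_imp[OF Suc.prems(3)]]
      by (simp add: grad_inner_Basis Ck_on_add[OF Suc.prems(1)])
  qed
qed (auto intro!: continuous_on_add continuous_on_mult)

lemma Ck_on_sum:
  assumes "open S" "\<And>i. i \<in> I \<Longrightarrow> Ck_on k S (f i)"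
  shows "Ck_on k S (\<lambda>x. \<Sum>i\<in>I. f i x)"
  using assms(2)
  by (induction I rule: infinite_finite_induct)
     (auto intro: Ck_on_const Ck_on_add assms(1))

text \<open>\<open>H j\<close> stands for the jth derivative of the outer function. The chain rule
  raises the index by one, so the induction on \<open>k\<close> has to range over all
  \<open>j\<close>.\<close>

lemma Ck_on_compose_real:
  assumes "open S" "f ` S \<subseteq> T"
    and H: "\<And>j y. y \<in> T \<Longrightarrow> (H j has_real_derivative H (Suc j) y) (at y)"
    and "Ck_on k S f"
  shows "Ck_on k S (\<lambda>x. H j (f x))"
  using assms(4)
proof (induction k arbitrary: j)
  case 0
  have "continuous_on T (H j)"
    using H by (intro continuous_at_imp_continuous_on) (blast intro: DERIV_isCont)
  then show ?case using 0 assms(2) by (auto intro: continuous_on_compose2)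
next
  case (Suc k)
  show ?case
  proof (rule Ck_on_SucI[OF assms(1)])
    show "((\<lambda>x. H j (f x)) has_derivative (\<lambda>h. (grad f x \<bullet> h) * H (Suc j) (f x))) (at x)" if "x \<in> S" for x
      using has_derivative_compose[OF Ck_on_SucD(1)[OF Suc.prems that]
          H[of "f x" j, unfolded has_field_derivative_def]] that assms(2)
      by (auto simp: mult.commute)
    show "Ck_on k S (\<lambda>x. (grad f x \<bullet> b) * H (Suc j) (f x))" if "b \<in> Basis" for b
      using that Ck_on_mult[OF assms(1) Ck_on_SucD(2)[OF Suc.prems that] Suc.IH[OF Ck_on_Suc_imp[OF Suc.prems]]]
      by (simp add: grad_inner_Basis)
  qed
qed

lemma Ck_on_compose:
  fixes \<Phi> :: "'a::euclidean_space \<Rightarrow> 'b::euclidean_space"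
  assumes "open S" "\<Phi> ` S \<subseteq> T"
    and "\<And>c. c \<in> Basis \<Longrightarrow> Ck_on k S (\<lambda>x. \<Phi> x \<bullet> c)"
    and "Ck_on k T f"
  shows "Ck_on k S (\<lambda>x. f (\<Phi> x))"
  using assms(3,4)
proof (induction k arbitrary: f)
  case 0
  have "continuous_on S \<Phi>"
    using 0 by (auto intro: continuous_on_componentwise[THEN iffD2])
  then show ?case using 0 assms(2) by (auto intro: continuous_on_compose2)
next
  case (Suc k)
  \<comment> \<open>The derivative of the map, assembled from the gradients of its components. With
    it the partial derivatives of the composite are sums of products of component derivatives and
    composites of partial derivatives of \<open>f\<close>, to which the induction hypothesis
    applies.\<close>
  define \<Phi>' where "\<Phi>' x h = (\<Sum>c\<in>Basis. (grad (\<lambda>x. \<Phi> x \<bullet> c) x \<bullet> h) *\<^sub>R c)" for x h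
  have \<Phi>': "(\<Phi> has_derivative \<Phi>' x) (at x)" if "x \<in> S" for x
  proof -
    have "((\<lambda>x. \<Phi> x \<bullet> c) has_derivative (\<lambda>h. \<Phi>' x h \<bullet> c)) (at x)" if "c \<in> Basis" for c
      using Ck_on_SucD(1)[OF Suc.prems(1)[OF that] \<open>x \<in> S\<close>] that
      by (simp add: \<Phi>'_def inner_sum_left inner_Basis if_distrib sum.If_cases cong: if_cong)
    then show ?thesis using has_derivative_componentwise_within by blast
  qed
  show ?case
  proof (rule Ck_on_SucI[OF assms(1)])
    show "((\<lambda>x. f (\<Phi> x)) has_derivative
        (\<lambda>h. \<Sum>c\<in>Basis. (grad (\<lambda>x. \<Phi> x \<bullet> c) x \<bullet> h) * partial_deriv c f (\<Phi> x))) (at x)" if "x \<in> S" for x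
      using has_derivative_compose[OF \<Phi>'[OF that] Ck_on_SucD(1)[OF Suc.prems(2), of "\<Phi> x"]] that assms(2)
      by (auto simp: \<Phi>'_def inner_sum_right grad_inner_Basis)
    show "Ck_on k S (\<lambda>x. \<Sum>c\<in>Basis. (grad (\<lambda>x. \<Phi> x \<bullet> c) x \<bullet> b) * partial_deriv c f (\<Phi> x))"
      if "b \<in> Basis" for b
      using that Ck_on_SucD(2)[OF Suc.prems(1) that] Suc.IH[OF Ck_on_Suc_imp[OF Suc.prems(1)] Ck_on_SucD(2)[OF Suc.prems(2)]]
      by (intro Ck_on_sum Ck_on_mult assms(1)) (simp_all add: grad_inner_Basis)
  qed
qed

section \<open>Smoothness of all orders\<close>

lemma smooth_on_cong:
  "open S \<Longrightarrow> (\<And>x. x \<in> S \<Longrightarrow> f x = g x) \<Longrightarrow> smooth_on S f \<Longrightarrow> smooth_on S g"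
  unfolding smooth_on_def using Ck_on_cong[of S f g] by metis

lemma smooth_on_subset: "smooth_on S f \<Longrightarrow> T \<subseteq> S \<Longrightarrow> smooth_on T f"
  unfolding smooth_on_def using Ck_on_subset by metis

lemma smooth_on_Un: "open S \<Longrightarrow> open T \<Longrightarrow> smooth_on S f \<Longrightarrow> smooth_on T f \<Longrightarrow> smooth_on (S \<union> T) f"
  unfolding smooth_on_def by (simp add: Ck_on_Un)

lemma smooth_on_const: "open S \<Longrightarrow> smooth_on S (\<lambda>x. c)"
  unfolding smooth_on_def by (simp add: Ck_on_const)

lemma smooth_on_linear: "open S \<Longrightarrow> bounded_linear f \<Longrightarrow> smooth_on S f"
  unfolding smooth_on_def by (simp add: Ck_on_linear)

lemma smooth_on_add:
  "open S \<Longrightarrow> smooth_on S f \<Longrightarrow> smooth_on S g \<Longrightarrow> smooth_on S (\<lambda>x. f x + g x)"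
  unfolding smooth_on_def by (simp add: Ck_on_add)

lemma smooth_on_mult:
  "open S \<Longrightarrow> smooth_on S f \<Longrightarrow> smooth_on S g \<Longrightarrow> smooth_on S (\<lambda>x. f x * g x)"
  unfolding smooth_on_def by (simp add: Ck_on_mult)

lemma smooth_on_diff:
  assumes "open S" "smooth_on S f" "smooth_on S g"
  shows "smooth_on S (\<lambda>x. f x - g x)"
  using smooth_on_add[OF assms(1,2) smooth_on_mult[OF assms(1) smooth_on_const[OF assms(1), of "-1"] assms(3)]]
  by simp

lemma smooth_on_sum:
  "open S \<Longrightarrow> (\<And>i. i \<in> I \<Longrightarrow> smooth_on S (f i)) \<Longrightarrow> smooth_on S (\<lambda>x. \<Sum>i\<in>I. f i x)"
  unfolding smooth_on_def by (simp add: Ck_on_sum)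

lemma smooth_on_compose_real:
  assumes "open S" "smooth_on S f" "f ` S \<subseteq> T"
    "\<And>j y. y \<in> T \<Longrightarrow> (H j has_real_derivative H (Suc j) y) (at y)"
  shows "smooth_on S (\<lambda>x. H 0 (f x))"
  using assms Ck_on_compose_real[of S f T H _ 0] unfolding smooth_on_def by metis

lemma smooth_on_compose:
  fixes \<Phi> :: "'a::euclidean_space \<Rightarrow> 'b::euclidean_space"
  assumes "open S" "smooth_on T f" "\<Phi> ` S \<subseteq> T" "\<And>c. c \<in> Basis \<Longrightarrow> smooth_on S (\<lambda>x. \<Phi> x \<bullet> c)"
  shows "smooth_on S (\<lambda>x. f (\<Phi> x))"
  using assms Ck_on_compose[of S \<Phi> T _ f] unfolding smooth_on_def by metis

lemma smooth_on_powr: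
  assumes "open S" "smooth_on S f" "\<And>x. x \<in> S \<Longrightarrow> f x > 0"
  shows "smooth_on S (\<lambda>x. f x powr a)"
proof -
  \<comment> \<open>The jth derivative of the power function, with a falling factorial as
    coefficient.\<close>
  define H :: "nat \<Rightarrow> real \<Rightarrow> real"
    where "H j y = (\<Prod>i<j. a - real i) * y powr (a - real j)" for j y
  have "smooth_on S (\<lambda>x. H 0 (f x))"
  proof (rule smooth_on_compose_real[where T="{0<..}", OF assms(1,2)])
    show "f ` S \<subseteq> {0<..}" using assms(3) by auto
    fix j :: nat and y :: real assume "y \<in> {0<..}"
    then show "(H j has_real_derivative H (Suc j) y) (at y)"
      using powr_diff[of y "a - real j" 1] unfolding H_def
      by (auto intro!: derivative_eq_intros simp: algebra_simps add_divide_distrib diff_divide_distrib)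
  qed
  then show ?thesis by (simp add: H_def)
qed

lemma smooth_on_partial_deriv: "smooth_on S f \<Longrightarrow> b \<in> Basis \<Longrightarrow> smooth_on S (partial_deriv b f)"
  unfolding smooth_on_def by (metis Ck_on.simps(2))

lemma smooth_on_differentiable: "smooth_on S f \<Longrightarrow> x \<in> S \<Longrightarrow> f differentiable (at x)"
  unfolding smooth_on_def using Ck_on.simps(2) by blast

lemma smooth_on_has_derivative:
  "smooth_on S f \<Longrightarrow> x \<in> S \<Longrightarrow> (f has_derivative (\<lambda>h. grad f x \<bullet> h)) (at x)"
  by (intro has_derivative_grad smooth_on_differentiable)

lemma smooth_on_continuous: "smooth_on S f \<Longrightarrow> continuous_on S f"
  unfolding smooth_on_def using Ck_on.simps(1) by blast

lemma smooth_on_continuous_grad: "smooth_on S f \<Longrightarrow> continuous_on S (grad f)"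
  unfolding grad_def
  by (intro continuous_intros smooth_on_continuous smooth_on_partial_deriv)

section \<open>Test functions and their supports\<close>

lemma test_functions_iff:
  "u \<in> test_functions \<Omega> \<longleftrightarrow> smooth_on UNIV u \<and> compact (closure {x. u x \<noteq> 0}) \<and> closure {x. u x \<noteq> 0} \<subseteq> \<Omega>"
  by (auto simp: test_functions_def smooth_on_def C_k_eq_Ck_on)

text \<open>The open sets \<open>S\<close> and \<open>-K\<close> cover the space, and
  \<open>f\<close> is smooth on the first by assumption and zero on the second.\<close>

lemma smooth_on_extend:
  assumes "open S" "smooth_on S f" "closed K" "K \<subseteq> S" "\<And>x. x \<notin> K \<Longrightarrow> f x = 0"
  shows "smooth_on UNIV f"
proof -
  have "smooth_on (-K) f"
    using assms by (intro smooth_on_cong[OF _ _ smooth_on_const[of "-K" 0]]) auto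
  then have "smooth_on (S \<union> -K) f" using assms by (intro smooth_on_Un) auto
  moreover have "S \<union> -K = UNIV" using \<open>K \<subseteq> S\<close> by auto
  ultimately show ?thesis by simp
qed

lemma test_functionsI:
  assumes "open S" "smooth_on S f" "compact K" "K \<subseteq> S" "K \<subseteq> \<Omega>" "\<And>x. x \<notin> K \<Longrightarrow> f x = 0"
  shows "f \<in> test_functions \<Omega>"
proof -
  have "closure {x. f x \<noteq> 0} \<subseteq> K"
    using assms by (intro closure_minimal) (auto simp: compact_imp_closed)
  moreover have "compact (closure {x. f x \<noteq> 0})"
    using calculation assms(3) by (metis closed_closure compact_Int_closed inf.absorb_iff2)
  moreover have "smooth_on UNIV f"
    by (rule smooth_on_extend[OF assms(1,2) compact_imp_closed[OF assms(3)] assms(4,6)])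
  ultimately show ?thesis
    using assms(5) unfolding test_functions_iff by simp
qed

lemma test_functionsE:
  assumes "u \<in> test_functions \<Omega>"
  obtains K where "compact K" "K \<subseteq> \<Omega>" "\<And>x. x \<notin> K \<Longrightarrow> u x = 0" "\<And>x. x \<notin> K \<Longrightarrow> grad u x = 0" "smooth_on UNIV u"
proof -
  define K where "K = closure {x. u x \<noteq> 0}"
  have K: "compact K" "K \<subseteq> \<Omega>" and u: "smooth_on UNIV u"
    using assms by (simp_all add: test_functions_iff K_def)
  have "{x. u x \<noteq> 0} \<subseteq> K" unfolding K_def by (rule closure_subset)
  then have 0: "u x = 0" if "x \<notin> K" for x using that by auto
  have "grad u x = 0" if "x \<notin> K" for x
    by (rule grad_eq_0_if_constant[of "-K" _ _ 0])
      (use that 0 K(1) in \<open>auto simp: compact_imp_closed open_Compl\<close>)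
  with K 0 u show thesis by (intro that[of K])
qed

section \<open>Integration of compactly supported functions\<close>

lemma integrable_compact_support:
  fixes f :: "'a::euclidean_space \<Rightarrow> 'b::{banach, second_countable_topology}"
  assumes "compact K" "continuous_on K f" "\<And>x. x \<notin> K \<Longrightarrow> f x = 0"
  shows "integrable lborel f"
proof -
  have "(\<lambda>x. indicator K x *\<^sub>R f x) = f" using assms(3) by (auto simp: indicator_def fun_eq_iff)
  then show ?thesis using borel_integrable_compact[OF assms(1,2)] by simp
qed

lemma integral_lborel_translate:
  fixes f :: "'a::euclidean_space \<Rightarrow> real"
  assumes "f \<in> borel_measurable borel"
  shows "(\<integral>x. f (c + x) \<partial>lborel) = (\<integral>x. f x \<partial>lborel)"
proof -
  have "(\<integral>x. f x \<partial>distr lborel borel ((+) c)) = (\<integral>x. f (c + x) \<partial>lborel)"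
    using assms by (intro integral_distr) auto
  then show ?thesis by (simp add: lborel_distr_plus)
qed

text \<open>By translation invariance the derivative may be replaced by its average over the unit
  segment from x to x + b. The fundamental theorem of calculus turns this average into f(x + b) -
  f(x), whose integral is 0. Fubini is applied to the product of the space with the segment
  parameter.\<close>

lemma integral_partial_deriv_zero:
  fixes f :: "'a::euclidean_space \<Rightarrow> real"
  assumes f: "smooth_on UNIV f" and K: "compact K" "\<And>x. x \<notin> K \<Longrightarrow> f x = 0" "\<And>x. x \<notin> K \<Longrightarrow> grad f x = 0"
    and b: "b \<in> Basis"
  shows "(\<integral>x. partial_deriv b f x \<partial>lborel) = 0"
proof -
  let ?d = "partial_deriv b f"
  have d0: "?d x = 0" if "x \<notin> K" for x using K(3)[OF that] grad_inner_Basis[OF b, of f x] by simp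
  have cont: "continuous_on UNIV f" "continuous_on UNIV ?d"
    using f b by (auto intro: smooth_on_continuous smooth_on_partial_deriv)
  define g where "g = (\<lambda>(s::real, x). indicator {0..1} s * ?d (x + s *\<^sub>R b))"
  \<comment> \<open>Contains the support of \<open>g\<close>, that is the pairs with s in the unit
    interval and x + s b in \<open>K\<close>. Written as a continuous image of a compact set, it is
    compact.\<close>
  define K' where "K' = (\<lambda>(s::real, y). (s, y - s *\<^sub>R b)) ` ({0..1} \<times> K)"
  have int_g: "integrable (lborel \<Otimes>\<^sub>M lborel) g"
    unfolding lborel_prod
  proof (rule integrable_compact_support)
    show "compact K'"
      unfolding K'_def by (intro compact_continuous_image compact_Times K)
        (auto intro!: continuous_intros simp: case_prod_beta)
    have "continuous_on K' (\<lambda>z. ?d (snd z + fst z *\<^sub>R b))"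
      by (intro continuous_on_compose2[OF cont(2)] continuous_intros) auto
    then show "continuous_on K' g"
      by (rule continuous_on_eq) (auto simp: K'_def g_def)
    fix z assume "z \<notin> K'"
    then have "\<not> (fst z \<in> {0..1} \<and> snd z + fst z *\<^sub>R b \<in> K)"
      by (force simp: K'_def image_iff)
    then show "g z = 0" using d0 by (auto simp: g_def case_prod_beta indicator_def)
  qed
  have fubini: "(\<integral>s. (\<integral>x. g (s, x) \<partial>lborel) \<partial>lborel) = (\<integral>x. (\<integral>s. g (s, x) \<partial>lborel) \<partial>lborel)"
    using lborel_pair.Fubini_integral[of "\<lambda>s x. g (s, x)"] int_g by simp
  have ftc: "(\<integral>s. g (s, x) \<partial>lborel) = f (b + x) - f x" for x
  proof -
    have "((\<lambda>s. f (x + s *\<^sub>R b)) has_real_derivative ?d (x + s *\<^sub>R b)) (at s)" for s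
    proof -
      have "((\<lambda>s. x + s *\<^sub>R b) has_derivative (\<lambda>h. h *\<^sub>R b)) (at s)"
        by (auto intro!: derivative_eq_intros)
      from has_derivative_compose[OF this smooth_on_has_derivative[OF f UNIV_I]]
      show ?thesis
        using b by (simp add: has_field_derivative_def grad_inner_Basis mult.commute[of _ "?d _"])
    qed
    moreover have "isCont (\<lambda>s. ?d (x + s *\<^sub>R b)) s" for s
      by (rule isCont_o2[of _ "\<lambda>s. x + s *\<^sub>R b"]) (use cont(2) in \<open>auto simp: continuous_on_eq_continuous_at intro!: continuous_intros\<close>)
    ultimately have "(\<integral>s. ?d (x + s *\<^sub>R b) * indicator {0..1} s \<partial>lborel) = f (x + b) - f x"
      using integral_FTC_Icc_real[of 0 1 "\<lambda>s. f (x + s *\<^sub>R b)" "\<lambda>s. ?d (x + s *\<^sub>R b)"] by simp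
    then show ?thesis by (simp add: g_def mult.commute add.commute)
  qed
  have zero: "(\<integral>x. f (b + x) - f x \<partial>lborel) = 0"
  proof -
    have m: "f \<in> borel_measurable borel" using cont(1) by (rule borel_measurable_continuous_onI)
    have i: "integrable lborel f" using K cont(1) by (intro integrable_compact_support[of K]) (auto intro: continuous_on_subset)
    have "integrable (distr lborel borel ((+) b)) f" using i by (simp add: lborel_distr_plus)
    then have "integrable lborel (\<lambda>x. f (b + x))" using m by (subst (asm) integrable_distr_eq) auto
    then show ?thesis using i integral_lborel_translate[OF m] by simp
  qed
  have inner: "(\<integral>x. g (s, x) \<partial>lborel) = indicator {0..1} s * (\<integral>x. ?d x \<partial>lborel)" for s
  proof -
    have "(\<integral>x. ?d (s *\<^sub>R b + x) \<partial>lborel) = (\<integral>x. ?d x \<partial>lborel)"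
      using cont(2) by (intro integral_lborel_translate borel_measurable_continuous_onI)
    then show ?thesis by (simp add: g_def add.commute)
  qed
  show ?thesis using fubini unfolding ftc inner zero by simp
qed

lemma integral_lebesgue_on_eq_lborel:
  fixes f :: "'a::euclidean_space \<Rightarrow> real"
  assumes "f \<in> borel_measurable borel" "\<And>x. x \<notin> \<Omega> \<Longrightarrow> f x = 0" "\<Omega> \<in> sets lebesgue"
  shows "(\<integral>x. f x \<partial>lebesgue_on \<Omega>) = (\<integral>x. f x \<partial>lborel)"
proof -
  have "(\<lambda>x. indicator \<Omega> x *\<^sub>R f x) = f" using assms(2) by (auto simp: indicator_def fun_eq_iff)
  then show ?thesis
    using assms by (simp add: integral_restrict_space integral_completion)
qed

section \<open>Inversion in the unit sphere\<close>

text \<open>The change of variables theorem of the library is stated for \<open>real ^ 'm\<close> with a well-ordered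
  index type; \<open>coord\<close> provides one with the right number of elements for every Euclidean space.\<close>

typedef (overloaded) ('a::euclidean_space) coord = "{..<DIM('a)}"
  by (auto intro: exI[of _ 0])

setup_lifting type_definition_coord

instantiation coord :: (euclidean_space) linorder
begin
lift_definition less_eq_coord :: "'a coord \<Rightarrow> 'a coord \<Rightarrow> bool" is "(\<le>)" .
lift_definition less_coord :: "'a coord \<Rightarrow> 'a coord \<Rightarrow> bool" is "(<)" .
instance by standard (transfer; auto)+
end

instance coord :: (euclidean_space) wellorder
proof
  fix P :: "'a coord \<Rightarrow> bool" and a
  assume *: "\<And>x. (\<And>y. y < x \<Longrightarrow> P y) \<Longrightarrow> P x"
  show "P a"
    by (induction a rule: measure_induct_rule[of Rep_coord]) (auto intro: * simp: less_coord.rep_eq)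
qed

lemma UNIV_coord: "(UNIV :: 'a::euclidean_space coord set) = Abs_coord ` {..<DIM('a)}"
  using type_definition.Abs_image[OF type_definition_coord] by metis

instance coord :: (euclidean_space) finite
  by standard (simp add: UNIV_coord)

lemma card_coord: "CARD('a::euclidean_space coord) = DIM('a)"
  using type_definition.card[OF type_definition_coord[where 'a='a]] by simp

text \<open>As \<open>inverse 0 = 0\<close>, the origin is fixed and the inversion is an involution
  of the whole space.\<close>

definition inversion :: "'a::real_inner \<Rightarrow> 'a" where
  "inversion x = inverse (x \<bullet> x) *\<^sub>R x"

lemma inversion_inner: "inversion x \<bullet> inversion x = inverse (x \<bullet> x)"
  by (cases "x = 0") (simp_all add: inversion_def)

lemma inversion_inversion: "inversion (inversion x) = x"
  by (cases "x = 0") (simp_all add: inversion_inner inversion_def[of "inversion x"], simp_all add: inversion_def)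

lemma inversion_eq_0_iff: "inversion x = 0 \<longleftrightarrow> x = 0"
  by (simp add: inversion_def)

text \<open>The derivative is a multiple of the reflection in the hyperplane orthogonal to x. This
  is the conformality of the inversion, and it yields the Jacobian below.\<close>

lemma has_derivative_inversion:
  fixes x :: "'a::real_inner"
  assumes "x \<noteq> 0"
  shows "(inversion has_derivative (\<lambda>h. inverse (x \<bullet> x) *\<^sub>R (h - (2 * (x \<bullet> h) / (x \<bullet> x)) *\<^sub>R x))) (at x within S)"
  unfolding inversion_def using assms
  by (auto intro!: derivative_eq_intros simp: fun_eq_iff algebra_simps inner_commute power2_eq_square divide_simps)

lemma orthogonal_reflection:
  fixes x :: "'a::euclidean_space"
  assumes "x \<noteq> 0"
  shows "orthogonal_transformation (\<lambda>h. h - (2 * (x \<bullet> h) / (x \<bullet> x)) *\<^sub>R x)"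
  unfolding orthogonal_transformation_def
proof
  show "linear (\<lambda>h. h - (2 * (x \<bullet> h) / (x \<bullet> x)) *\<^sub>R x)"
    by (rule linearI) (simp_all add: algebra_simps inner_add_right add_divide_distrib)
qed (use assms in \<open>auto simp: inner_diff_left inner_diff_right inner_commute field_simps\<close>)

lemma inversion_change_of_variables_vec:
  fixes F :: "real^'m::{finite,wellorder} \<Rightarrow> real"
  assumes "integrable lebesgue F"
  shows "integrable lebesgue (\<lambda>x. inverse (x \<bullet> x) ^ CARD('m) * F (inversion x))"
    and "(\<integral>x. inverse (x \<bullet> x) ^ CARD('m) * F (inversion x) \<partial>lebesgue) = (\<integral>x. F x \<partial>lebesgue)"
proof -
  define S :: "(real^'m::_) set" where "S = -{0}"
  define D where "D x h = inverse (x \<bullet> x) *\<^sub>R (h - (2 * (x \<bullet> h) / (x \<bullet> x)) *\<^sub>R x)" for x h :: "real^'m::_"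
  have S: "S \<in> sets lebesgue" by (simp add: S_def)
  have der: "(inversion has_derivative D x) (at x within S)" if "x \<in> S" for x
    using has_derivative_inversion[of x S] that by (simp add: S_def D_def[abs_def])
  have inj: "inj_on inversion S" by (rule inj_on_inverseI[of _ inversion]) (rule inversion_inversion)
  have img: "inversion ` S = S"
  proof
    show "inversion ` S \<subseteq> S" by (auto simp: S_def inversion_eq_0_iff)
    show "S \<subseteq> inversion ` S"
    proof
      fix x assume "x \<in> S"
      then have "inversion x \<in> S" by (simp add: S_def inversion_eq_0_iff)
      then show "x \<in> inversion ` S" by (rule rev_image_eqI) (simp add: inversion_inversion)
    qed
  qed
  \<comment> \<open>The derivative is an orthogonal map followed by a scaling, so only the scaling
    contributes to the modulus of the determinant.\<close>
  have det: "\<bar>det (matrix (D x))\<bar> = inverse (x \<bullet> x) ^ CARD('m)" if "x \<in> S" for x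
  proof -
    have o: "orthogonal_transformation (\<lambda>h. h - (2 * (x \<bullet> h) / (x \<bullet> x)) *\<^sub>R x)" (is "orthogonal_transformation ?R")
      using that by (intro orthogonal_reflection) (simp add: S_def)
    have "matrix (D x) = matrix ((*\<^sub>R) (inverse (x \<bullet> x))) ** matrix ?R"
      using matrix_compose[of ?R "(*\<^sub>R) (inverse (x \<bullet> x))"] o
      by (simp add: D_def[abs_def] o_def orthogonal_transformation_linear linear_scaleR)
    then show ?thesis using orthogonal_transformation_det[OF o] by (simp add: det_mul abs_mult power_abs)
  qed
  have F0: "integrable lebesgue (\<lambda>x. indicator S x *\<^sub>R F x)"
    using assms S by (rule integrable_mult_indicator[rotated])
  then have "F absolutely_integrable_on S" by (simp add: set_integrable_def)
  \<comment> \<open>The change of variables theorem speaks of vector-valued functions;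
    \<open>F\<close> is carried through it as a function into \<open>real ^ 1\<close>.\<close>
  then have "(\<lambda>x. vec (F x) :: real^1) absolutely_integrable_on inversion ` S"
    by (simp add: absolutely_integrable_on_1_iff img)
  then have *: "(\<lambda>x. \<bar>det (matrix (D x))\<bar> *\<^sub>R (vec (F (inversion x)) :: real^1)) absolutely_integrable_on S \<and>
      integral S (\<lambda>x. \<bar>det (matrix (D x))\<bar> *\<^sub>R (vec (F (inversion x)) :: real^1)) = integral S (\<lambda>x. vec (F x))"
    using has_absolute_integral_change_of_variables[OF S der inj, of "\<lambda>x. vec (F x) :: real^1" "integral S (\<lambda>x. vec (F x))"]
    by (simp add: img)
  let ?G = "\<lambda>x. inverse (x \<bullet> x) ^ CARD('m) * F (inversion x)"
  have G: "?G absolutely_integrable_on S" and int: "integral S ?G = integral S F"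
    using * by (auto simp: absolutely_integrable_on_1_iff integral_on_1_eq det vec_eq_iff
        cong: set_integrable_cong Henstock_Kurzweil_Integration.integral_cong)
  have GS: "(\<lambda>x. indicator S x *\<^sub>R ?G x) = ?G"
    by (auto simp: S_def fun_eq_iff indicator_def)
  show 1: "integrable lebesgue ?G" using G unfolding set_integrable_def GS .
  have "(\<integral>x. ?G x \<partial>lebesgue) = integral S ?G"
    using set_lebesgue_integral_eq_integral(2)[OF G] unfolding set_lebesgue_integral_def GS by simp
  also have "\<dots> = (\<integral>x. indicator S x *\<^sub>R F x \<partial>lebesgue)"
    using set_lebesgue_integral_eq_integral(2)[OF \<open>F absolutely_integrable_on S\<close>] int
    unfolding set_lebesgue_integral_def by simp
  also have "\<dots> = (\<integral>x. F x \<partial>lebesgue)"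
  proof (rule integral_cong_AE)
    have "{0} \<in> null_sets (lebesgue :: (real^'m::_) measure)" by simp
    then show "AE x in lebesgue. indicator S x *\<^sub>R F x = F x"
      by (rule AE_I') (auto simp: S_def indicator_def)
  qed (use F0 assms in auto)
  finally show "(\<integral>x. ?G x \<partial>lebesgue) = (\<integral>x. F x \<partial>lebesgue)" .
qed

text \<open>Transfers the change of variables to an arbitrary Euclidean space. Matching basis
  vectors with indices gives a linear isometry under which boxes correspond to boxes with the same
  side lengths, so Lebesgue measure is preserved.\<close>

lemma obtain_coordinates:
  obtains T :: "real ^ ('a::euclidean_space coord) \<Rightarrow> 'a"
  where "linear T" "\<And>x y. T x \<bullet> T y = x \<bullet> y" "distr lborel borel T = lborel"
proof -
  obtain h :: "'a \<Rightarrow> 'a coord" where h: "bij_betw h Basis UNIV"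
    using finite_same_card_bij[of "Basis :: 'a set" "UNIV :: 'a coord set"] by (auto simp: card_coord)
  define T where "T z = (\<Sum>b\<in>Basis. (z $ h b) *\<^sub>R b)" for z :: "real ^ 'a coord"
  have Tb: "T z \<bullet> b = z $ h b" if "b \<in> Basis" for z b
    using that by (simp add: T_def inner_sum_left inner_Basis if_distrib cong: if_cong)
  have lin: "linear T"
    by (rule linearI) (simp_all add: T_def algebra_simps sum.distrib scaleR_sum_right)
  have inner: "T x \<bullet> T y = x \<bullet> y" for x y
  proof -
    have "T x \<bullet> T y = (\<Sum>b\<in>Basis. x $ h b * y $ h b)"
      by (subst euclidean_inner) (simp add: Tb)
    also have "\<dots> = x \<bullet> y"
      by (simp add: inner_vec_def sum.reindex_bij_betw[OF h, of "\<lambda>i. x $ i * y $ i"])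
    finally show ?thesis .
  qed
  have meas: "T \<in> borel_measurable borel"
    using lin by (intro borel_measurable_continuous_onI linear_continuous_on linear_conv_bounded_linear[THEN iffD1])
  have "lborel = distr lborel borel T"
  proof (rule lborel_eqI)
    fix l u :: 'a assume lu: "\<And>b. b \<in> Basis \<Longrightarrow> l \<bullet> b \<le> u \<bullet> b"
    define g where "g = inv_into Basis h"
    have g: "g i \<in> Basis" "h (g i) = i" for i
      using h by (auto simp: g_def bij_betw_def inv_into_into f_inv_into_f)
    have hall: "(\<forall>b\<in>Basis. P b (h b)) \<longleftrightarrow> (\<forall>i. P (g i) i)" for P
      using g h by (metis bij_betw_imp_inj_on inj_on_eq_iff)
    let ?v = "\<lambda>x. \<chi> i. x \<bullet> g i"
    have "T -` box l u = box (?v l) (?v u)"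
      unfolding box_def by (auto simp: Tb hall[of "\<lambda>b i. l \<bullet> b < _ $ i \<and> _ $ i < u \<bullet> b"] Basis_vec_def cart_eq_inner_axis[symmetric] inner_axis)

    then have "emeasure (distr lborel borel T) (box l u) = emeasure lborel (box (?v l) (?v u))"
      using meas by (simp add: emeasure_distr)
    also have "\<dots> = (\<Prod>b\<in>Basis. (?v u - ?v l) \<bullet> b)"
      using lu g by (intro emeasure_lborel_box) (auto simp: Basis_vec_def inner_axis)
    also have "(\<Prod>b\<in>Basis. (?v u - ?v l) \<bullet> b) = (\<Prod>i\<in>UNIV. (u - l) \<bullet> g i)"
      by (rule prod.reindex_bij_witness[of _ "\<lambda>i. axis i 1" "\<lambda>b. SOME i. b = axis i 1"])
         (auto simp: Basis_vec_def inner_axis inner_diff_left axis_eq_axis)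
    also have "\<dots> = (\<Prod>b\<in>Basis. (u - l) \<bullet> b)"
      using bij_betw_inv_into[OF h] unfolding g_def[symmetric]
      by (rule prod.reindex_bij_betw)
    finally show "emeasure (distr lborel borel T) (box l u) = (\<Prod>b\<in>Basis. (u - l) \<bullet> b)" .
  qed simp
  with that lin inner show thesis by simp
qed

lemma inversion_change_of_variables:
  fixes F :: "'a::euclidean_space \<Rightarrow> real"
  assumes F: "integrable lborel F"
  shows "integrable lborel (\<lambda>x. inverse (x \<bullet> x) ^ DIM('a) * F (inversion x))" (is "integrable _ ?G")
    and "(\<integral>x. inverse (x \<bullet> x) ^ DIM('a) * F (inversion x) \<partial>lborel) = (\<integral>x. F x \<partial>lborel)"
proof -
  obtain T :: "real ^ 'a coord \<Rightarrow> 'a" where T: "linear T" "\<And>x y. T x \<bullet> T y = x \<bullet> y" "distr lborel borel T = lborel"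
    using obtain_coordinates by blast
  have [measurable]: "T \<in> borel_measurable borel"
    using T(1) by (intro borel_measurable_continuous_onI linear_continuous_on linear_conv_bounded_linear[THEN iffD1])
  have [measurable]: "F \<in> borel_measurable borel" using F by auto
  have [measurable]: "(inversion :: 'a \<Rightarrow> 'a) \<in> borel_measurable borel"
    "(inversion :: real^'a coord \<Rightarrow> _) \<in> borel_measurable borel"
    unfolding inversion_def by measurable
  have Tinv: "T (inversion x) = inversion (T x)" for x
    by (simp add: inversion_def T linear_scale[OF T(1)])
  have FT: "integrable lborel (\<lambda>x. F (T x))"
    using F by (subst (asm) T(3)[symmetric], subst (asm) integrable_distr_eq) auto
  then have FT': "integrable lebesgue (\<lambda>x. F (T x))" by (simp add: integrable_completion)
  note * = inversion_change_of_variables_vec[OF FT', unfolded Tinv card_coord]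
  have GT: "?G (T x) = inverse (x \<bullet> x) ^ DIM('a) * F (inversion (T x))" for x by (simp add: T)
  have "integrable lborel (\<lambda>x. ?G (T x))"
    using *(1) unfolding GT by (subst (asm) integrable_completion) auto
  then show "integrable lborel ?G"
    by (subst T(3)[symmetric], subst integrable_distr_eq) auto
  have "(\<integral>x. ?G x \<partial>lborel) = (\<integral>x. ?G (T x) \<partial>lborel)"
    by (subst T(3)[symmetric], subst integral_distr) auto
  also have "\<dots> = (\<integral>x. F (T x) \<partial>lborel)"
    using *(2) unfolding GT by (subst (asm) (1 2) integral_completion) auto
  also have "\<dots> = (\<integral>x. F x \<partial>distr lborel borel T)"
    by (subst integral_distr) auto
  also have "\<dots> = (\<integral>x. F x \<partial>lborel)"
    by (simp only: T(3))
  finally show "(\<integral>x. ?G x \<partial>lborel) = (\<integral>x. F x \<partial>lborel)" .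
qed

section \<open>Affine changes of variables\<close>

lemma integral_lborel_affine:
  fixes f :: "'a::euclidean_space \<Rightarrow> real"
  assumes "f \<in> borel_measurable borel" "c \<noteq> 0"
  shows "(\<integral>x. f x \<partial>lborel) = \<bar>c\<bar> ^ DIM('a) * (\<integral>x. f (t + c *\<^sub>R x) \<partial>lborel)"
proof -
  have "(\<integral>x. f x \<partial>lborel) = (\<integral>x. f x \<partial>density (distr lborel borel (\<lambda>x. t + c *\<^sub>R x)) (\<lambda>_. ennreal (\<bar>c\<bar> ^ DIM('a))))"
    using lborel_affine[OF assms(2), of t] by (simp add: ennreal_power)
  also have "\<dots> = \<bar>c\<bar> ^ DIM('a) * (\<integral>x. f x \<partial>distr lborel borel (\<lambda>x. t + c *\<^sub>R x))"
    using assms(1) by (subst integral_density) auto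
  also have "(\<integral>x. f x \<partial>distr lborel borel (\<lambda>x. t + c *\<^sub>R x)) = (\<integral>x. f (t + c *\<^sub>R x) \<partial>lborel)"
    using assms(1) by (intro integral_distr) auto
  finally show ?thesis .
qed

lemma test_functions_affine:
  fixes u :: "'a::euclidean_space \<Rightarrow> real"
  assumes u: "u \<in> test_functions \<Omega>" and c: "c \<noteq> 0"
  shows "(\<lambda>x. u (t + c *\<^sub>R x)) \<in> test_functions {x. t + c *\<^sub>R x \<in> \<Omega>}"
proof -
  obtain K where K: "compact K" "K \<subseteq> \<Omega>" "\<And>x. x \<notin> K \<Longrightarrow> u x = 0" and s: "smooth_on UNIV u"
    using test_functionsE[OF u] by metis
  let ?K = "(\<lambda>y. (1 / c) *\<^sub>R (y - t)) ` K"
  have mem: "x \<in> ?K \<longleftrightarrow> t + c *\<^sub>R x \<in> K" for x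
  proof
    assume "t + c *\<^sub>R x \<in> K"
    then show "x \<in> ?K" by (rule rev_image_eqI) (use c in simp)
  qed (use c in auto)
  show ?thesis
  proof (rule test_functionsI[of UNIV _ ?K])
    show "smooth_on UNIV (\<lambda>x. u (t + c *\<^sub>R x))"
      by (rule smooth_on_compose[OF _ s])
        (simp_all add: inner_add_left smooth_on_add smooth_on_mult smooth_on_const smooth_on_linear bounded_linear_inner_left)
    show "compact ?K" by (intro compact_continuous_image K continuous_intros)
    show "?K \<subseteq> {x. t + c *\<^sub>R x \<in> \<Omega>}" using K(2) c by auto
    show "u (t + c *\<^sub>R x) = 0" if "x \<notin> ?K" for x using that mem K(3) by blast
  qed auto
qed

lemma grad_affine:
  fixes u :: "'a::euclidean_space \<Rightarrow> real"
  assumes "smooth_on UNIV u"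
  shows "grad (\<lambda>x. u (t + c *\<^sub>R x)) x = c *\<^sub>R grad u (t + c *\<^sub>R x)"
proof (rule grad_eqI)
  have "((\<lambda>x. t + c *\<^sub>R x) has_derivative (\<lambda>h. c *\<^sub>R h)) (at x)"
    by (auto intro!: derivative_eq_intros)
  from has_derivative_compose[OF this smooth_on_has_derivative[OF assms UNIV_I]]
  show "((\<lambda>x. u (t + c *\<^sub>R x)) has_derivative (\<lambda>h. (c *\<^sub>R grad u (t + c *\<^sub>R x)) \<bullet> h)) (at x)"
    by (simp add: mult.commute)
qed

lemma test_functions_measurable:
  assumes "u \<in> test_functions \<Omega>"
  shows "u \<in> borel_measurable borel" "grad u \<in> borel_measurable borel"
  using test_functionsE[OF assms]
  by (metis borel_measurable_continuous_onI smooth_on_continuous smooth_on_continuous_grad)+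

lemma test_functions_smooth: "u \<in> test_functions \<Omega> \<Longrightarrow> smooth_on UNIV u"
  by (simp add: test_functions_iff)

lemma integral_grad_affine:
  fixes u :: "'a::euclidean_space \<Rightarrow> real"
  assumes u: "u \<in> test_functions \<Omega>" and c: "c \<noteq> 0"
  shows "\<bar>c\<bar> ^ DIM('a) * (\<integral>x. (norm (grad (\<lambda>x. u (t + c *\<^sub>R x)) x))\<^sup>2 \<partial>lborel) = c\<^sup>2 * energy u"
proof -
  note [measurable] = test_functions_measurable[OF u]
  show ?thesis
    using integral_lborel_affine[OF _ c, of "\<lambda>x. (norm (grad u x))\<^sup>2" t]
    by (simp add: grad_affine[OF test_functions_smooth[OF u]] power_mult_distrib)
qed

section \<open>The Kelvin transform\<close>

lemma smooth_on_inner_self: "open S \<Longrightarrow> smooth_on S (\<lambda>x::'a::euclidean_space. x \<bullet> x)"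
  by (subst euclidean_inner) (intro smooth_on_sum smooth_on_mult smooth_on_linear bounded_linear_inner_left)

lemma smooth_on_inverse:
  assumes "open S" "smooth_on S f" "\<And>x. x \<in> S \<Longrightarrow> f x > 0"
  shows "smooth_on S (\<lambda>x. inverse (f x))"
  by (rule smooth_on_cong[OF assms(1) _ smooth_on_powr[OF assms, of "-1"]])
    (use assms(3) in \<open>auto simp: powr_minus less_imp_le\<close>)

lemma compact_inversion: "compact K \<Longrightarrow> 0 \<notin> K \<Longrightarrow> compact (inversion ` K :: 'a::euclidean_space set)"
  unfolding inversion_def by (intro compact_continuous_image continuous_intros) auto

lemma inversion_mem_iff: "inversion x \<in> K \<longleftrightarrow> x \<in> inversion ` K"
  by (metis image_iff inversion_inversion)

text \<open>The factor is |y|^(-(N-2)) with N = \<open>DIM('a)\<close>, written as a power of |y|^2,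
  which is smooth and positive off the origin.\<close>

definition kelvin :: "('a::euclidean_space \<Rightarrow> real) \<Rightarrow> 'a \<Rightarrow> real" where
  "kelvin u y = (y \<bullet> y) powr (- (real DIM('a) - 2) / 2) * u (inversion y)"

lemma kelvin_test_functions:
  fixes u :: "'a::euclidean_space \<Rightarrow> real"
  assumes u: "u \<in> test_functions \<Omega>" and 0: "0 \<notin> \<Omega>"
  shows "kelvin u \<in> test_functions (inversion ` \<Omega>)"
proof -
  obtain K where K: "compact K" "K \<subseteq> \<Omega>" "\<And>x. x \<notin> K \<Longrightarrow> u x = 0" and s: "smooth_on UNIV u"
    using test_functionsE[OF u] by metis
  have K0: "0 \<notin> K" using K 0 by auto
  have o: "open (-{0::'a})" by auto
  show ?thesis
  proof (rule test_functionsI[of "-{0}" _ "inversion ` K"])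
    have comp: "smooth_on (-{0}) (\<lambda>y::'a. inverse (y \<bullet> y) * (y \<bullet> c))" for c
      by (intro smooth_on_mult smooth_on_inverse smooth_on_inner_self smooth_on_linear bounded_linear_inner_left o) auto
    have "smooth_on (-{0}) (\<lambda>y::'a. u (inversion y))"
      by (rule smooth_on_compose[OF o s])
        (simp_all add: inversion_def comp)
    then show "smooth_on (-{0}) (kelvin u)"
      unfolding kelvin_def by (intro smooth_on_mult smooth_on_powr smooth_on_inner_self o) auto
    show "compact (inversion ` K)" using K K0 by (intro compact_inversion)
    show "inversion ` K \<subseteq> - {0}" using K0 by (auto simp: inversion_eq_0_iff)
    show "kelvin u x = 0" if "x \<notin> inversion ` K" for x
      using that K(3) by (simp add: kelvin_def inversion_mem_iff[symmetric])
  qed (use K in auto)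
qed

text \<open>The powers of |y| combine to the Jacobian of the inversion. Besides |grad u|^2 the
  bracket contains two terms that together are m times the divergence of the field u^2 x / |x|^2;
  they disappear on integration in \<open>kelvin_energy\<close>.\<close>

lemma kelvin_grad:
  fixes u :: "'a::euclidean_space \<Rightarrow> real"
  assumes u: "smooth_on UNIV u" and y: "y \<noteq> 0"
  defines "x \<equiv> inversion y" and "m \<equiv> real DIM('a) - 2"
  shows "(norm (grad (kelvin u) y))\<^sup>2 = inverse (y \<bullet> y) ^ DIM('a) *
    (m\<^sup>2 * (u x)\<^sup>2 * inverse (x \<bullet> x) + (norm (grad u x))\<^sup>2 + 2 * m * u x * (x \<bullet> grad u x) * inverse (x \<bullet> x))"
proof -
  define q where "q = y \<bullet> y"
  have q: "q > 0" using y by (simp add: q_def)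
  define g where "g = grad u x"
  define P where "P = q powr (- m / 2)"
  have xx: "x \<bullet> x = 1 / q" by (simp add: x_def inversion_inner q_def inverse_eq_divide)
  have xg: "x \<bullet> g = (y \<bullet> g) / q" by (simp add: x_def inversion_def q_def divide_simps)
  define G where "G = (- m * P / q * u x) *\<^sub>R y + (P / q) *\<^sub>R (g - (2 * (y \<bullet> g) / q) *\<^sub>R y)"
  have d1: "((\<lambda>y. (y \<bullet> y) powr (- m / 2)) has_derivative (\<lambda>h. - m * P / q * (y \<bullet> h))) (at y)"
    using q unfolding q_def P_def
    by (auto intro!: derivative_eq_intros simp: fun_eq_iff inner_commute powr_diff field_simps)
  have d2: "((\<lambda>y. u (inversion y)) has_derivative
      (\<lambda>h. g \<bullet> (inverse q *\<^sub>R (h - (2 * (y \<bullet> h) / q) *\<^sub>R y)))) (at y)"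
    using has_derivative_compose[OF has_derivative_inversion[OF y] smooth_on_has_derivative[OF u UNIV_I]]
    by (simp add: q_def g_def x_def)
  have "(kelvin u has_derivative (\<lambda>h. P * (g \<bullet> (inverse q *\<^sub>R (h - (2 * (y \<bullet> h) / q) *\<^sub>R y)))
      + (- m * P / q * (y \<bullet> h)) * u x)) (at y)"
    using has_derivative_mult[OF d1 d2] unfolding kelvin_def[abs_def]
    by (simp add: m_def P_def q_def x_def)
  also have "(\<lambda>h. P * (g \<bullet> (inverse q *\<^sub>R (h - (2 * (y \<bullet> h) / q) *\<^sub>R y)))
      + (- m * P / q * (y \<bullet> h)) * u x) = (\<lambda>h. G \<bullet> h)"
    by (simp add: G_def fun_eq_iff algebra_simps inner_add_left inner_diff_left inner_diff_right divide_inverse inner_commute)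
  finally have "grad (kelvin u) y = G" by (rule grad_eqI)
  then have "(norm (grad (kelvin u) y))\<^sup>2 = G \<bullet> G" by (simp add: power2_norm_eq_inner)
  also have "\<dots> = (P / q)\<^sup>2 * (m\<^sup>2 * (u x)\<^sup>2 * q + g \<bullet> g + 2 * m * u x * (y \<bullet> g))"
    using q by (simp add: G_def inner_add_left inner_add_right inner_diff_left inner_diff_right inner_commute
        q_def[symmetric] power2_eq_square field_simps)
  \<comment> \<open>The conformal factor squared times the squared power weight: q^(-m-2) with m + 2
    = N.\<close>
  also have "(P / q)\<^sup>2 = inverse q ^ DIM('a)"
  proof -
    have "(P / q)\<^sup>2 = (q powr (- m / 2 - 1)) powr 2" using q by (simp add: P_def powr_diff)
    also have "\<dots> = q powr (- real DIM('a))"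
      unfolding powr_powr by (rule arg_cong[where f="(powr) q"]) (simp add: m_def field_simps)
    also have "\<dots> = inverse q ^ DIM('a)" using q by (simp add: powr_minus powr_realpow power_inverse)
    finally show ?thesis .
  qed
  finally show ?thesis
    unfolding g_def[symmetric] xx xg q_def[symmetric] using q by (simp add: power2_norm_eq_inner)
qed

lemma kelvin_energy:
  fixes u :: "'a::euclidean_space \<Rightarrow> real"
  assumes u: "u \<in> test_functions \<Omega>" and 0: "0 \<notin> \<Omega>"
  shows "(\<integral>y. (norm (grad (kelvin u) y))\<^sup>2 \<partial>lborel) = energy u"
proof -
  obtain K where K: "compact K" "K \<subseteq> \<Omega>" "\<And>x. x \<notin> K \<Longrightarrow> u x = 0" "\<And>x. x \<notin> K \<Longrightarrow> grad u x = 0"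
    and s: "smooth_on UNIV u"
    using test_functionsE[OF u] by metis
  have K0: "0 \<notin> K" using K 0 by auto
  define m where "m = real DIM('a) - 2"
  define H where "H x = m\<^sup>2 * (u x)\<^sup>2 * inverse (x \<bullet> x) + (norm (grad u x))\<^sup>2 + 2 * m * u x * (x \<bullet> grad u x) * inverse (x \<bullet> x)" for x
  \<comment> \<open>The components of the field u^2 x / |x|^2. It is smooth everywhere because the
    support of u avoids the origin, so the integral of its divergence is 0.\<close>
  define f where "f b x = (u x * u x) * ((x \<bullet> b) * inverse (x \<bullet> x))" for b x
  have f0: "f b x = 0" if "x \<notin> K" for b x using K(3)[OF that] by (simp add: f_def)
  have f_smooth: "smooth_on UNIV (f b)" for b
  proof (rule smooth_on_extend[of "-{0}" _ K])
    show "smooth_on (-{0}) (f b)" unfolding f_def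
      by (intro smooth_on_mult smooth_on_subset[OF s] smooth_on_linear bounded_linear_inner_left smooth_on_inverse smooth_on_inner_self) auto
  qed (use K K0 f0 in \<open>auto simp: compact_imp_closed\<close>)
  have der: "(f b has_derivative (\<lambda>h. (u x * u x) * ((x \<bullet> b) * (- 2 * (x \<bullet> h) * inverse (x \<bullet> x) ^ 2) + (h \<bullet> b) * inverse (x \<bullet> x))
      + (2 * u x * (grad u x \<bullet> h)) * ((x \<bullet> b) * inverse (x \<bullet> x)))) (at x)" if "x \<noteq> 0" for b x
    unfolding f_def using that
    by (auto intro!: derivative_eq_intros smooth_on_has_derivative[OF s] simp: fun_eq_iff algebra_simps inner_commute power2_eq_square)
  have gf0: "grad (f b) x = 0" if "x \<notin> K" for b x
    by (rule grad_eq_0_if_constant[of "-K" _ _ 0])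
      (use that f0 K(1) in \<open>auto simp: compact_imp_closed open_Compl\<close>)
  have df: "partial_deriv b (f b) x = u x * u x * (1 - 2 * (x \<bullet> b) * (x \<bullet> b) * inverse (x \<bullet> x)) * inverse (x \<bullet> x)
      + 2 * u x * ((x \<bullet> b) * (grad u x \<bullet> b)) * inverse (x \<bullet> x)" if b: "b \<in> Basis" for x and b :: 'a
  proof (cases "x = 0")
    case True
    then have "x \<notin> K" using K0 by simp
    then show ?thesis using True gf0[OF \<open>x \<notin> K\<close>, of b] grad_inner_Basis[OF b, of "f b" x] by simp
  next
    case False
    show ?thesis using b
      by (simp add: partial_deriv_eq[OF der[OF False]] algebra_simps power2_eq_square)
  qed
  have H: "H x = (norm (grad u x))\<^sup>2 + m * (\<Sum>b\<in>Basis. partial_deriv b (f b) x)" for x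
  proof (cases "x = 0")
    case True
    then show ?thesis using K K0 by (simp add: H_def df)
  next
    case False
    have "(\<Sum>b\<in>Basis. partial_deriv b (f b) x) = (\<Sum>b\<in>Basis. u x * u x * inverse (x \<bullet> x)
        - 2 * (u x * u x) * inverse (x \<bullet> x) ^ 2 * ((x \<bullet> b) * (x \<bullet> b))
        + 2 * u x * inverse (x \<bullet> x) * ((x \<bullet> b) * (grad u x \<bullet> b)))"
      by (intro sum.cong refl) (simp add: df algebra_simps power2_eq_square)
    also have "\<dots> = DIM('a) * (u x * u x * inverse (x \<bullet> x)) - 2 * (u x * u x) * inverse (x \<bullet> x) ^ 2 * (x \<bullet> x)
        + 2 * u x * inverse (x \<bullet> x) * (x \<bullet> grad u x)"
      by (simp add: sum.distrib sum_subtractf sum_distrib_left[symmetric] euclidean_inner[symmetric])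
    also have "\<dots> = m * (u x * u x) * inverse (x \<bullet> x) + 2 * u x * inverse (x \<bullet> x) * (x \<bullet> grad u x)"
      using False by (simp add: m_def power2_eq_square algebra_simps)
    finally show ?thesis by (simp add: H_def algebra_simps power2_eq_square)
  qed
  have int_df: "integrable lborel (partial_deriv b (f b))" if b: "b \<in> Basis" for b
  proof (rule integrable_compact_support[OF K(1)])
    show "continuous_on K (partial_deriv b (f b))"
      using smooth_on_continuous[OF smooth_on_partial_deriv[OF f_smooth b]] by (rule continuous_on_subset) simp
    show "partial_deriv b (f b) x = 0" if "x \<notin> K" for x
      using gf0[OF that, of b] grad_inner_Basis[OF b, of "f b" x] by simp
  qed
  have int_g: "integrable lborel (\<lambda>x. (norm (grad u x))\<^sup>2)"
    using smooth_on_continuous_grad[OF s] K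
    by (intro integrable_compact_support[OF K(1)]) (auto intro!: continuous_intros intro: continuous_on_subset)
  have int_H: "integrable lborel H"
    unfolding H[abs_def] using int_df int_g by (intro Bochner_Integration.integrable_add) auto
  have "(\<integral>y. (norm (grad (kelvin u) y))\<^sup>2 \<partial>lborel) = (\<integral>y. inverse (y \<bullet> y) ^ DIM('a) * H (inversion y) \<partial>lborel)"
  proof (rule integral_cong_AE)
    show "AE y in lborel. (norm (grad (kelvin u) y))\<^sup>2 = inverse (y \<bullet> y) ^ DIM('a) * H (inversion y)"
      by (rule eventually_mono[OF AE_lborel_singleton[of 0]]) (simp add: kelvin_grad[OF s] H_def m_def)
    note [measurable] = test_functions_measurable[OF kelvin_test_functions[OF u 0]]
    show "(\<lambda>y. (norm (grad (kelvin u) y))\<^sup>2) \<in> borel_measurable lborel" by measurable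
    show "(\<lambda>y. inverse (y \<bullet> y) ^ DIM('a) * H (inversion y)) \<in> borel_measurable lborel"
      using inversion_change_of_variables(1)[OF int_H] by auto
  qed
  also have "\<dots> = (\<integral>x. H x \<partial>lborel)" by (rule inversion_change_of_variables(2)[OF int_H])
  also have "\<dots> = energy u + m * (\<Sum>b\<in>Basis. \<integral>x. partial_deriv b (f b) x \<partial>lborel)"
    unfolding H using int_df int_g by (subst Bochner_Integration.integral_add) auto
  also have "(\<Sum>b\<in>Basis. \<integral>x. partial_deriv b (f b) x \<partial>lborel) = 0"
    using integral_partial_deriv_zero[OF f_smooth K(1) f0 gf0] by simp
  finally show ?thesis by simp
qed

lemma test_functions_mono: "u \<in> test_functions S \<Longrightarrow> S \<subseteq> T \<Longrightarrow> u \<in> test_functions T"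
  by (auto simp: test_functions_def)

section \<open>Weighted potentials\<close>

lemma continuous_on_potential:
  fixes W u :: "'a::euclidean_space \<Rightarrow> real"
  assumes "continuous_on K u" "continuous_on K W" "\<And>x. x \<in> K \<Longrightarrow> W x > 0" "p > 0"
  shows "continuous_on K (\<lambda>x. W x powr g * \<bar>u x\<bar> powr p)"
proof -
  have "continuous_on K (\<lambda>x. W x powr g)"
    using assms by (intro continuous_on_powr continuous_on_const) (auto dest: assms(3))
  moreover have "continuous_on K (\<lambda>x. \<bar>u x\<bar> powr p)"
    using assms by (intro continuous_on_powr' continuous_on_const continuous_on_rabs) auto
  ultimately show ?thesis by (rule continuous_on_mult)
qed

lemma integrable_potential:
  fixes u :: "'a::euclidean_space \<Rightarrow> real"
  assumes u: "u \<in> test_functions \<Omega>" and W: "continuous_on \<Omega> W" "\<And>x. x \<in> \<Omega> \<Longrightarrow> W x > 0" and p: "p > 0"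
  shows "integrable lborel (\<lambda>x. W x powr g * \<bar>u x\<bar> powr p)"
proof -
  obtain K where K: "compact K" "K \<subseteq> \<Omega>" "\<And>x. x \<notin> K \<Longrightarrow> u x = 0" and s: "smooth_on UNIV u"
    using test_functionsE[OF u] by metis
  show ?thesis
  proof (rule integrable_compact_support[OF K(1)])
    show "continuous_on K (\<lambda>x. W x powr g * \<bar>u x\<bar> powr p)"
      using K p W(2) by (intro continuous_on_potential continuous_on_subset[OF W(1)]
          continuous_on_subset[OF smooth_on_continuous[OF s]]) auto
  qed (use K(3) in simp)
qed

lemma AE_eq_0_imp_eq_0:
  fixes u :: "'a::euclidean_space \<Rightarrow> real"
  assumes "continuous_on UNIV u" "AE x in lborel. u x = 0"
  shows "u x = 0"
proof (rule ccontr)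
  assume "u x \<noteq> 0"
  have o: "open {x. u x \<noteq> 0}"
    using assms(1) by (intro open_Collect_neq continuous_on_const)
  moreover have "negligible {x. u x \<noteq> 0}"
    using assms(2) unfolding negligible_iff_null_sets eventually_ae_filter
    by (auto intro: completion.complete2 null_sets_completionI)
  ultimately show False using \<open>u x \<noteq> 0\<close> open_not_negligible by blast
qed

lemma potential_pos:
  fixes u :: "'a::euclidean_space \<Rightarrow> real"
  assumes u: "u \<in> test_functions \<Omega>" "u \<noteq> (\<lambda>x. 0)" and W: "continuous_on \<Omega> W" "\<And>x. x \<in> \<Omega> \<Longrightarrow> W x > 0" and p: "p > 0"
  shows "(\<integral>x. W x powr g * \<bar>u x\<bar> powr p \<partial>lborel) > 0"
proof (rule ccontr)
  obtain K where K: "compact K" "K \<subseteq> \<Omega>" "\<And>x. x \<notin> K \<Longrightarrow> u x = 0" and s: "smooth_on UNIV u"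
    using test_functionsE[OF u(1)] by metis
  assume "\<not> ?thesis"
  moreover have "(\<integral>x. W x powr g * \<bar>u x\<bar> powr p \<partial>lborel) \<ge> 0"
    by (intro Bochner_Integration.integral_nonneg) simp
  ultimately have "(\<integral>x. W x powr g * \<bar>u x\<bar> powr p \<partial>lborel) = 0" by simp
  then have "AE x in lborel. W x powr g * \<bar>u x\<bar> powr p = 0"
    using integrable_potential[OF u(1) W p] by (subst (asm) integral_nonneg_eq_0_iff_AE) auto
  then have "AE x in lborel. u x = 0"
  proof (rule eventually_mono)
    fix x assume *: "W x powr g * \<bar>u x\<bar> powr p = 0"
    show "u x = 0"
    proof (rule ccontr)
      assume "u x \<noteq> 0"
      then have "W x > 0" using K W by blast
      with * \<open>u x \<noteq> 0\<close> show False by simp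
    qed
  qed
  then show False using AE_eq_0_imp_eq_0[OF smooth_on_continuous[OF s]] u(2) by blast
qed

text \<open>The relation between g and p is the conformal balance: with q = |y|^2 the Jacobian
  contributes q^(-N) and the weight q^(-g), and the product is exactly the power q^(-(N-2)p/2) that
  the Kelvin transform carries.\<close>

lemma kelvin_potential:
  fixes u :: "'a::euclidean_space \<Rightarrow> real"
  assumes u: "u \<in> test_functions \<Omega>" and 0: "0 \<notin> \<Omega>"
    and W: "continuous_on UNIV W" "\<And>x. x \<in> \<Omega> \<Longrightarrow> W (inversion x) > 0" and p: "p > 0"
    and g: "g = (real DIM('a) - 2) / 2 * p - real DIM('a)"
  shows "(\<integral>y. W y powr g * \<bar>kelvin u y\<bar> powr p \<partial>lborel) =
    (\<integral>x. ((x \<bullet> x) * W (inversion x)) powr g * \<bar>u x\<bar> powr p \<partial>lborel)"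
proof -
  let ?F = "\<lambda>x. ((x \<bullet> x) * W (inversion x)) powr g * \<bar>u x\<bar> powr p"
  have "continuous_on \<Omega> (\<lambda>x. (x \<bullet> x) * W (inversion x))"
    unfolding inversion_def using 0
    by (intro continuous_intros continuous_on_compose2[OF W(1)]) auto
  then have "integrable lborel ?F"
    by (rule integrable_potential[OF u _ _ p]) (use W(2) 0 in \<open>auto intro!: mult_pos_pos\<close>)
  then have cov: "(\<integral>x. ?F x \<partial>lborel) = (\<integral>y. inverse (y \<bullet> y) ^ DIM('a) * ?F (inversion y) \<partial>lborel)"
    by (rule inversion_change_of_variables(2)[symmetric])
  have pw: "inverse (y \<bullet> y) ^ DIM('a) * ?F (inversion y) = W y powr g * \<bar>kelvin u y\<bar> powr p" for y
  proof (cases "y = 0 \<or> u (inversion y) = 0")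
    case True
    then show ?thesis by (auto simp: kelvin_def)
  next
    case False
    then have "inversion y \<in> \<Omega>" using test_functionsE[OF u] by (metis subsetD)
    then have W': "W y > 0" using W(2)[of "inversion y"] by (simp add: inversion_inversion)
    define q where "q = y \<bullet> y"
    have q: "q > 0" using False by (simp add: q_def)
    have "inverse (y \<bullet> y) ^ DIM('a) * ?F (inversion y) =
        q powr (- real DIM('a)) * (q powr (-1) * W y) powr g * \<bar>u (inversion y)\<bar> powr p"
      using q by (simp add: inversion_inner inversion_inversion q_def[symmetric] powr_minus powr_realpow power_inverse)
    also have "\<dots> = (q powr (- real DIM('a)) * q powr (-g)) * W y powr g * \<bar>u (inversion y)\<bar> powr p"
      using q W' by (simp add: powr_divide powr_minus_divide)
    also have "q powr (- real DIM('a)) * q powr (-g) = q powr (- (real DIM('a) - 2) / 2 * p)"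
      unfolding powr_add[symmetric] by (rule arg_cong[where f="(powr) q"]) (simp add: g field_simps)
    also have "\<dots> * W y powr g * \<bar>u (inversion y)\<bar> powr p = W y powr g * \<bar>kelvin u y\<bar> powr p"
      using q by (simp add: kelvin_def q_def[symmetric] abs_mult powr_mult powr_powr)
    finally show ?thesis .
  qed
  show ?thesis by (simp only: cov pw)
qed

lemma ball_to_half_space:
  fixes \<phi> :: "'a::euclidean_space \<Rightarrow> real" and e :: 'a
  assumes \<phi>: "\<phi> \<in> test_functions (ball 0 1)" and e: "norm e = 1" and p: "p > 0"
    and g: "g = (real DIM('a) - 2) / 2 * p - real DIM('a)"
  obtains w where "w \<in> test_functions {z. z \<bullet> e > 0}"
    "energy w = energy \<phi>"
    "(\<integral>x. (x \<bullet> e) powr g * \<bar>w x\<bar> powr p \<partial>lborel) = (\<integral>x. ((1 - x \<bullet> x) / 2) powr g * \<bar>\<phi> x\<bar> powr p \<partial>lborel)"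
proof -
  have ee: "e \<bullet> e = 1" using e by (simp add: norm_eq_1)
  define u where "u = (\<lambda>x. \<phi> (- e + 1 *\<^sub>R x))"
  define \<Omega> where "\<Omega> = {x. - e + 1 *\<^sub>R x \<in> ball 0 1}"
  define w where "w = (\<lambda>z. kelvin u ((1/2) *\<^sub>R e + 1 *\<^sub>R z))"
  have u: "u \<in> test_functions \<Omega>" unfolding u_def \<Omega>_def by (rule test_functions_affine[OF \<phi>]) simp
  \<comment> \<open>The origin lies on the boundary sphere of the ball around e, so the support of u
    stays away from the centre of inversion.\<close>
  have 0: "0 \<notin> \<Omega>" using e by (simp add: \<Omega>_def)
  have v: "kelvin u \<in> test_functions (inversion ` \<Omega>)" by (rule kelvin_test_functions[OF u 0])
  have eq: "x \<bullet> e - (x \<bullet> x) / 2 = (1 - (- e + x) \<bullet> (- e + x)) / 2" for x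
    by (simp add: inner_diff_left inner_diff_right inner_commute ee algebra_simps)
  \<comment> \<open>The height of \<open>inversion x\<close> above the bounding hyperplane,
    multiplied by |x|^2, is the conformal weight of the ball around e. It is this product that
    \<open>kelvin_potential\<close> produces.\<close>
  have eq2: "(x \<bullet> x) * (inversion x \<bullet> e - 1 / 2) = (1 - (- e + x) \<bullet> (- e + x)) / 2" for x
    unfolding eq[symmetric] by (cases "x = 0") (simp_all add: inversion_def field_simps)
  have pos: "inversion x \<bullet> e - 1 / 2 > 0" if "x \<in> \<Omega>" for x
  proof -
    have x0: "x \<bullet> x > 0" using that 0 by auto
    have "norm (- e + x) < 1" using that by (simp add: \<Omega>_def)
    then have "(- e + x) \<bullet> (- e + x) < 1"
      by (simp add: power2_norm_eq_inner[symmetric] abs_square_less_1)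
    then have "x \<bullet> e - (x \<bullet> x) / 2 > 0" unfolding eq by simp
    then show ?thesis using x0 by (simp add: inversion_def field_simps)
  qed
  show thesis
  proof
    have "w \<in> test_functions {z. (1/2) *\<^sub>R e + 1 *\<^sub>R z \<in> inversion ` \<Omega>}"
      unfolding w_def by (rule test_functions_affine[OF v]) simp
    then show "w \<in> test_functions {z. z \<bullet> e > 0}"
    proof (rule test_functions_mono, safe)
      fix z x assume z: "(1/2) *\<^sub>R e + 1 *\<^sub>R z = inversion x" "x \<in> \<Omega>"
      have "z \<bullet> e = inversion x \<bullet> e - 1 / 2"
        using z(1)[symmetric] by (simp add: inner_add_left ee)
      then show "z \<bullet> e > 0" using pos[OF z(2)] by simp
    qed
    have "energy w = energy (kelvin u)"
      using integral_grad_affine[OF v, of 1 "(1/2) *\<^sub>R e"] by (simp add: w_def)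
    also have "\<dots> = energy u" by (rule kelvin_energy[OF u 0])
    also have "\<dots> = energy \<phi>"
      using integral_grad_affine[OF \<phi>, of 1 "- e"] by (simp add: u_def)
    finally show "energy w = energy \<phi>" .
    note [measurable] = test_functions_measurable[OF v] test_functions_measurable[OF \<phi>]
    have "(\<integral>x. (x \<bullet> e) powr g * \<bar>w x\<bar> powr p \<partial>lborel) = (\<integral>y. (y \<bullet> e - 1 / 2) powr g * \<bar>kelvin u y\<bar> powr p \<partial>lborel)"
      using integral_lborel_affine[of "\<lambda>y. (y \<bullet> e - 1 / 2) powr g * \<bar>kelvin u y\<bar> powr p" 1 "(1/2) *\<^sub>R e"]
      by (simp add: inner_add_left ee w_def)
    also have "\<dots> = (\<integral>x. ((x \<bullet> x) * (inversion x \<bullet> e - 1 / 2)) powr g * \<bar>u x\<bar> powr p \<partial>lborel)"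
      by (rule kelvin_potential[OF u 0 _ _ p g]) (rule pos | intro continuous_intros)+
    also have "\<dots> = (\<integral>x. ((1 - (- e + x) \<bullet> (- e + x)) / 2) powr g * \<bar>u x\<bar> powr p \<partial>lborel)"
      by (simp only: eq2)
    also have "\<dots> = (\<integral>x. ((1 - x \<bullet> x) / 2) powr g * \<bar>\<phi> x\<bar> powr p \<partial>lborel)"
      using integral_lborel_affine[of "\<lambda>x. ((1 - x \<bullet> x) / 2) powr g * \<bar>\<phi> x\<bar> powr p" 1 "- e"]
      by (simp add: u_def)
    finally show "(\<integral>x. (x \<bullet> e) powr g * \<bar>w x\<bar> powr p \<partial>lborel) = (\<integral>x. ((1 - x \<bullet> x) / 2) powr g * \<bar>\<phi> x\<bar> powr p \<partial>lborel)" .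
  qed
qed

text \<open>In the last bound R^N comes from the change of variables and R^g from the weight. The
  explicit form of \<phi> is passed on because \<phi> \<noteq> 0 has to be concluded from w \<noteq>
  0.\<close>

lemma half_space_to_ball:
  fixes w :: "'a::euclidean_space \<Rightarrow> real"
  assumes w: "w \<in> test_functions {z. z \<bullet> e > 0}" and e: "norm e = 1" and p: "p > 0" and g: "g \<le> 0"
  obtains \<phi> R where "\<phi> \<in> test_functions (ball 0 1)" "R > 0" "\<phi> = (\<lambda>x. w (R *\<^sub>R e + R *\<^sub>R x))"
    "R ^ DIM('a) * energy \<phi> = R\<^sup>2 * energy w"
    "(\<integral>x. (x \<bullet> e) powr g * \<bar>w x\<bar> powr p \<partial>lborel)
       \<le> R powr (real DIM('a) + g) * (\<integral>x. (1 - norm x) powr g * \<bar>\<phi> x\<bar> powr p \<partial>lborel)"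
proof -
  have ee: "e \<bullet> e = 1" using e by (simp add: norm_eq_1)
  define K where "K = closure {z. w z \<noteq> 0}"
  have K: "compact K" "K \<subseteq> {z. z \<bullet> e > 0}" and wK: "w \<in> test_functions K"
    using w by (simp_all add: K_def test_functions_def)
  \<comment> \<open>A point z with z \<bullet> e > 0 satisfies |z - R e| < R exactly if this
    quotient is below R. It is bounded on the compact support, so some R serves all points at
    once.\<close>
  have "bounded ((\<lambda>z. (z \<bullet> z) / (2 * (z \<bullet> e))) ` K)"
    using K by (intro compact_imp_bounded compact_continuous_image continuous_intros) auto
  then obtain B where B: "\<And>z. z \<in> K \<Longrightarrow> \<bar>(z \<bullet> z) / (2 * (z \<bullet> e))\<bar> \<le> B"
    by (auto simp: bounded_iff)
  define R where "R = \<bar>B\<bar> + 1"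
  have R: "R > 0" by (simp add: R_def add_nonneg_pos)
  define \<phi> where "\<phi> = (\<lambda>x. w (R *\<^sub>R e + R *\<^sub>R x))"
  have R': "R \<noteq> 0" using R by simp
  have "\<phi> \<in> test_functions {x. R *\<^sub>R e + R *\<^sub>R x \<in> K}"
    unfolding \<phi>_def by (rule test_functions_affine[OF wK R'])
  then have \<phi>: "\<phi> \<in> test_functions (ball 0 1)"
  proof (rule test_functions_mono, safe)
    fix x assume x: "R *\<^sub>R e + R *\<^sub>R x \<in> K"
    define z where "z = R *\<^sub>R e + R *\<^sub>R x"
    have z: "z \<bullet> e > 0" "z \<in> K" using x K by (auto simp: z_def)
    have "(z \<bullet> z) / (2 * (z \<bullet> e)) < R"
      using B[OF z(2)] abs_ge_self[of "(z \<bullet> z) / (2 * (z \<bullet> e))"] abs_ge_self[of B] unfolding R_def by linarith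
    then have "z \<bullet> z < 2 * R * (z \<bullet> e)" using z by (simp add: field_simps)
    moreover have "z \<bullet> z = R * R * (1 + 2 * (x \<bullet> e) + x \<bullet> x)" "z \<bullet> e = R * (1 + x \<bullet> e)"
      by (simp_all add: z_def inner_add_left inner_add_right inner_commute ee algebra_simps)
    ultimately have "R * R * (1 + 2 * (x \<bullet> e) + x \<bullet> x) < R * R * (2 + 2 * (x \<bullet> e))"
      by (simp add: algebra_simps)
    then have "x \<bullet> x < 1" using R by (simp add: mult_less_cancel_left)
    then show "x \<in> ball 0 1" by (simp add: norm_eq_sqrt_inner)
  qed
  note [measurable] = test_functions_measurable[OF w] test_functions_measurable[OF \<phi>]
  have ball: "norm x < 1" if "\<phi> x \<noteq> 0" for x
    using test_functionsE[OF \<phi>] that by (metis dist_0_norm mem_ball subsetD)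
  have i1: "integrable lborel (\<lambda>x. (1 - norm x) powr g * \<bar>\<phi> x\<bar> powr p)"
    by (rule integrable_potential[OF \<phi> _ _ p]) (auto intro!: continuous_intros)
  have pos: "1 - norm x \<le> 1 + x \<bullet> e" for x
    using Cauchy_Schwarz_ineq2[of x e] e by simp
  have "(\<integral>x. (x \<bullet> e) powr g * \<bar>w x\<bar> powr p \<partial>lborel) =
      R ^ DIM('a) * (\<integral>x. (R * (1 + x \<bullet> e)) powr g * \<bar>\<phi> x\<bar> powr p \<partial>lborel)"
    using integral_lborel_affine[OF _ R', of "\<lambda>x. (x \<bullet> e) powr g * \<bar>w x\<bar> powr p" "R *\<^sub>R e"] R
    by (simp add: \<phi>_def inner_add_left ee algebra_simps)
  also have "(\<integral>x. (R * (1 + x \<bullet> e)) powr g * \<bar>\<phi> x\<bar> powr p \<partial>lborel) \<le>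
      (\<integral>x. R powr g * ((1 - norm x) powr g * \<bar>\<phi> x\<bar> powr p) \<partial>lborel)"
  proof (rule integral_mono')
    show "integrable lborel (\<lambda>x. R powr g * ((1 - norm x) powr g * \<bar>\<phi> x\<bar> powr p))"
      using i1 by simp
    fix x show "(R * (1 + x \<bullet> e)) powr g * \<bar>\<phi> x\<bar> powr p \<le> R powr g * ((1 - norm x) powr g * \<bar>\<phi> x\<bar> powr p)"
    proof (cases "\<phi> x = 0")
      case False
      then have "norm x < 1" by (rule ball)
      then have "(1 + x \<bullet> e) powr g \<le> (1 - norm x) powr g"
        using pos[of x] g by (intro powr_mono2') auto
      moreover have "1 + x \<bullet> e \<ge> 0" using pos[of x] \<open>norm x < 1\<close> by simp
      ultimately show ?thesis using R by (simp add: powr_mult mult_left_mono mult_right_mono)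
    qed simp
  qed (use R in auto)
  also have "\<dots> = R powr g * (\<integral>x. (1 - norm x) powr g * \<bar>\<phi> x\<bar> powr p \<partial>lborel)" by simp
  finally have "(\<integral>x. (x \<bullet> e) powr g * \<bar>w x\<bar> powr p \<partial>lborel)
       \<le> R powr (real DIM('a) + g) * (\<integral>x. (1 - norm x) powr g * \<bar>\<phi> x\<bar> powr p \<partial>lborel)"
    using R by (simp add: powr_add powr_realpow mult_left_mono)
  then show thesis
    using that[OF \<phi> R \<phi>_def] integral_grad_affine[OF w R', of "R *\<^sub>R e"] R by (simp add: \<phi>_def)
qed

section \<open>Cutoff functions\<close>

text \<open>With s = 1/t the jth derivative of exp (-1/t) is P(s) exp (-s) for a polynomial P. Since
  ds/dt = -s^2, one more differentiation replaces P by s^2 (P - P').\<close>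

primrec flat_poly :: "nat \<Rightarrow> real poly" where
  "flat_poly 0 = 1"
| "flat_poly (Suc j) = [:0, 0, 1:] * (flat_poly j - pderiv (flat_poly j))"

definition flat :: "nat \<Rightarrow> real \<Rightarrow> real" where
  "flat j t = (if t > 0 then poly (flat_poly j) (1 / t) * exp (- 1 / t) else 0)"

lemma poly_exp_tendsto_0: "((\<lambda>s::real. poly q s * exp (- s)) \<longlongrightarrow> 0) at_top"
proof -
  have "((\<lambda>s::real. \<Sum>i\<le>degree q. coeff q i * (s ^ i / exp s)) \<longlongrightarrow> (\<Sum>i\<le>degree q. coeff q i * 0)) at_top"
    by (intro tendsto_sum tendsto_mult tendsto_const tendsto_power_div_exp_0)
  then show ?thesis
    by (simp add: poly_altdef sum_distrib_right exp_minus divide_inverse mult.assoc)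
qed

lemma has_real_derivative_flat: "(flat j has_real_derivative flat (Suc j) t) (at t)"
proof -
  consider "t > 0" | "t < 0" | "t = 0" by linarith
  then show ?thesis
  proof cases
    case 1
    have "((\<lambda>t. poly (flat_poly j) (1 / t) * exp (- 1 / t)) has_real_derivative flat (Suc j) t) (at t)"
      using 1 by (auto intro!: derivative_eq_intros DERIV_chain2[OF poly_DERIV]
          simp: flat_def algebra_simps power2_eq_square divide_simps)
    then show ?thesis
      by (rule DERIV_cong_ev[OF refl _ refl, THEN iffD1, rotated])
        (use 1 in \<open>auto simp: flat_def intro!: eventually_mono[OF order_tendstoD(1)[OF tendsto_ident_at]] eventually_nhds_in_open[of "{0<..}", THEN eventually_mono]\<close>)
  next
    case 2
    have "((\<lambda>t. 0) has_real_derivative 0) (at t)" by simp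
    then show ?thesis
      using 2 by (subst DERIV_cong_ev[OF refl _ refl, of _ "\<lambda>t. 0"])
        (auto simp: flat_def intro!: eventually_nhds_in_open[of "{..<0}", THEN eventually_mono])
  next
    case 3
    \<comment> \<open>For h > 0 and s = 1/h the difference quotient is s P(s) exp (-s), again a
      polynomial times a decaying exponential.\<close>
    have "((\<lambda>h. flat j h / h) \<longlongrightarrow> 0) (at 0)"
    proof (rule filterlim_split_at)
      show "((\<lambda>h. flat j h / h) \<longlongrightarrow> 0) (at_left 0)"
        by (rule Lim_transform_eventually[OF tendsto_const])
          (auto simp: flat_def eventually_at_filter)
      have "((\<lambda>h. poly ([:0, 1:] * flat_poly j) (inverse h) * exp (- inverse h)) \<longlongrightarrow> 0) (at_right 0)"
        by (rule filterlim_compose[OF poly_exp_tendsto_0 filterlim_inverse_at_top_right])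
      then show "((\<lambda>h. flat j h / h) \<longlongrightarrow> 0) (at_right 0)"
        by (rule Lim_transform_eventually)
          (auto simp: flat_def eventually_at_filter field_simps)
    qed
    then show ?thesis using 3 by (simp add: has_field_derivative_iff flat_def)
  qed
qed

lemma obtain_cutoff:
  obtains \<psi> :: "'a::euclidean_space \<Rightarrow> real"
  where "\<psi> \<in> test_functions (cball 0 2)" "\<And>x. norm x \<le> 1 \<Longrightarrow> \<psi> x = 1"
proof -
  \<comment> \<open>\<open>N\<close> vanishes exactly for |x| \<ge> 2 and \<open>M\<close> exactly
    for |x| \<le> 1. They have no common zero, so the quotient N / (N + M) is smooth, equal to 1 on
    the unit ball and to 0 outside the ball of radius 2.\<close>
  define N where "N x = flat 0 (4 - x \<bullet> x)" for x :: 'a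
  define M where "M x = flat 0 (x \<bullet> x - 1)" for x :: 'a
  define \<psi> where "\<psi> x = N x * inverse (N x + M x)" for x
  have nonneg: "N x \<ge> 0" "M x \<ge> 0" for x by (simp_all add: N_def M_def flat_def)
  have pos: "N x + M x > 0" for x
  proof (cases "x \<bullet> x < 4")
    case True
    then have "N x > 0" by (simp add: N_def flat_def)
    then show ?thesis using nonneg[of x] by simp
  next
    case False
    then have "M x > 0" by (simp add: M_def flat_def)
    then show ?thesis using nonneg[of x] by simp
  qed
  have sm: "smooth_on UNIV N" "smooth_on UNIV M"
    unfolding N_def M_def
    by (rule smooth_on_compose_real[where T=UNIV];
        auto intro!: has_real_derivative_flat smooth_on_diff smooth_on_const smooth_on_inner_self)+
  show thesis
  proof
    show "\<psi> \<in> test_functions (cball 0 2)"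
    proof (rule test_functionsI[of UNIV _ "cball 0 2"])
      show "smooth_on UNIV \<psi>"
        unfolding \<psi>_def using sm pos by (intro smooth_on_mult smooth_on_inverse smooth_on_add) auto
      fix x :: 'a assume "x \<notin> cball 0 2"
      then have "2\<^sup>2 < (norm x)\<^sup>2" by (intro power_strict_mono) auto
      then show "\<psi> x = 0" by (simp add: \<psi>_def N_def flat_def power2_norm_eq_inner)
    qed auto
    fix x :: 'a assume "norm x \<le> 1"
    then have "(norm x)\<^sup>2 \<le> 1" by (simp add: abs_square_le_1)
    then have "M x = 0" by (simp add: M_def flat_def power2_norm_eq_inner)
    then show "\<psi> x = 1" using pos[of x] by (simp add: \<psi>_def)
  qed
qed

section \<open>The two variational problems\<close>

type_synonym 'n upper = "(real, 'n) vec \<times> real"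

lemma test_functions_zero_outside:
  assumes "u \<in> test_functions \<Omega>" "x \<notin> \<Omega>"
  shows "u x = 0"
proof (rule test_functionsE[OF assms(1)])
  fix K assume "K \<subseteq> \<Omega>" "\<And>x. x \<notin> K \<Longrightarrow> u x = 0"
  then show "u x = 0" using assms(2) by auto
qed

lemma bdry_dist_ball:
  fixes x :: "'a::euclidean_space"
  assumes "norm x < 1"
  shows "bdry_dist (ball 0 1) x = 1 - norm x"
proof -
  define y where "y = (if x = 0 then (SOME b. b \<in> Basis) else (1 / norm x) *\<^sub>R x)"
  have y: "norm y = 1" by (auto simp: y_def some_in_eq)
  have "dist x y = 1 - norm x"
  proof (cases "x = 0")
    case True
    then show ?thesis using y by simp
  next
    case False
    have "x - y = (1 - 1 / norm x) *\<^sub>R x" using False by (simp add: y_def algebra_simps)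
    then have "dist x y = \<bar>1 - 1 / norm x\<bar> * norm x" by (simp add: dist_norm)
    also have "\<dots> = \<bar>(1 - 1 / norm x) * norm x\<bar>" by (simp add: abs_mult)
    also have "\<dots> = 1 - norm x" using assms False by (simp add: left_diff_distrib)
    finally show ?thesis .
  qed
  moreover have "infdist x (sphere 0 1) \<le> dist x y" using y by (intro infdist_le) simp
  moreover have "1 - norm x \<le> infdist x (sphere 0 1)"
  proof -
    have "sphere 0 1 \<noteq> ({} :: 'a set)" using y by auto
    then show ?thesis
      by (subst infdist_notempty) (auto intro!: cINF_greatest simp: dist_norm norm_minus_commute
          intro: order_trans[OF _ norm_triangle_ineq2])
  qed
  ultimately show ?thesis by (simp add: bdry_dist_def frontier_ball)
qed

lemma half_space_eq: "(half_space :: ((real ^ 'n) \<times> real) set) = {z. z \<bullet> (0, 1) > 0}"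
  by (auto simp: half_space_def inner_prod_def)

lemma bdry_dist_half_space:
  fixes z :: "(real ^ 'n) \<times> real"
  assumes "z \<in> half_space"
  shows "bdry_dist half_space z = snd z"
proof -
  have fr: "frontier (half_space :: ((real ^ 'n) \<times> real) set) = {z. snd z = 0}"
    using frontier_halfspace_gt[of "(0, 1) :: (real ^ 'n) \<times> real" 0]
    by (simp add: half_space_eq inner_commute) (simp add: inner_prod_def zero_prod_def)
  have z: "snd z > 0" using assms by (auto simp: half_space_def)
  have "infdist z {z. snd z = 0} \<le> dist z (fst z, 0)" by (rule infdist_le) simp
  moreover have "dist z (fst z, 0) = snd z" using z by (simp add: dist_prod_def dist_norm)
  moreover have "snd z \<le> infdist z {z. snd z = 0}"
  proof -
    have "(0, 0) \<in> {z :: (real ^ 'n) \<times> real. snd z = 0}" by simp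
    then have "{z :: (real ^ 'n) \<times> real. snd z = 0} \<noteq> {}" by blast
    moreover have "snd z \<le> dist z w" if "snd w = 0" for w :: "(real ^ 'n) \<times> real"
      using dist_snd_le[of z w] that z by (simp add: dist_norm)
    ultimately show ?thesis by (subst infdist_notempty) (auto intro!: cINF_greatest)
  qed
  ultimately show ?thesis by (simp add: bdry_dist_def fr)
qed

context
  fixes \<beta> p g :: real and n :: real and ty :: "'n::finite itself"
  assumes \<beta>: "\<beta> \<ge> 0" and n: "n = real CARD('n)"
    and p: "p = 2 + 2 * \<beta> / (n + 1)" and g: "g = - 2 + (n - 1) / (n + 1) * \<beta>" and g0: "g \<le> 0"
begin

lemma p_ge_2: "p \<ge> 2"
  using \<beta> n by (simp add: p)

text \<open>The exponents of the quotient satisfy the balance required by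
  \<open>kelvin_potential\<close>. In this form g \<le> 0 reads p (N-2) \<le> 2N.\<close>

lemma g_conv: "g = (real DIM('n upper) - 2) / 2 * p - real DIM('n upper)"
proof -
  have "n + 1 > 0" using n by simp
  then have "g * (n + 1) = ((n - 1) / 2 * p - (n + 1)) * (n + 1)" by (simp add: g p field_simps)
  then have "g = (n - 1) / 2 * p - (n + 1)" using \<open>n + 1 > 0\<close> by simp
  then show ?thesis by (simp add: n)
qed

lemma J_quot_conv:
  fixes \<Omega> :: "'n upper set"
  shows "J_quot \<beta> \<Omega> u Du = (\<integral>x. (norm (Du x))\<^sup>2 \<partial>lebesgue_on \<Omega>) /
     (\<integral>x. bdry_dist \<Omega> x powr g * \<bar>u x\<bar> powr p \<partial>lebesgue_on \<Omega>) powr (2 / p)"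
proof -
  have "n + 1 > 0" using n by simp
  then have "(n + 1) / (n + \<beta> + 1) = 2 / p" using \<beta> by (simp add: p field_simps)
  then show ?thesis by (simp only: J_quot_def Let_def n[symmetric] g[symmetric] p[symmetric])
qed

lemma J_quot_test:
  fixes \<Omega> :: "'n upper set"
  assumes u: "u \<in> test_functions \<Omega>" and \<Omega>: "open \<Omega>"
    and W: "\<And>x. x \<in> \<Omega> \<Longrightarrow> bdry_dist \<Omega> x = W x" "W \<in> borel_measurable borel"
  shows "J_quot \<beta> \<Omega> u (grad u) = energy u /
     (\<integral>x. W x powr g * \<bar>u x\<bar> powr p \<partial>lborel) powr (2 / p)"
proof -
  note [measurable] = test_functions_measurable[OF u] W(2)
  obtain K where K: "K \<subseteq> \<Omega>" "\<And>x. x \<notin> K \<Longrightarrow> u x = 0" "\<And>x. x \<notin> K \<Longrightarrow> grad u x = 0"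
    using test_functionsE[OF u] by metis
  have 0: "u x = 0" "grad u x = 0" if "x \<notin> \<Omega>" for x using K that by blast+
  have "(\<integral>x. (norm (grad u x))\<^sup>2 \<partial>lebesgue_on \<Omega>) = energy u"
    using \<Omega> 0 by (intro integral_lebesgue_on_eq_lborel) auto
  moreover have "(\<integral>x. bdry_dist \<Omega> x powr g * \<bar>u x\<bar> powr p \<partial>lebesgue_on \<Omega>) = (\<integral>x. W x powr g * \<bar>u x\<bar> powr p \<partial>lebesgue_on \<Omega>)"
    using \<Omega> W(1) by (intro Bochner_Integration.integral_cong refl) (auto simp: space_restrict_space)
  moreover have "\<dots> = (\<integral>x. W x powr g * \<bar>u x\<bar> powr p \<partial>lborel)"
    using \<Omega> 0 by (intro integral_lebesgue_on_eq_lborel) auto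
  ultimately show ?thesis by (simp add: J_quot_conv)
qed

lemmas J_quot_ball = J_quot_test[OF _ open_ball, where W="\<lambda>x. 1 - norm x"]

lemma J_quot_half_space:
  fixes u :: "'n upper \<Rightarrow> real"
  assumes "u \<in> test_functions half_space"
  shows "J_quot \<beta> half_space u (grad u) = energy u /
     (\<integral>x. (x \<bullet> (0, 1)) powr g * \<bar>u x\<bar> powr p \<partial>lborel) powr (2 / p)"
proof (rule J_quot_test[OF assms])
  show "open (half_space :: 'n upper set)"
    unfolding half_space_eq by (intro open_Collect_less continuous_intros)
qed (simp_all add: bdry_dist_half_space inner_prod_def borel_measurable_continuous_onI continuous_on_snd)

lemma J_quot_nonneg: "J_quot \<beta> \<Omega> u Du \<ge> 0" for \<Omega> :: "'n upper set"
  unfolding J_quot_conv by (intro divide_nonneg_nonneg Bochner_Integration.integral_nonneg) auto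

lemma mu_le: "u \<in> test_functions \<Omega> \<Longrightarrow> u \<noteq> (\<lambda>x. 0) \<Longrightarrow> mu \<beta> \<Omega> \<le> J_quot \<beta> \<Omega> u (grad u)"
  for \<Omega> :: "'n upper set"
  unfolding mu_def by (rule cINF_lower) (auto intro: bdd_belowI2[of _ 0] J_quot_nonneg)

text \<open>An infimum of reals is bounded below by a common lower bound only if the index set is
  nonempty. The cutoff has radius 2: shrunk by the factor 3 it fits into the unit ball, lifted by 3
  it fits into the half-space.\<close>

lemma nonzero_test_functions:
  "test_functions (ball 0 1) - {\<lambda>x. 0} \<noteq> ({} :: ('n upper \<Rightarrow> real) set)"
  "test_functions half_space - {\<lambda>x. 0} \<noteq> ({} :: ('n upper \<Rightarrow> real) set)"
proof -
  obtain \<psi> :: "'n upper \<Rightarrow> real" where \<psi>: "\<psi> \<in> test_functions (cball 0 2)"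
    "\<And>x. norm x \<le> 1 \<Longrightarrow> \<psi> x = 1"
    by (rule obtain_cutoff) blast
  have "(\<lambda>x. \<psi> (0 + 3 *\<^sub>R x)) \<in> test_functions (ball 0 1)"
    by (rule test_functions_mono[OF test_functions_affine[OF \<psi>(1)]]) auto
  moreover have "(\<lambda>x. \<psi> (0 + 3 *\<^sub>R x)) \<noteq> (\<lambda>x. 0)"
  proof
    assume "(\<lambda>x. \<psi> (0 + 3 *\<^sub>R x)) = (\<lambda>x. 0)"
    from fun_cong[OF this, of 0] show False using \<psi>(2)[of 0] by simp
  qed
  ultimately show "test_functions (ball 0 1) - {\<lambda>x. 0} \<noteq> ({} :: ('n upper \<Rightarrow> real) set)" by blast
  let ?w = "\<lambda>x. \<psi> ((0, -3) + 1 *\<^sub>R x)"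
  have "?w \<in> test_functions half_space"
  proof (rule test_functions_mono[OF test_functions_affine[OF \<psi>(1)]], safe)
    fix y t assume "(0, -3) + 1 *\<^sub>R (y, t) \<in> cball (0 :: 'n upper) 2"
    then have "norm (y, t - 3) \<le> 2" by (simp add: algebra_simps)
    then have "\<bar>t - 3\<bar> \<le> 2" using norm_snd_le[of "t - 3" y] by simp
    then show "(y, t) \<in> half_space" by (simp add: half_space_def abs_le_iff)
  qed simp
  moreover have "?w \<noteq> (\<lambda>x. 0)"
  proof
    assume "?w = (\<lambda>x. 0)"
    from fun_cong[OF this, of "(0, 3)"] show False using \<psi>(2)[of 0] by (simp add: zero_prod_def)
  qed
  ultimately show "test_functions half_space - {\<lambda>x. 0} \<noteq> ({} :: ('n upper \<Rightarrow> real) set)" by blast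
qed

lemma mu_half_space_nonneg: "mu \<beta> (half_space :: 'n upper set) \<ge> 0"
  unfolding mu_def by (intro cINF_greatest nonzero_test_functions J_quot_nonneg)

lemma half_space_potential_pos:
  fixes w :: "'n upper \<Rightarrow> real"
  assumes w: "w \<in> test_functions half_space" "w \<noteq> (\<lambda>x. 0)"
  shows "(\<integral>x. (x \<bullet> (0, 1)) powr g * \<bar>w x\<bar> powr p \<partial>lborel) > 0"
proof (rule potential_pos[OF w])
  show "continuous_on half_space (\<lambda>x::'n upper. x \<bullet> (0, 1))"
    by (intro continuous_on_inner continuous_on_id continuous_on_const)
  show "p > 0" using p_ge_2 by simp
  fix x :: "'n upper" assume "x \<in> half_space"
  then show "x \<bullet> (0, 1) > 0" unfolding half_space_eq by simp
qed

lemma half_space_inequality: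
  fixes w :: "'n upper \<Rightarrow> real"
  assumes w: "w \<in> test_functions half_space"
  shows "mu \<beta> (half_space :: 'n upper set) *
      (\<integral>x. (x \<bullet> (0, 1)) powr g * \<bar>w x\<bar> powr p \<partial>lborel) powr (2 / p) \<le> energy w"
proof (cases "w = (\<lambda>x. 0)")
  case False
  have "(\<integral>x. (x \<bullet> (0, 1)) powr g * \<bar>w x\<bar> powr p \<partial>lborel) > 0"
    by (rule half_space_potential_pos[OF w False])
  then have "(\<integral>x. (x \<bullet> (0, 1)) powr g * \<bar>w x\<bar> powr p \<partial>lborel) powr (2 / p) > 0" by simp
  then show ?thesis
    using mu_le[OF w False] unfolding J_quot_half_space[OF w] by (simp add: pos_le_divide_eq)
qed simp

section \<open>Comparison of the two infima\<close>

lemma norm_e: "norm ((0, 1) :: 'n upper) = 1"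
  by (simp add: norm_prod_def)

text \<open>The half-space constant for the ball, but with the conformal weight, which for g \<le> 0
  is at least the weight of \<open>J_quot\<close>. This surplus gives the comparison of the infima
  and, when g < 0, the non-attainment.\<close>

lemma conformal_ball_inequality:
  fixes \<phi> :: "'n upper \<Rightarrow> real"
  assumes \<phi>: "\<phi> \<in> test_functions (ball 0 1)"
  shows "mu \<beta> (half_space :: 'n upper set) *
      (\<integral>x. ((1 - x \<bullet> x) / 2) powr g * \<bar>\<phi> x\<bar> powr p \<partial>lborel) powr (2 / p) \<le> energy \<phi>"
proof -
  have p0: "p > 0" using p_ge_2 by simp
  show ?thesis
  proof (rule ball_to_half_space[OF \<phi> norm_e p0 g_conv])
    fix w :: "'n upper \<Rightarrow> real"
    assume w: "w \<in> test_functions {z. z \<bullet> (0, 1) > 0}"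
      and *: "energy w = energy \<phi>"
        "(\<integral>x. (x \<bullet> (0, 1)) powr g * \<bar>w x\<bar> powr p \<partial>lborel) = (\<integral>x. ((1 - x \<bullet> x) / 2) powr g * \<bar>\<phi> x\<bar> powr p \<partial>lborel)"
    have "w \<in> test_functions half_space" using w by (simp only: half_space_eq)
    from half_space_inequality[OF this] show ?thesis by (simp only: *)
  qed
qed

lemma mu_ball_ge:
  "mu \<beta> (half_space :: 'n upper set) \<le> mu \<beta> (ball 0 1 :: 'n upper set)"
  unfolding mu_def[of \<beta> "ball 0 1"]
proof (rule cINF_greatest[OF nonzero_test_functions(1)])
  fix \<phi> :: "'n upper \<Rightarrow> real" assume "\<phi> \<in> test_functions (ball 0 1) - {\<lambda>x. 0}"
  then have \<phi>: "\<phi> \<in> test_functions (ball 0 1)" "\<phi> \<noteq> (\<lambda>x. 0)" by auto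
  have p0: "p > 0" using p_ge_2 by simp
  have ball: "norm x < 1" if "\<phi> x \<noteq> 0" for x
    using test_functions_zero_outside[OF \<phi>(1), of x] that by auto
  have sq: "x \<bullet> x < 1" if "norm x < 1" for x :: "'n upper"
    using that by (simp add: power2_norm_eq_inner[symmetric] abs_square_less_1)
  let ?P = "\<integral>x. (1 - norm x) powr g * \<bar>\<phi> x\<bar> powr p \<partial>lborel"
  let ?Q = "\<integral>x. ((1 - x \<bullet> x) / 2) powr g * \<bar>\<phi> x\<bar> powr p \<partial>lborel"
  have P: "?P > 0"
    by (rule potential_pos[OF \<phi> _ _ p0, where W="\<lambda>x. 1 - norm x"]) (auto intro!: continuous_intros)
  have "?P \<le> ?Q"
  proof (rule integral_mono')
    show "integrable lborel (\<lambda>x. ((1 - x \<bullet> x) / 2) powr g * \<bar>\<phi> x\<bar> powr p)"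
      by (rule integrable_potential[OF \<phi>(1) _ _ p0, where W="\<lambda>x. (1 - x \<bullet> x) / 2"])
        (use sq in \<open>auto intro!: continuous_intros\<close>)
    fix x show "(1 - norm x) powr g * \<bar>\<phi> x\<bar> powr p \<le> ((1 - x \<bullet> x) / 2) powr g * \<bar>\<phi> x\<bar> powr p"
    proof (cases "\<phi> x = 0")
      case False
      have "x \<bullet> x = norm x * norm x" by (simp add: power2_norm_eq_inner[symmetric] power2_eq_square)
      \<comment> \<open>The right-hand side exceeds the left-hand side by half the square of 1 -
        |x|.\<close>
      then have "(1 - x \<bullet> x) / 2 \<le> 1 - norm x"
        using zero_le_square[of "1 - norm x"] unfolding left_diff_distrib right_diff_distrib by simp
      then show ?thesis
        using sq[OF ball[OF False]] g0 by (intro mult_right_mono powr_mono2') auto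
    qed simp
  qed auto
  then have "?P powr (2 / p) \<le> ?Q powr (2 / p)" using P p0 by (intro powr_mono2) auto
  then have "mu \<beta> (half_space :: 'n upper set) * ?P powr (2 / p) \<le> energy \<phi>"
    using order_trans[OF mult_left_mono[OF _ mu_half_space_nonneg] conformal_ball_inequality[OF \<phi>(1)]]
    by blast
  moreover have "?P powr (2 / p) > 0" using P by simp
  ultimately show "mu \<beta> (half_space :: 'n upper set) \<le> J_quot \<beta> (ball 0 1) \<phi> (grad \<phi>)"
    using J_quot_ball[OF \<phi>(1)] by (simp add: bdry_dist_ball pos_le_divide_eq)
qed

lemma mu_ball_le:
  "mu \<beta> (ball 0 1 :: 'n upper set) \<le> mu \<beta> (half_space :: 'n upper set)"
  unfolding mu_def[of \<beta> half_space]
proof (rule cINF_greatest[OF nonzero_test_functions(2)])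
  fix w :: "'n upper \<Rightarrow> real" assume "w \<in> test_functions half_space - {\<lambda>x. 0}"
  then have w: "w \<in> test_functions half_space" "w \<noteq> (\<lambda>x. 0)" by auto
  have p0: "p > 0" using p_ge_2 by simp
  let ?e = "(0, 1) :: 'n upper"
  let ?N = "DIM('n upper)"
  have w': "w \<in> test_functions {z. z \<bullet> ?e > 0}" using w(1) by (simp only: half_space_eq)
  show "mu \<beta> (ball 0 1 :: 'n upper set) \<le> J_quot \<beta> half_space w (grad w)"
  proof (rule half_space_to_ball[OF w' norm_e p0 g0])
    fix \<phi> :: "'n upper \<Rightarrow> real" and R :: real
    assume \<phi>: "\<phi> \<in> test_functions (ball 0 1)" and R: "R > 0" and eq: "\<phi> = (\<lambda>x. w (R *\<^sub>R ?e + R *\<^sub>R x))"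
      and E: "R ^ ?N * energy \<phi> = R\<^sup>2 * energy w"
      and P: "(\<integral>x. (x \<bullet> ?e) powr g * \<bar>w x\<bar> powr p \<partial>lborel)
         \<le> R powr (real ?N + g) * (\<integral>x. (1 - norm x) powr g * \<bar>\<phi> x\<bar> powr p \<partial>lborel)"
    let ?Pw = "\<integral>x. (x \<bullet> ?e) powr g * \<bar>w x\<bar> powr p \<partial>lborel"
    let ?P = "\<integral>x. (1 - norm x) powr g * \<bar>\<phi> x\<bar> powr p \<partial>lborel"
    let ?Ew = "\<integral>x. (norm (grad w x))\<^sup>2 \<partial>lborel"
    let ?E = "\<integral>x. (norm (grad \<phi> x))\<^sup>2 \<partial>lborel"
    have \<phi>0: "\<phi> \<noteq> (\<lambda>x. 0)"
    proof
      assume "\<phi> = (\<lambda>x. 0)"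
      then have "\<phi> ((1 / R) *\<^sub>R (z - R *\<^sub>R ?e)) = 0" for z by simp
      then have "w z = 0" for z using R unfolding eq by simp
      then show False using w(2) by auto
    qed
    have P0: "?P > 0"
      by (rule potential_pos[OF \<phi> \<phi>0 _ _ p0, where W="\<lambda>x. 1 - norm x"]) (auto intro!: continuous_intros)
    have Pw0: "?Pw > 0"
      by (rule half_space_potential_pos[OF w])
    \<comment> \<open>The common scaling factor: the energy scales by R^(N-2), and so does the
      potential to the power 2/p, because (N + g) 2/p = N - 2.\<close>
    define a where "a = R powr (real ?N - 2)"
    have a: "a > 0" using R by (simp add: a_def)
    have "R ^ ?N = R powr (real ?N - 2 + 2)" using powr_realpow[OF R, of ?N] by (simp only: diff_add_cancel)
    also have "\<dots> = a * R\<^sup>2" using R unfolding powr_add a_def by simp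
    finally have "R ^ ?N = a * R\<^sup>2" .
    then have E': "a * ?E = ?Ew" using E R by (simp add: mult.assoc)
    have "?Pw powr (2 / p) \<le> (R powr (real ?N + g) * ?P) powr (2 / p)"
      using P Pw0 p0 by (intro powr_mono2) auto
    also have "\<dots> = (R powr (real ?N + g)) powr (2 / p) * ?P powr (2 / p)"
      using P0 by (simp add: powr_mult)
    also have "(R powr (real ?N + g)) powr (2 / p) = a"
      unfolding powr_powr a_def by (rule arg_cong[where f="(powr) R"]) (use p0 in \<open>simp add: g_conv field_simps\<close>)
    finally have le: "?Pw powr (2 / p) \<le> a * ?P powr (2 / p)" .
    have "mu \<beta> (ball 0 1 :: 'n upper set) \<le> ?E / ?P powr (2 / p)"
      using mu_le[OF \<phi> \<phi>0] J_quot_ball[OF \<phi>] by (simp add: bdry_dist_ball)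
    also have "\<dots> = ?Ew / (a * ?P powr (2 / p))" using a E'[symmetric] by simp
    also have "\<dots> \<le> ?Ew / ?Pw powr (2 / p)"
      using le Pw0 by (intro divide_left_mono Bochner_Integration.integral_nonneg) (auto intro!: mult_pos_pos a powr_gt_zero[THEN iffD2] simp: less_imp_neq[OF P0, symmetric])
    also have "\<dots> = J_quot \<beta> half_space w (grad w)" by (rule J_quot_half_space[OF w(1), symmetric])
    finally show "mu \<beta> (ball 0 1 :: 'n upper set) \<le> J_quot \<beta> half_space w (grad w)" .
  qed
qed

end

section \<open>Integration in the half-space model\<close>

lemma borel_measurable_snd_borel [measurable]:
  "(snd :: 'a::euclidean_space \<times> real \<Rightarrow> real) \<in> borel_measurable borel"
  by (intro borel_measurable_continuous_onI continuous_on_snd continuous_on_id)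

lemma borel_measurable_fst_borel [measurable]:
  "(fst :: 'a::euclidean_space \<times> real \<Rightarrow> 'a) \<in> borel_measurable borel"
  by (intro borel_measurable_continuous_onI continuous_on_fst continuous_on_id)

definition hyp_weight :: "'b::euclidean_space \<times> real \<Rightarrow> ennreal" where
  "hyp_weight x = ennreal (if snd x > 0 then snd x powr (- real DIM('b \<times> real)) else 0)"

text \<open>Hyperbolic volume of the half-space, carried as a measure on the whole space in which
  the closed lower half is a null set.\<close>

definition hyp :: "('b::euclidean_space \<times> real) measure" where
  "hyp = density lborel hyp_weight"

lemma hyp_weight_measurable [measurable]: "hyp_weight \<in> borel_measurable borel"
  unfolding hyp_weight_def by measurable

lemma sets_hyp [measurable_cong, simp]: "sets hyp = sets borel"
  by (simp add: hyp_def)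

lemma space_hyp [simp]: "space hyp = UNIV"
  by (simp add: hyp_def)

lemma nn_integral_hyp:
  "f \<in> borel_measurable borel \<Longrightarrow> (\<integral>\<^sup>+x. f x \<partial>hyp) = (\<integral>\<^sup>+x. hyp_weight x * f x \<partial>lborel)"
  unfolding hyp_def by (rule nn_integral_density) auto

lemma AE_hyp_pos: "AE x in hyp. snd x > 0"
  unfolding hyp_def by (subst AE_density) (auto simp: hyp_weight_def)

lemma sigma_finite_hyp: "sigma_finite_measure (hyp :: ('b::euclidean_space \<times> real) measure)"
  unfolding hyp_def
  by (subst sigma_finite_measure.sigma_finite_iff_density_finite[OF sigma_finite_lborel]) (auto simp: hyp_weight_def)

lemma pair_sigma_finite_hyp:
  "pair_sigma_finite (hyp :: ('b::euclidean_space \<times> real) measure) (lborel :: 'c::euclidean_space measure)"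
  by (intro pair_sigma_finite.intro sigma_finite_hyp sigma_finite_lborel)

section \<open>Displacements proportional to the height\<close>

lemma nn_integral_lborel_translate:
  fixes f :: "'a::euclidean_space \<Rightarrow> ennreal"
  assumes "f \<in> borel_measurable borel"
  shows "(\<integral>\<^sup>+x. f (x + c) \<partial>lborel) = (\<integral>\<^sup>+x. f x \<partial>lborel)"
proof -
  have "(\<integral>\<^sup>+x. f x \<partial>distr lborel borel ((+) c)) = (\<integral>\<^sup>+x. f (c + x) \<partial>lborel)"
    using assms by (intro nn_integral_distr) auto
  then show ?thesis by (simp add: lborel_distr_plus add.commute)
qed

lemma nn_integral_lborel_affine:
  fixes f :: "'a::euclidean_space \<Rightarrow> ennreal"
  assumes f: "f \<in> borel_measurable borel" and c: "c \<noteq> 0"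
  shows "(\<integral>\<^sup>+x. f x \<partial>lborel) = ennreal (\<bar>c\<bar> ^ DIM('a)) * (\<integral>\<^sup>+x. f (t + c *\<^sub>R x) \<partial>lborel)"
proof -
  have "(\<integral>\<^sup>+x. f x \<partial>lborel) = (\<integral>\<^sup>+x. f x \<partial>density (distr lborel borel (\<lambda>x. t + c *\<^sub>R x)) (\<lambda>_. ennreal (\<bar>c\<bar> ^ DIM('a))))"
    using lborel_affine[OF c, of t] by (simp add: ennreal_power)
  also have "\<dots> = ennreal (\<bar>c\<bar> ^ DIM('a)) * (\<integral>\<^sup>+x. f x \<partial>distr lborel borel (\<lambda>x. t + c *\<^sub>R x))"
    using f by (subst nn_integral_density) (auto intro!: nn_integral_cmult)
  also have "(\<integral>\<^sup>+x. f x \<partial>distr lborel borel (\<lambda>x. t + c *\<^sub>R x)) = (\<integral>\<^sup>+x. f (t + c *\<^sub>R x) \<partial>lborel)"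
    using f by (intro nn_integral_distr) auto
  finally show ?thesis .
qed

text \<open>At fixed height t the map translates the horizontal component by t a, and the height
  itself is multiplied by 1 + c. Slicing by height shows that only the latter contributes to the
  Jacobian.\<close>

lemma nn_integral_lborel_shear:
  fixes F :: "'b::euclidean_space \<times> real \<Rightarrow> ennreal"
  assumes F[measurable]: "F \<in> borel_measurable borel" and c: "c > -1"
  shows "(\<integral>\<^sup>+x. F x \<partial>lborel) = ennreal (1 + c) * (\<integral>\<^sup>+x. F (x + snd x *\<^sub>R (a, c)) \<partial>lborel)"
proof -
  define G where "G t = (\<integral>\<^sup>+y. F (y, t) \<partial>lborel)" for t
  have F2[measurable]: "F \<in> borel_measurable (borel \<Otimes>\<^sub>M borel)" using F by (simp add: borel_prod)
  have [measurable]: "G \<in> borel_measurable borel" unfolding G_def by measurable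
  have "(\<lambda>x. F (x + snd x *\<^sub>R (a, c))) \<in> borel_measurable borel" by measurable
  then have F3: "(\<lambda>x. F (x + snd x *\<^sub>R (a, c))) \<in> borel_measurable (lborel \<Otimes>\<^sub>M lborel)" by (simp add: lborel_prod)
  have "(\<integral>\<^sup>+x. F (x + snd x *\<^sub>R (a, c)) \<partial>lborel) = (\<integral>\<^sup>+t. (\<integral>\<^sup>+y. F ((y, t) + t *\<^sub>R (a, c)) \<partial>lborel) \<partial>lborel)"
    using lborel_pair.nn_integral_snd[OF F3] by (simp add: lborel_prod)
  also have "\<dots> = (\<integral>\<^sup>+t. G (0 + (1 + c) * t) \<partial>lborel)"
  proof (rule nn_integral_cong)
    fix t :: real
    have "(\<integral>\<^sup>+y. F ((y, t) + t *\<^sub>R (a, c)) \<partial>lborel) = (\<integral>\<^sup>+y. F (y + t *\<^sub>R a, 0 + (1 + c) * t) \<partial>lborel)"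
      by (simp add: algebra_simps)
    also have "\<dots> = G (0 + (1 + c) * t)" unfolding G_def
      by (rule nn_integral_lborel_translate[of "\<lambda>y. F (y, 0 + (1 + c) * t)"]) measurable
    finally show "(\<integral>\<^sup>+y. F ((y, t) + t *\<^sub>R (a, c)) \<partial>lborel) = G (0 + (1 + c) * t)" .
  qed
  finally have "ennreal (1 + c) * (\<integral>\<^sup>+x. F (x + snd x *\<^sub>R (a, c)) \<partial>lborel) = (\<integral>\<^sup>+t. G t \<partial>lborel)"
    using nn_integral_real_affine[of G "1 + c" 0] c by simp
  also have "\<dots> = (\<integral>\<^sup>+x. F x \<partial>lborel)"
    using lborel_pair.nn_integral_snd[of F] F2 unfolding G_def by (simp add: lborel_prod)
  finally show ?thesis by simp
qed

text \<open>A step proportional to the height has bounded hyperbolic length. As 1 + c lies between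
  1/2 and 3/2, the density changes by at most 2^N and the inverse of the Jacobian 1 + c is at most
  2.\<close>

lemma nn_integral_hyp_shear_le:
  fixes F :: "'b::euclidean_space \<times> real \<Rightarrow> ennreal"
  assumes F[measurable]: "F \<in> borel_measurable borel" and c: "\<bar>c\<bar> \<le> 1 / 2"
  shows "(\<integral>\<^sup>+x. F (x + snd x *\<^sub>R (a, c)) \<partial>hyp) \<le> ennreal (2 ^ (DIM('b \<times> real) + 1)) * (\<integral>\<^sup>+x. F x \<partial>hyp)"
proof -
  let ?N = "DIM('b \<times> real)"
  let ?T = "\<lambda>x::'b \<times> real. x + snd x *\<^sub>R (a, c)"
  let ?I = "\<integral>\<^sup>+x. hyp_weight (?T x) * F (?T x) \<partial>lborel"
  have w: "hyp_weight x \<le> ennreal (2 ^ ?N) * hyp_weight (?T x)" for x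
  proof (cases "snd x > 0")
    case True
    define t where "t = snd x"
    have t: "t > 0" "snd (?T x) = t * (1 + c)" using True by (auto simp: t_def algebra_simps)
    have c1: "1 + c > 0" "1 + c \<le> 2" using c by auto
    have "t powr - real ?N = t powr - real ?N * ((1 + c) powr real ?N * (1 + c) powr - real ?N)"
      using c1 unfolding powr_add[symmetric] by simp
    also have "\<dots> = (1 + c) powr ?N * (t * (1 + c)) powr - real ?N"
      using t c1 by (simp add: powr_mult del: DIM_prod)
    also have "\<dots> \<le> 2 powr ?N * (t * (1 + c)) powr - real ?N"
      using c1 by (intro mult_right_mono powr_mono2) auto
    finally have *: "t powr - real ?N \<le> 2 ^ ?N * (t * (1 + c)) powr - real ?N" by (simp add: powr_realpow del: DIM_prod)
    have "hyp_weight x = ennreal (t powr - real ?N)"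
      unfolding hyp_weight_def t_def[symmetric] using t(1) by simp
    moreover have "hyp_weight (?T x) = ennreal ((t * (1 + c)) powr - real ?N)"
      unfolding hyp_weight_def t(2) using t(1) c1 by simp
    ultimately show ?thesis using ennreal_leI[OF *] by (simp add: ennreal_mult del: DIM_prod)
  qed (simp add: hyp_weight_def)
  have "(\<integral>\<^sup>+x. F (?T x) \<partial>hyp) = (\<integral>\<^sup>+x. hyp_weight x * F (?T x) \<partial>lborel)"
    by (rule nn_integral_hyp) measurable
  also have "\<dots> \<le> (\<integral>\<^sup>+x. ennreal (2 ^ ?N) * (hyp_weight (?T x) * F (?T x)) \<partial>lborel)"
    unfolding mult.assoc[symmetric] by (intro nn_integral_mono mult_right_mono w) auto
  also have "\<dots> = ennreal (2 ^ ?N) * ?I" by (rule nn_integral_cmult) measurable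
  also have "?I \<le> ennreal 2 * (ennreal (1 + c) * ?I)"
  proof -
    have "1 * ?I \<le> ennreal (2 * (1 + c)) * ?I"
      using c by (intro mult_right_mono) auto
    moreover have "ennreal (2 * (1 + c)) = ennreal 2 * ennreal (1 + c)"
      using c by (intro ennreal_mult) auto
    ultimately show ?thesis by (simp only: mult.assoc mult_1_left)
  qed
  also have "ennreal (1 + c) * ?I = (\<integral>\<^sup>+x. hyp_weight x * F x \<partial>lborel)"
    using c by (intro nn_integral_lborel_shear[symmetric]) (auto, measurable)
  also have "\<dots> = (\<integral>\<^sup>+x. F x \<partial>hyp)" by (rule nn_integral_hyp[symmetric]) measurable
  finally show ?thesis by (simp add: ennreal_mult mult.assoc mult.left_commute mult_left_mono del: DIM_prod)
qed

lemma segment_estimate: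
  fixes V :: "'a::euclidean_space \<Rightarrow> real"
  assumes der: "\<And>s. s \<in> {0..1} \<Longrightarrow> (V has_derivative (\<lambda>k. GV (x + s *\<^sub>R h) \<bullet> k)) (at (x + s *\<^sub>R h))"
    and cont: "\<And>s. s \<in> {0..1} \<Longrightarrow> isCont GV (x + s *\<^sub>R h)"
  shows "ennreal ((V (x + h) - V x)\<^sup>2) \<le>
    (\<integral>\<^sup>+s. indicator {0..1} s * ennreal ((norm h)\<^sup>2 * (norm (GV (x + s *\<^sub>R h)))\<^sup>2) \<partial>lborel)"
proof -
  define q where "q s = GV (x + s *\<^sub>R h) \<bullet> h" for s
  define a where "a = V (x + h) - V x"
  have qc: "isCont q s" if "s \<in> {0..1}" for s
    unfolding q_def using cont[OF that]
    by (intro continuous_inner isCont_o2[where f="\<lambda>s. x + s *\<^sub>R h" and g=GV]) (auto intro!: continuous_intros)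
  have qd: "((\<lambda>s. V (x + s *\<^sub>R h)) has_real_derivative q s) (at s)" if "s \<in> {0..1}" for s
  proof -
    have "((\<lambda>s. x + s *\<^sub>R h) has_derivative (\<lambda>k. k *\<^sub>R h)) (at s)"
      by (auto intro!: derivative_eq_intros)
    from has_derivative_compose[OF this der[OF that]]
    show ?thesis by (simp add: has_field_derivative_def q_def mult_commute_abs)
  qed
  have con: "continuous_on {0..1} q" using qc by (intro continuous_at_imp_continuous_on) auto
  have i1: "integrable lborel (\<lambda>s. indicator {0..1} s *\<^sub>R q s)"
    and i2: "integrable lborel (\<lambda>s. indicator {0..1} s *\<^sub>R (q s)\<^sup>2)"
    using con by (auto intro!: borel_integrable_compact continuous_intros simp del: real_scaleR_def)
  have "(\<integral>s. q s * indicator {0..1} s \<partial>lborel) = V (x + 1 *\<^sub>R h) - V (x + 0 *\<^sub>R h)"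
    by (rule integral_FTC_Icc_real) (use qc qd in auto)
  then have int: "(\<integral>s. indicator {0..1} s *\<^sub>R q s \<partial>lborel) = a" by (simp add: a_def mult.commute)
  \<comment> \<open>The variance of \<open>q\<close> on the unit interval is nonnegative. As its
    mean is \<open>a\<close>, the mean of its square is at least \<open>a\<close> squared.\<close>
  have "0 \<le> (\<integral>s. indicator {0..1} s *\<^sub>R (q s - a)\<^sup>2 \<partial>lborel)"
    by (intro Bochner_Integration.integral_nonneg) (auto simp: indicator_def)
  also have "\<dots> = (\<integral>s. indicator {0..1} s *\<^sub>R (q s)\<^sup>2 - 2 * a * (indicator {0..1} s *\<^sub>R q s) + a\<^sup>2 * indicator {0..1} s \<partial>lborel)"
    by (intro Bochner_Integration.integral_cong refl) (auto simp: power2_eq_square algebra_simps)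
  also have "\<dots> = (\<integral>s. indicator {0..1} s *\<^sub>R (q s)\<^sup>2 \<partial>lborel) - 2 * a * a + a\<^sup>2"
    using i1 i2 int by simp
  finally have "a\<^sup>2 \<le> (\<integral>s. indicator {0..1} s *\<^sub>R (q s)\<^sup>2 \<partial>lborel)" by (simp add: power2_eq_square)
  then have "ennreal (a\<^sup>2) \<le> ennreal (\<integral>s. indicator {0..1} s *\<^sub>R (q s)\<^sup>2 \<partial>lborel)" by (rule ennreal_leI)
  also have "\<dots> = (\<integral>\<^sup>+s. ennreal (indicator {0..1} s *\<^sub>R (q s)\<^sup>2) \<partial>lborel)"
    using i2 by (intro nn_integral_eq_integral[symmetric]) auto
  also have "\<dots> \<le> (\<integral>\<^sup>+s. indicator {0..1} s * ennreal ((norm h)\<^sup>2 * (norm (GV (x + s *\<^sub>R h)))\<^sup>2) \<partial>lborel)"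
  proof (rule nn_integral_mono)
    fix s
    have "\<bar>q s\<bar> \<le> norm (GV (x + s *\<^sub>R h)) * norm h" unfolding q_def by (rule Cauchy_Schwarz_ineq2)
    then have "\<bar>q s\<bar>\<^sup>2 \<le> (norm (GV (x + s *\<^sub>R h)) * norm h)\<^sup>2" by (intro power_mono) auto
    then show "ennreal (indicator {0..1} s *\<^sub>R (q s)\<^sup>2) \<le> indicator {0..1} s * ennreal ((norm h)\<^sup>2 * (norm (GV (x + s *\<^sub>R h)))\<^sup>2)"
      by (auto simp: indicator_def power_mult_distrib mult.commute intro!: ennreal_leI)
  qed
  finally show ?thesis by (simp add: a_def)
qed

text \<open>Along the segment the height stays at least half of \<open>snd x\<close>, so a step of
  length at most r t costs 4 r^2 times the squared height at the intermediate point. Integrating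
  over x for each s by \<open>nn_integral_hyp_shear_le\<close> costs a further 2^(N+1), in total
  2^(N+3).\<close>

lemma hyp_difference_estimate:
  fixes V :: "'b::euclidean_space \<times> real \<Rightarrow> real"
  assumes [measurable]: "V \<in> borel_measurable borel" "GV \<in> borel_measurable borel"
    and der: "\<And>x. snd x > 0 \<Longrightarrow> (V has_derivative (\<lambda>k. GV x \<bullet> k)) (at x)"
    and cont: "\<And>x. snd x > 0 \<Longrightarrow> isCont GV x"
    and z: "norm z \<le> 1" and r: "0 < r" "r \<le> 1 / 2"
  shows "(\<integral>\<^sup>+x. ennreal ((V (x + (r * snd x) *\<^sub>R z) - V x)\<^sup>2) \<partial>hyp) \<le>
    ennreal (2 ^ (DIM('b \<times> real) + 3) * r\<^sup>2) * (\<integral>\<^sup>+x. ennreal ((snd x)\<^sup>2 * (norm (GV x))\<^sup>2) \<partial>hyp)"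
proof -
  interpret pair_sigma_finite "hyp :: ('b \<times> real) measure" "lborel :: real measure" by (rule pair_sigma_finite_hyp)
  let ?N = "DIM('b \<times> real)"
  let ?F = "\<lambda>x::'b \<times> real. ennreal ((snd x)\<^sup>2 * (norm (GV x))\<^sup>2)"
  have z2: "\<bar>snd z\<bar> \<le> 1" using norm_snd_le[of "snd z" "fst z"] z by simp
  have c: "\<bar>s * r * snd z\<bar> \<le> 1 / 2" if "s \<in> {0..1}" for s
  proof -
    have "\<bar>s * r * snd z\<bar> = s * r * \<bar>snd z\<bar>" using that r by (simp add: abs_mult)
    also have "\<dots> \<le> 1 * (1 / 2) * 1" using that r z2 by (intro mult_mono) auto
    finally show ?thesis by simp
  qed
  have "(\<integral>\<^sup>+x. ennreal ((V (x + (r * snd x) *\<^sub>R z) - V x)\<^sup>2) \<partial>hyp) \<le>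
      (\<integral>\<^sup>+x. (\<integral>\<^sup>+s. indicator {0..1} s * (ennreal (4 * r\<^sup>2) * ?F (x + (s * r * snd x) *\<^sub>R z)) \<partial>lborel) \<partial>hyp)"
  proof (rule nn_integral_mono_AE, rule eventually_mono[OF AE_hyp_pos])
    fix x :: "'b \<times> real" assume x: "snd x > 0"
    have sn: "snd (x + s *\<^sub>R ((r * snd x) *\<^sub>R z)) = snd x * (1 + s * r * snd z)" for s by (simp add: algebra_simps)
    have pos: "snd (x + s *\<^sub>R ((r * snd x) *\<^sub>R z)) > 0" "snd x \<le> 2 * snd (x + s *\<^sub>R ((r * snd x) *\<^sub>R z))" if "s \<in> {0..1}" for s
    proof -
      have b: "1 + s * r * snd z \<ge> 1 / 2" using c[OF that] by (simp add: abs_le_iff)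
      then show "snd (x + s *\<^sub>R ((r * snd x) *\<^sub>R z)) > 0" unfolding sn using x by (intro mult_pos_pos) auto
      have "snd x * 1 \<le> snd x * (2 * (1 + s * r * snd z))" using x b by (intro mult_left_mono) auto
      then show "snd x \<le> 2 * snd (x + s *\<^sub>R ((r * snd x) *\<^sub>R z))" unfolding sn by (simp add: algebra_simps)
    qed
    have "ennreal ((V (x + (r * snd x) *\<^sub>R z) - V x)\<^sup>2) \<le>
      (\<integral>\<^sup>+s. indicator {0..1} s * ennreal ((norm ((r * snd x) *\<^sub>R z))\<^sup>2 * (norm (GV (x + s *\<^sub>R ((r * snd x) *\<^sub>R z))))\<^sup>2) \<partial>lborel)"
      using pos by (intro segment_estimate der cont)
    also have "\<dots> \<le> (\<integral>\<^sup>+s. indicator {0..1} s * (ennreal (4 * r\<^sup>2) * ?F (x + (s * r * snd x) *\<^sub>R z)) \<partial>lborel)"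
    proof (rule nn_integral_mono)
      fix s :: real
      show "indicator {0..1} s * ennreal ((norm ((r * snd x) *\<^sub>R z))\<^sup>2 * (norm (GV (x + s *\<^sub>R ((r * snd x) *\<^sub>R z))))\<^sup>2)
        \<le> indicator {0..1} s * (ennreal (4 * r\<^sup>2) * ?F (x + (s * r * snd x) *\<^sub>R z))"
      proof (cases "s \<in> {0..1}")
        case True
        define y where "y = x + (s * r * snd x) *\<^sub>R z"
        have y: "x + s *\<^sub>R ((r * snd x) *\<^sub>R z) = y" by (simp add: y_def mult.assoc)
        have p: "snd y > 0" "snd x \<le> 2 * snd y" using pos[OF True] unfolding y by auto
        have "norm ((r * snd x) *\<^sub>R z) = r * snd x * norm z" using x r by (simp add: abs_mult)
        also have "\<dots> \<le> r * (2 * snd y) * 1"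
          by (intro mult_mono) (use p x r z in auto)
        finally have "norm ((r * snd x) *\<^sub>R z) \<le> r * (2 * snd y) * 1" .
        then have "(norm ((r * snd x) *\<^sub>R z))\<^sup>2 \<le> (r * (2 * snd y) * 1)\<^sup>2" by (intro power_mono) auto
        also have "\<dots> = 4 * r\<^sup>2 * (snd y)\<^sup>2" by (simp add: power_mult_distrib)
        finally have "(norm ((r * snd x) *\<^sub>R z))\<^sup>2 * (norm (GV y))\<^sup>2 \<le> 4 * r\<^sup>2 * ((snd y)\<^sup>2 * (norm (GV y))\<^sup>2)"
          by (simp add: mult_right_mono flip: mult.assoc)
        then show ?thesis using True unfolding y by (simp add: y_def[symmetric] flip: ennreal_mult)
      qed simp
    qed
    finally show "ennreal ((V (x + (r * snd x) *\<^sub>R z) - V x)\<^sup>2) \<le>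
      (\<integral>\<^sup>+s. indicator {0..1} s * (ennreal (4 * r\<^sup>2) * ?F (x + (s * r * snd x) *\<^sub>R z)) \<partial>lborel)" .
  qed
  also have "\<dots> = (\<integral>\<^sup>+s. (\<integral>\<^sup>+x. indicator {0..1} s * (ennreal (4 * r\<^sup>2) * ?F (x + (s * r * snd x) *\<^sub>R z)) \<partial>hyp) \<partial>lborel)"
    by (rule Fubini'[symmetric]) measurable
  also have "\<dots> \<le> (\<integral>\<^sup>+s. ennreal (4 * r\<^sup>2) * (ennreal (2 ^ (?N + 1)) * (\<integral>\<^sup>+x. ?F x \<partial>hyp)) * indicator {0..1::real} s \<partial>lborel)"
  proof (rule nn_integral_mono)
    fix s :: real
    show "(\<integral>\<^sup>+x. indicator {0..1} s * (ennreal (4 * r\<^sup>2) * ?F (x + (s * r * snd x) *\<^sub>R z)) \<partial>hyp)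
      \<le> ennreal (4 * r\<^sup>2) * (ennreal (2 ^ (?N + 1)) * (\<integral>\<^sup>+x. ?F x \<partial>hyp)) * indicator {0..1} s"
    proof (cases "s \<in> {0..1}")
      case True
      have eq: "x + (s * r * snd x) *\<^sub>R z = x + snd x *\<^sub>R ((s * r) *\<^sub>R fst z, s * r * snd z)" for x
        by (cases z) (simp add: mult.commute)
      have "(\<integral>\<^sup>+x. ennreal (4 * r\<^sup>2) * ?F (x + (s * r * snd x) *\<^sub>R z) \<partial>hyp) =
          ennreal (4 * r\<^sup>2) * (\<integral>\<^sup>+x. ?F (x + (s * r * snd x) *\<^sub>R z) \<partial>hyp)"
        by (rule nn_integral_cmult) measurable
      also have "\<dots> \<le> ennreal (4 * r\<^sup>2) * (ennreal (2 ^ (?N + 1)) * (\<integral>\<^sup>+x. ?F x \<partial>hyp))"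
        unfolding eq using c[OF True]
        by (intro mult_left_mono nn_integral_hyp_shear_le[where F="?F"]) auto
      finally show ?thesis using True by (simp del: DIM_prod)
    qed simp
  qed
  also have "\<dots> = ennreal (4 * r\<^sup>2) * (ennreal (2 ^ (?N + 1)) * (\<integral>\<^sup>+x. ?F x \<partial>hyp))"
    by (subst nn_integral_cmult_indicator) auto
  also have "\<dots> = ennreal (2 ^ (?N + 3) * r\<^sup>2) * (\<integral>\<^sup>+x. ?F x \<partial>hyp)"
  proof -
    have "4 * r\<^sup>2 * 2 ^ (?N + 1) = 2 ^ (?N + 3) * r\<^sup>2" by (simp add: power_add del: DIM_prod)
    then show ?thesis by (simp only: mult.assoc[symmetric] ennreal_mult[symmetric] zero_le_power2 zero_le_power zero_le_mult_iff zero_le_numeral simp_thms)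
  qed
  finally show ?thesis .
qed

text \<open>The points reached from x have height below 3t/2, so their hyperbolic density is at
  least (3t/2)^(-N). The dilation contributes (r t)^(-N), and t cancels: small hyperbolic measure
  forces a small portion of every such ball.\<close>

lemma emeasure_ball_le_hyp:
  fixes A :: "('b::euclidean_space \<times> real) set"
  assumes [measurable]: "A \<in> sets borel" and x: "snd x > 0" and r: "0 < r" "r \<le> 1 / 2"
  shows "emeasure lborel {z \<in> ball 0 1. x + (r * snd x) *\<^sub>R z \<in> A}
    \<le> ennreal ((3 / 2) ^ DIM('b \<times> real) / r ^ DIM('b \<times> real)) * emeasure hyp A"
proof -
  let ?N = "DIM('b \<times> real)"
  define t where "t = snd x"
  have t: "t > 0" using x by (simp add: t_def)
  have rt: "r * t > 0" "r * t \<noteq> 0" using r t by auto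
  \<comment> \<open>The indicator of the part of \<open>A\<close> at heights reachable from x, where
    the density is bounded below.\<close>
  define k :: "'b \<times> real \<Rightarrow> ennreal" where
    "k y = (if y \<in> A \<and> 0 < snd y \<and> snd y < 3 / 2 * t then 1 else 0)" for y
  have km[measurable]: "k \<in> borel_measurable borel" unfolding k_def by measurable
  have snd_bound: "0 < snd (x + (r * t) *\<^sub>R z)" "snd (x + (r * t) *\<^sub>R z) < 3 / 2 * t" if "z \<in> ball 0 1" for z
  proof -
    have "\<bar>snd z\<bar> < 1" using norm_snd_le[of "snd z" "fst z"] that by simp
    then have "\<bar>r * snd z\<bar> < 1 / 2 * 1"
      using r unfolding abs_mult by (intro mult_le_less_imp_less) auto
    then have *: "- (1 / 2) < r * snd z" "r * snd z < 1 / 2" by (simp_all add: abs_less_iff)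
    have "t * (1 + r * snd z) > 0" "t * (1 + r * snd z) < t * (3 / 2)"
      using * t by (auto intro!: mult_pos_pos mult_strict_left_mono)
    then show "0 < snd (x + (r * t) *\<^sub>R z)" "snd (x + (r * t) *\<^sub>R z) < 3 / 2 * t"
      by (simp_all add: t_def algebra_simps)
  qed
  have "{z \<in> ball 0 1. x + (r * t) *\<^sub>R z \<in> A} \<in> sets borel" by measurable
  then have "emeasure lborel {z \<in> ball 0 1. x + (r * t) *\<^sub>R z \<in> A} =
      (\<integral>\<^sup>+z. indicator {z \<in> ball 0 1. x + (r * t) *\<^sub>R z \<in> A} z \<partial>lborel)" by simp
  also have "\<dots> \<le> (\<integral>\<^sup>+z. k (x + (r * t) *\<^sub>R z) \<partial>lborel)"
    using snd_bound by (intro nn_integral_mono) (auto simp: k_def indicator_def)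
  also have "\<dots> = ennreal (1 / (r * t) ^ ?N) * (\<integral>\<^sup>+y. k y \<partial>lborel)"
  proof -
    have "(\<integral>\<^sup>+y. k y \<partial>lborel) = ennreal ((r * t) ^ ?N) * (\<integral>\<^sup>+z. k (x + (r * t) *\<^sub>R z) \<partial>lborel)"
      using nn_integral_lborel_affine[OF km rt(2), of x] rt by (simp del: DIM_prod)
    moreover have "ennreal (1 / (r * t) ^ ?N) * ennreal ((r * t) ^ ?N) = 1"
      using rt by (subst ennreal_mult[symmetric]) (auto simp del: DIM_prod)
    ultimately show ?thesis by (simp only: mult.assoc[symmetric] mult_1_left)
  qed
  also have "(\<integral>\<^sup>+y. k y \<partial>lborel) \<le> (\<integral>\<^sup>+y. ennreal ((3 / 2 * t) ^ ?N) * (hyp_weight y * indicator A y) \<partial>lborel)"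
  proof (rule nn_integral_mono)
    fix y :: "'b \<times> real"
    show "k y \<le> ennreal ((3 / 2 * t) ^ ?N) * (hyp_weight y * indicator A y)"
    proof (cases "y \<in> A \<and> 0 < snd y \<and> snd y < 3 / 2 * t")
      case True
      then have "1 = (snd y) ^ ?N * snd y powr - real ?N"
        by (simp add: powr_minus powr_realpow del: DIM_prod)
      also have "\<dots> \<le> (3 / 2 * t) ^ ?N * snd y powr - real ?N"
        using True by (intro mult_right_mono power_mono) auto
      finally have "ennreal 1 \<le> ennreal ((3 / 2 * t) ^ ?N) * ennreal (snd y powr - real ?N)"
        using t by (subst ennreal_mult[symmetric]) (auto simp del: DIM_prod)
      then show ?thesis using True by (simp add: k_def hyp_weight_def del: DIM_prod)
    qed (auto simp: k_def)
  qed
  also have "\<dots> = ennreal ((3 / 2 * t) ^ ?N) * (\<integral>\<^sup>+y. hyp_weight y * indicator A y \<partial>lborel)"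
    by (rule nn_integral_cmult) measurable
  also have "(\<integral>\<^sup>+y. hyp_weight y * indicator A y \<partial>lborel) = emeasure hyp A"
    by (subst nn_integral_hyp[symmetric]) simp_all
  also have "ennreal (1 / (r * t) ^ ?N) * (ennreal ((3 / 2 * t) ^ ?N) * emeasure hyp A) =
      ennreal ((3 / 2) ^ ?N / r ^ ?N) * emeasure hyp A"
  proof -
    have "1 / (r * t) ^ ?N * (3 / 2 * t) ^ ?N = (3 / 2) ^ ?N / r ^ ?N"
      using t unfolding power_mult_distrib[of "3 / 2" t] power_mult_distrib[of r t] by (simp del: DIM_prod)
    moreover have "ennreal (1 / (r * t) ^ ?N) * ennreal ((3 / 2 * t) ^ ?N) = ennreal (1 / (r * t) ^ ?N * (3 / 2 * t) ^ ?N)"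
      using rt t by (intro ennreal_mult[symmetric]) auto
    ultimately show ?thesis by (simp only: mult.assoc[symmetric])
  qed
  finally show ?thesis by (simp add: t_def mult_left_mono del: DIM_prod)
qed

text \<open>For \<open>x \<in> A\<close> at height \<open>t\<close>, at least half of the ball of radius \<open>r t\<close> around \<open>x\<close> lies
  outside \<open>A'\<close>, where \<open>V\<close> differs from its value at \<open>x\<close> by \<open>1\<close>.\<close>

lemma hyp_capacity_estimate:
  fixes V :: "'b::euclidean_space \<times> real \<Rightarrow> real"
  assumes [measurable]: "V \<in> borel_measurable borel" "GV \<in> borel_measurable borel"
    and der: "\<And>x. snd x > 0 \<Longrightarrow> (V has_derivative (\<lambda>k. GV x \<bullet> k)) (at x)"
    and cont: "\<And>x. snd x > 0 \<Longrightarrow> isCont GV x"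
    and [measurable]: "A \<in> sets borel" "A' \<in> sets borel"
    and A: "\<And>x. x \<in> A \<Longrightarrow> snd x > 0 \<and> V x = 1"
    and A': "\<And>x. snd x > 0 \<Longrightarrow> x \<notin> A' \<Longrightarrow> V x = 0"
    and r: "0 < r" "r \<le> 1 / 2"
    and small: "ennreal ((3 / 2) ^ DIM('b \<times> real) / r ^ DIM('b \<times> real)) * emeasure hyp A'
      \<le> ennreal (measure lborel (ball (0 :: 'b \<times> real) 1) / 2)"
  shows "emeasure hyp A \<le> ennreal (2 ^ (DIM('b \<times> real) + 4) * r\<^sup>2) *
    (\<integral>\<^sup>+x. ennreal ((snd x)\<^sup>2 * (norm (GV x))\<^sup>2) \<partial>hyp)"
proof -
  let ?N = "DIM('b \<times> real)"
  let ?B = "ball (0 :: 'b \<times> real) 1"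
  let ?D = "\<integral>\<^sup>+x. ennreal ((snd x)\<^sup>2 * (norm (GV x))\<^sup>2) \<partial>hyp"
  define \<omega> where "\<omega> = measure lborel ?B"
  interpret pair_sigma_finite "hyp :: ('b \<times> real) measure" "lborel :: ('b \<times> real) measure" by (rule pair_sigma_finite_hyp)
  have Bfin: "emeasure lborel ?B = ennreal \<omega>"
    unfolding \<omega>_def by (intro emeasure_eq_ennreal_measure) (use emeasure_bounded_finite[of ?B] in auto)
  have \<omega>: "\<omega> > 0" unfolding \<omega>_def by (rule content_ball_pos) simp
  let ?f = "\<lambda>x z. ennreal ((V (x + (r * snd x) *\<^sub>R z) - V x)\<^sup>2)"
  have half: "ennreal (\<omega> / 2) \<le> (\<integral>\<^sup>+z. indicator ?B z * ?f x z \<partial>lborel)" if x: "x \<in> A" for x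
  proof -
    have sx: "snd x > 0" "V x = 1" using A[OF x] by auto
    define S where "S = {z \<in> ?B. x + (r * snd x) *\<^sub>R z \<in> A'}"
    have S[measurable]: "S \<in> sets borel" unfolding S_def by measurable
    have "emeasure lborel S \<le> ennreal (\<omega> / 2)"
      using order_trans[OF emeasure_ball_le_hyp[OF _ sx(1) r, of A'] small] unfolding S_def \<omega>_def by simp
    moreover have "emeasure lborel ?B = emeasure lborel S + emeasure lborel (?B - S)"
      by (subst plus_emeasure) (auto simp: S_def intro!: arg_cong[where f="emeasure lborel"])
    ultimately have "ennreal \<omega> \<le> ennreal (\<omega> / 2) + emeasure lborel (?B - S)"
      unfolding Bfin by (metis add_right_mono)
    moreover have "ennreal \<omega> = ennreal (\<omega> / 2) + ennreal (\<omega> / 2)" using \<omega> by (subst ennreal_plus[symmetric]) auto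
    ultimately have "ennreal (\<omega> / 2) \<le> emeasure lborel (?B - S)"
      by (simp add: ennreal_add_left_cancel_le)
    also have "\<dots> = (\<integral>\<^sup>+z. indicator (?B - S) z \<partial>lborel)" by simp
    also have "\<dots> \<le> (\<integral>\<^sup>+z. indicator ?B z * ?f x z \<partial>lborel)"
    proof (rule nn_integral_mono)
      fix z :: "'b \<times> real"
      show "indicator (?B - S) z \<le> indicator ?B z * ?f x z"
      proof (cases "z \<in> ?B - S")
        case True
        have "\<bar>snd z\<bar> < 1" using norm_snd_le[of "snd z" "fst z"] True by simp
        then have "\<bar>r * snd z\<bar> < 1 / 2 * 1"
          using r unfolding abs_mult by (intro mult_le_less_imp_less) auto
        then have "1 + r * snd z > 0" by (simp add: abs_less_iff)
        then have "snd x * (1 + r * snd z) > 0" using sx by simp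
        then have "snd (x + (r * snd x) *\<^sub>R z) > 0" by (simp add: algebra_simps)
        then have "V (x + (r * snd x) *\<^sub>R z) = 0" using True by (intro A') (auto simp: S_def)
        then show ?thesis using True sx by simp
      qed simp
    qed
    finally show ?thesis .
  qed
  have meas: "(\<lambda>(x, z). indicator ?B z * ?f x z) \<in> borel_measurable (hyp \<Otimes>\<^sub>M lborel)"
  proof -
    have P: "(\<lambda>q::('b \<times> real) \<times> ('b \<times> real). fst q + (r * snd (fst q)) *\<^sub>R snd q) \<in> borel_measurable (borel \<Otimes>\<^sub>M borel)"
      unfolding borel_prod by (intro borel_measurable_continuous_onI continuous_intros)
    have V1: "(\<lambda>q::('b \<times> real) \<times> ('b \<times> real). V (fst q + (r * snd (fst q)) *\<^sub>R snd q)) \<in> borel_measurable (borel \<Otimes>\<^sub>M borel)"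
      by (rule measurable_compose[OF P assms(1)])
    have V2: "(\<lambda>q::('b \<times> real) \<times> ('b \<times> real). V (fst q)) \<in> borel_measurable (borel \<Otimes>\<^sub>M borel)"
      by (rule measurable_compose[OF measurable_fst assms(1)])
    have I: "(\<lambda>q::('b \<times> real) \<times> ('b \<times> real). indicator ?B (snd q) :: ennreal) \<in> borel_measurable (borel \<Otimes>\<^sub>M borel)"
      by (rule measurable_compose[OF measurable_snd borel_measurable_indicator]) simp
    have "(\<lambda>q. indicator ?B (snd q) * ?f (fst q) (snd q)) \<in> borel_measurable (borel \<Otimes>\<^sub>M borel)"
      by (intro borel_measurable_times_ennreal I measurable_compose[OF _ measurable_ennreal] borel_measurable_power
          borel_measurable_diff V1 V2)
    then show ?thesis
      by (subst measurable_cong_sets[OF sets_pair_measure_cong[OF sets_hyp sets_lborel] refl]) (simp add: case_prod_beta')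
  qed
  \<comment> \<open>Integrate \<open>half\<close> over \<open>A\<close> and exchange the integrals:
    each z in the ball costs one difference estimate. The ball has measure \<omega> against
    \<omega>/2 on the left, which turns 2^(N+3) into 2^(N+4).\<close>
  have "ennreal (\<omega> / 2) * emeasure hyp A = (\<integral>\<^sup>+x. ennreal (\<omega> / 2) * indicator A x \<partial>hyp)"
    by (subst nn_integral_cmult_indicator) auto
  also have "\<dots> \<le> (\<integral>\<^sup>+x. (\<integral>\<^sup>+z. indicator ?B z * ?f x z \<partial>lborel) \<partial>hyp)"
    using half by (intro nn_integral_mono) (auto simp: indicator_def)
  also have "\<dots> = (\<integral>\<^sup>+z. (\<integral>\<^sup>+x. indicator ?B z * ?f x z \<partial>hyp) \<partial>lborel)"
    by (rule Fubini'[symmetric, OF meas])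
  also have "\<dots> \<le> (\<integral>\<^sup>+z. (ennreal (2 ^ (?N + 3) * r\<^sup>2) * ?D) * indicator ?B z \<partial>lborel)"
  proof (rule nn_integral_mono)
    fix z :: "'b \<times> real"
    show "(\<integral>\<^sup>+x. indicator ?B z * ?f x z \<partial>hyp) \<le> (ennreal (2 ^ (?N + 3) * r\<^sup>2) * ?D) * indicator ?B z"
    proof (cases "z \<in> ?B")
      case True
      then have "norm z \<le> 1" by simp
      from hyp_difference_estimate[OF assms(1,2) der cont this r]
      show ?thesis using True by (simp del: DIM_prod)
    qed simp
  qed
  also have "\<dots> = ennreal (2 ^ (?N + 3) * r\<^sup>2) * ?D * ennreal \<omega>"
    unfolding Bfin[symmetric] by (rule nn_integral_cmult_indicator) auto
  finally have "ennreal (2 / \<omega>) * (ennreal (\<omega> / 2) * emeasure hyp A) \<le> ennreal (2 / \<omega>) * (ennreal (2 ^ (?N + 3) * r\<^sup>2) * ?D * ennreal \<omega>)"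
    by (rule mult_left_mono) simp
  also have "ennreal (2 / \<omega>) * (ennreal (\<omega> / 2) * emeasure hyp A) = emeasure hyp A"
  proof -
    have "ennreal (2 / \<omega>) * ennreal (\<omega> / 2) = 1" using \<omega> by (subst ennreal_mult[symmetric]) auto
    then show ?thesis by (simp only: mult.assoc[symmetric] mult_1_left)
  qed
  also have "ennreal (2 / \<omega>) * (ennreal (2 ^ (?N + 3) * r\<^sup>2) * ?D * ennreal \<omega>) = ennreal (2 ^ (?N + 4) * r\<^sup>2) * ?D"
  proof -
    have "ennreal (2 / \<omega>) * ennreal (2 ^ (?N + 3) * r\<^sup>2) * ennreal \<omega> = ennreal (2 / \<omega> * (2 ^ (?N + 3) * r\<^sup>2) * \<omega>)"
      using \<omega> by (subst (1 2) ennreal_mult) auto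
    also have "2 / \<omega> * (2 ^ (?N + 3) * r\<^sup>2) * \<omega> = 2 ^ (?N + 4) * r\<^sup>2" using \<omega> by (simp add: power_add del: DIM_prod)
    finally have c: "ennreal (2 / \<omega>) * ennreal (2 ^ (?N + 3) * r\<^sup>2) * ennreal \<omega> = ennreal (2 ^ (?N + 4) * r\<^sup>2)" .
    have "ennreal (2 / \<omega>) * (ennreal (2 ^ (?N + 3) * r\<^sup>2) * ?D * ennreal \<omega>) =
        (ennreal (2 / \<omega>) * ennreal (2 ^ (?N + 3) * r\<^sup>2) * ennreal \<omega>) * ?D" by (simp only: mult_ac)
    then show ?thesis by (simp only: c)
  qed
  finally show ?thesis .
qed

section \<open>Superposition of level sets\<close>

lemma flat_continuous: "continuous_on UNIV (flat j)"
  by (intro continuous_at_imp_continuous_on ballI DERIV_isCont[OF has_real_derivative_flat])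

text \<open>The derivative lives on a half-open interval to match the half-open dyadic shells below:
  truncations at different levels then draw on disjoint parts of the energy.\<close>

lemma obtain_step:
  obtains \<tau> \<tau>' :: "real \<Rightarrow> real" and M where "\<And>s. (\<tau> has_real_derivative \<tau>' s) (at s)" "\<And>s. isCont \<tau>' s"
    "\<And>s. s \<le> 1 \<Longrightarrow> \<tau> s = 0" "\<And>s. s \<ge> 2 \<Longrightarrow> \<tau> s = 1" "\<And>s. s \<notin> {1<..2} \<Longrightarrow> \<tau>' s = 0" "\<And>s. \<bar>\<tau>' s\<bar> \<le> M" "M > 0"
proof -
  define F where "F s = flat 0 (s - 1)" for s
  define G where "G s = flat 0 (2 - s)" for s
  define F' where "F' s = flat 1 (s - 1)" for s
  define G' where "G' s = - flat 1 (2 - s)" for s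
  define \<tau> where "\<tau> s = F s / (F s + G s)" for s
  define \<tau>' where "\<tau>' s = (F' s * (F s + G s) - F s * (F' s + G' s)) / ((F s + G s) * (F s + G s))" for s
  have nonneg: "F s \<ge> 0" "G s \<ge> 0" for s by (simp_all add: F_def G_def flat_def)
  have pos: "F s + G s > 0" for s
  proof (cases "s > 1")
    case True
    then have "F s > 0" by (simp add: F_def flat_def)
    then show ?thesis using nonneg[of s] by simp
  next
    case False
    then have "G s > 0" by (simp add: G_def flat_def)
    then show ?thesis using nonneg[of s] by simp
  qed
  have dF: "(F has_real_derivative F' s) (at s)" for s
  proof -
    have "((\<lambda>s::real. s - 1) has_real_derivative 1) (at s)" by (auto intro!: derivative_eq_intros)
    from DERIV_chain2[where f="flat 0", OF has_real_derivative_flat this]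
    show ?thesis by (simp add: F_def[abs_def] F'_def)
  qed
  have dG: "(G has_real_derivative G' s) (at s)" for s
  proof -
    have "((\<lambda>s::real. 2 - s) has_real_derivative -1) (at s)" by (auto intro!: derivative_eq_intros)
    from DERIV_chain2[where f="flat 0", OF has_real_derivative_flat this]
    show ?thesis by (simp add: G_def[abs_def] G'_def)
  qed
  have d: "(\<tau> has_real_derivative \<tau>' s) (at s)" for s
    unfolding \<tau>_def \<tau>'_def using pos[of s]
    by (intro DERIV_quotient[THEN DERIV_cong] DERIV_divide DERIV_add dF dG) auto
  have cont: "continuous_on UNIV \<tau>'"
    unfolding \<tau>'_def F_def G_def F'_def G'_def using pos unfolding F_def G_def
    by (intro continuous_intros continuous_on_compose2[OF flat_continuous]) (auto simp: less_imp_neq[symmetric])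
  have zero: "\<tau>' s = 0" if "s \<notin> {1<..2}" for s
  proof (cases "s \<le> 1")
    case True
    then show ?thesis by (simp add: \<tau>'_def F_def F'_def flat_def)
  next
    case False
    then have "G s = 0" "G' s = 0" using that by (simp_all add: G_def G'_def flat_def)
    then show ?thesis by (simp add: \<tau>'_def)
  qed
  have "compact (\<tau>' ` {1..2})" using cont by (intro compact_continuous_image) (auto intro: continuous_on_subset)
  then obtain B where B: "\<And>s. s \<in> {1..2} \<Longrightarrow> \<bar>\<tau>' s\<bar> \<le> B"
    using compact_imp_bounded bounded_iff by (metis imageI real_norm_def)
  show thesis
  proof (rule that[of \<tau> \<tau>' "\<bar>B\<bar> + 1"])
    show "\<bar>\<tau>' s\<bar> \<le> \<bar>B\<bar> + 1" for s
    proof (cases "s \<in> {1..2}")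
      case True
      then show ?thesis using B[OF True] abs_ge_self[of B] by linarith
    next
      case False
      then have "\<tau>' s = 0" by (intro zero) auto
      then show ?thesis by simp
    qed
    show "isCont \<tau>' s" for s using cont by (simp add: continuous_on_eq_continuous_at)
    show "\<tau> s = 0" if "s \<le> 1" for s using that by (simp add: \<tau>_def F_def flat_def)
    show "\<tau> s = 1" if "s \<ge> 2" for s
    proof -
      have "G s = 0" using that by (simp add: G_def flat_def)
      then show ?thesis using pos[of s] by (simp add: \<tau>_def)
    qed
  qed (use d zero in auto)
qed

text \<open>If the superlevel set of \<open>U\<^sup>2\<close> has small measure, apply the capacity estimate to the truncation
  \<open>\<tau> (U\<^sup>2/l)\<close>; otherwise Chebyshev's inequality suffices.\<close>

lemma level_set_estimate:
  fixes p :: real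
  assumes p: "p \<ge> 2" and pN: "p * (real DIM('b::euclidean_space \<times> real) - 2) \<le> 2 * real DIM('b \<times> real)"
  obtains C where "C > 0"
    "\<And>(U :: 'b \<times> real \<Rightarrow> real) GU (\<phi>::real) (l::real). U \<in> borel_measurable borel \<Longrightarrow> GU \<in> borel_measurable borel \<Longrightarrow>
      (\<And>x. snd x > 0 \<Longrightarrow> (U has_derivative (\<lambda>k. GU x \<bullet> k)) (at x)) \<Longrightarrow> (\<And>x. snd x > 0 \<Longrightarrow> isCont GU x) \<Longrightarrow>
      \<phi> > 0 \<Longrightarrow> (\<integral>\<^sup>+x. ennreal (\<bar>U x\<bar> powr p) \<partial>hyp) \<le> ennreal \<phi> \<Longrightarrow> l > 0 \<Longrightarrow>
      (\<integral>\<^sup>+x. ennreal (\<bar>U x\<bar> powr p) * indicator {x. snd x > 0 \<and> 2 * l < (U x)\<^sup>2 \<and> (U x)\<^sup>2 \<le> 2 * (2 * l)} x \<partial>hyp)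
      \<le> ennreal (C * \<phi> powr (1 - 2 / p)) *
       ((\<integral>\<^sup>+x. ennreal ((snd x)\<^sup>2 * (norm (GU x))\<^sup>2) * indicator {x. snd x > 0 \<and> l < (U x)\<^sup>2 \<and> (U x)\<^sup>2 \<le> 2 * l} x \<partial>hyp)
        + (\<integral>\<^sup>+x. ennreal ((U x)\<^sup>2) * indicator {x. snd x > 0 \<and> 2 * l < (U x)\<^sup>2 \<and> (U x)\<^sup>2 \<le> 2 * (2 * l)} x \<partial>hyp))"
proof -
  let ?N = "DIM('b \<times> real)"
  define N where "N = real ?N"
  have N: "N \<ge> 2" using DIM_positive[where 'a='b] by (simp add: N_def)
  obtain \<tau> \<tau>' :: "real \<Rightarrow> real" and M where \<tau>: "\<And>s. (\<tau> has_real_derivative \<tau>' s) (at s)" "\<And>s. isCont \<tau>' s"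
    "\<And>s. s \<le> 1 \<Longrightarrow> \<tau> s = 0" "\<And>s. s \<ge> 2 \<Longrightarrow> \<tau> s = 1" "\<And>s. s \<notin> {1<..2} \<Longrightarrow> \<tau>' s = 0"
    and M: "\<And>s. \<bar>\<tau>' s\<bar> \<le> M" "M > 0"
    by (rule obtain_step) blast
  define q where "q = p / 2"
  define \<theta> where "\<theta> = 1 - 2 / p"
  have q: "q \<ge> 1" and \<theta>: "\<theta> \<ge> 0" "\<theta> \<le> 1" and q\<theta>: "q * \<theta> = q - 1" using p by (auto simp: q_def \<theta>_def field_simps)
  have \<theta>N: "\<theta> \<le> 2 / N"
  proof -
    have "p * (N - 2) \<le> 2 * N" using pN by (simp add: N_def)
    then show ?thesis using p N by (simp add: \<theta>_def field_simps)
  qed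
  define \<omega> where "\<omega> = measure lborel (ball (0 :: 'b \<times> real) 1)"
  have \<omega>: "\<omega> > 0" unfolding \<omega>_def by (rule content_ball_pos) simp
  \<comment> \<open>With r^N = K m this makes the smallness condition of
    \<open>hyp_capacity_estimate\<close> an equality when m replaces the measure of the superlevel
    set.\<close>
  define K where "K = 2 * (3 / 2) ^ ?N / \<omega>"
  have K: "K > 0" using \<omega> by (simp add: K_def)
  \<comment> \<open>The first summand collects the constants of the capacity estimate and of the
    chain rule for the truncation; the second serves the case of a large superlevel set.\<close>
  define C1 where "C1 = 2 ^ (?N + 4) * (8 * M\<^sup>2) + 2 ^ ?N"
  have C1: "C1 > 0" using M by (simp add: C1_def add_nonneg_pos)
  define C where "C = 4 powr q * (C1 * K powr \<theta>)"
  have C: "C > 0" using C1 K by (simp add: C_def)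
  show thesis
  proof (rule that[OF C])
    fix U :: "'b \<times> real \<Rightarrow> real" and GU and \<phi> l :: real
    assume [measurable]: "U \<in> borel_measurable borel" "GU \<in> borel_measurable borel"
      and der: "\<And>x. snd x > 0 \<Longrightarrow> (U has_derivative (\<lambda>k. GU x \<bullet> k)) (at x)"
      and cont: "\<And>x. snd x > 0 \<Longrightarrow> isCont GU x"
      and \<phi>: "\<phi> > 0" and \<Phi>: "(\<integral>\<^sup>+x. ennreal (\<bar>U x\<bar> powr p) \<partial>hyp) \<le> ennreal \<phi>" and l: "l > 0"
    define A where "A c = {x. snd x > 0 \<and> c < (U x)\<^sup>2}" for c
    define L where "L c = {x. snd x > 0 \<and> c < (U x)\<^sup>2 \<and> (U x)\<^sup>2 \<le> 2 * c}" for c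
    have [measurable]: "A c \<in> sets borel" "L c \<in> sets borel" for c unfolding A_def L_def by measurable
    let ?X1 = "\<integral>\<^sup>+x. ennreal ((snd x)\<^sup>2 * (norm (GU x))\<^sup>2) * indicator (L l) x \<partial>hyp"
    let ?X2 = "\<integral>\<^sup>+x. ennreal ((U x)\<^sup>2) * indicator (L (2 * l)) x \<partial>hyp"
    have powq: "\<bar>U x\<bar> powr p = ((U x)\<^sup>2) powr q" for x
    proof (cases "U x = 0")
      case False
      then have "(U x)\<^sup>2 = \<bar>U x\<bar> powr 2" by simp
      then show ?thesis by (simp only: powr_powr) (simp add: q_def)
    qed simp
    define m where "m = \<phi> / l powr q"
    have m: "m > 0" using \<phi> l by (simp add: m_def)
    have mA: "emeasure hyp (A l) \<le> ennreal m"
    proof -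
      have "ennreal (l powr q) * emeasure hyp (A l) = (\<integral>\<^sup>+x. ennreal (l powr q) * indicator (A l) x \<partial>hyp)"
        by (subst nn_integral_cmult_indicator) auto
      also have "\<dots> \<le> (\<integral>\<^sup>+x. ennreal (\<bar>U x\<bar> powr p) \<partial>hyp)"
        unfolding powq using l q by (intro nn_integral_mono) (auto simp: A_def indicator_def intro!: ennreal_leI powr_mono2)
      also have "\<dots> \<le> ennreal \<phi>" by (rule \<Phi>)
      finally have "ennreal (1 / l powr q) * (ennreal (l powr q) * emeasure hyp (A l)) \<le> ennreal (1 / l powr q) * ennreal \<phi>"
        by (rule mult_left_mono) simp
      moreover have "ennreal (1 / l powr q) * ennreal (l powr q) = 1"
        using l by (subst ennreal_mult[symmetric]) auto
      moreover have "ennreal (1 / l powr q) * ennreal \<phi> = ennreal m"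
        using l \<phi> by (subst ennreal_mult[symmetric]) (auto simp: m_def)
      ultimately show ?thesis by (simp only: mult.assoc[symmetric] mult_1_left)
    qed
    define \<kappa> where "\<kappa> = K * m"
    have \<kappa>: "\<kappa> > 0" using K m by (simp add: \<kappa>_def)
    have main: "emeasure hyp (L (2 * l)) \<le> ennreal (C1 * \<kappa> powr \<theta> / l) * (?X1 + ?X2)"
    \<comment> \<open>The radius r with r^N = \<kappa> is admissible in the capacity estimate
      exactly if it is at most 1/2.\<close>
    proof (cases "\<kappa> \<le> (1 / 2) ^ ?N")
      case True
      define V where "V x = \<tau> ((U x)\<^sup>2 / l)" for x
      define GV where "GV x = (\<tau>' ((U x)\<^sup>2 / l) * (2 * U x / l)) *\<^sub>R GU x" for x
      have [measurable]: "\<tau> \<in> borel_measurable borel"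
        by (intro borel_measurable_continuous_onI continuous_at_imp_continuous_on ballI DERIV_isCont[OF \<tau>(1)])
      have [measurable]: "\<tau>' \<in> borel_measurable borel"
        by (intro borel_measurable_continuous_onI continuous_at_imp_continuous_on ballI \<tau>(2))
      have [measurable]: "V \<in> borel_measurable borel" "GV \<in> borel_measurable borel"
        unfolding V_def GV_def by measurable
      define r where "r = \<kappa> powr (1 / N)"
      have r: "r > 0" using \<kappa> by (simp add: r_def)
      have rN: "r ^ ?N = \<kappa>" using \<kappa> N by (simp add: r_def powr_realpow[symmetric] powr_powr N_def del: DIM_prod)
      have r2: "r \<le> 1 / 2"
      proof (rule ccontr)
        assume "\<not> r \<le> 1 / 2"
        then have "(1 / 2) ^ ?N < r ^ ?N" by (intro power_strict_mono) auto
        then show False using True rN by simp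
      qed
      \<comment> \<open>The bound on p enters here: it means \<theta> \<le> 2/N, and \<kappa> \<le>
        1, so the exponent 2/N of r^2 may be lowered to \<theta>.\<close>
      have rr: "r\<^sup>2 \<le> \<kappa> powr \<theta>"
      proof -
        have "\<kappa> \<le> 1" using True by (rule order_trans) (rule power_le_one; simp)
        have "r\<^sup>2 = r powr 2" using r by simp
        also have "\<dots> = \<kappa> powr (2 / N)" by (simp add: r_def powr_powr)
        also have "\<dots> \<le> \<kappa> powr \<theta>" using \<theta>N \<kappa> \<open>\<kappa> \<le> 1\<close> by (intro powr_mono') auto
        finally show ?thesis .
      qed
      have Vder: "(V has_derivative (\<lambda>k. GV x \<bullet> k)) (at x)" if x: "snd x > 0" for x
      proof -
        have "((\<lambda>x. (U x)\<^sup>2 / l) has_derivative (\<lambda>k. 2 * U x / l * (GU x \<bullet> k))) (at x)"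
          using l by (auto intro!: derivative_eq_intros der[OF x] simp: fun_eq_iff)
        from has_derivative_compose[OF this \<tau>(1)[of "(U x)\<^sup>2 / l", unfolded has_field_derivative_def]]
        show ?thesis by (simp add: V_def[abs_def] GV_def mult.assoc)
      qed
      have Vcont: "isCont GV x" if x: "snd x > 0" for x
      proof -
        have "isCont U x" using der[OF x] by (rule has_derivative_continuous)
        then show ?thesis unfolding GV_def using l cont[OF x]
          by (intro continuous_intros isCont_o2[OF _ \<tau>(2)]) auto
      qed
      have "emeasure hyp (A (2 * l)) \<le> ennreal (2 ^ (?N + 4) * r\<^sup>2) * (\<integral>\<^sup>+x. ennreal ((snd x)\<^sup>2 * (norm (GV x))\<^sup>2) \<partial>hyp)"
      proof (rule hyp_capacity_estimate[where V=V and A'="A l"])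
        show "snd x > 0 \<and> V x = 1" if "x \<in> A (2 * l)" for x
          using that l by (auto simp: A_def V_def field_simps intro!: \<tau>(4))
        show "V x = 0" if "snd x > 0" "x \<notin> A l" for x
          using that l by (auto simp: A_def V_def field_simps intro!: \<tau>(3))
        have "ennreal ((3 / 2) ^ ?N / r ^ ?N) * emeasure hyp (A l) \<le> ennreal ((3 / 2) ^ ?N / r ^ ?N) * ennreal m"
          by (rule mult_left_mono[OF mA]) simp
        also have "\<dots> = ennreal ((3 / 2) ^ ?N / r ^ ?N * m)" using r m by (intro ennreal_mult[symmetric]) auto
        also have "(3 / 2) ^ ?N / r ^ ?N * m = \<omega> / 2"
          unfolding rN \<kappa>_def K_def using m \<omega> by (simp add: field_simps del: DIM_prod)
        finally show "ennreal ((3 / 2) ^ ?N / r ^ ?N) * emeasure hyp (A l) \<le> ennreal (measure lborel (ball (0 :: 'b \<times> real) 1) / 2)"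
          by (simp add: \<omega>_def)
      qed (use Vder Vcont r r2 in auto)
      also have "(\<integral>\<^sup>+x. ennreal ((snd x)\<^sup>2 * (norm (GV x))\<^sup>2) \<partial>hyp) \<le>
          (\<integral>\<^sup>+x. ennreal (8 * M\<^sup>2 / l) * (ennreal ((snd x)\<^sup>2 * (norm (GU x))\<^sup>2) * indicator (L l) x) \<partial>hyp)"
      proof (rule nn_integral_mono_AE, rule eventually_mono[OF AE_hyp_pos])
        fix x :: "'b \<times> real" assume x: "snd x > 0"
        show "ennreal ((snd x)\<^sup>2 * (norm (GV x))\<^sup>2) \<le> ennreal (8 * M\<^sup>2 / l) * (ennreal ((snd x)\<^sup>2 * (norm (GU x))\<^sup>2) * indicator (L l) x)"
        proof (cases "x \<in> L l")
          case True
          have "(\<tau>' ((U x)\<^sup>2 / l))\<^sup>2 \<le> M\<^sup>2" using M(1)[of "(U x)\<^sup>2 / l"] by (metis abs_ge_zero power_mono power2_abs)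
          \<comment> \<open>On the shell the square of U is at most 2 l.\<close>
          moreover have "(2 * U x / l)\<^sup>2 \<le> 8 / l"
            using True l by (auto simp: L_def power_divide power_mult_distrib divide_simps power2_eq_square)
          ultimately have "(\<tau>' ((U x)\<^sup>2 / l))\<^sup>2 * (2 * U x / l)\<^sup>2 \<le> M\<^sup>2 * (8 / l)" by (intro mult_mono) auto
          then have *: "(snd x)\<^sup>2 * (((\<tau>' ((U x)\<^sup>2 / l))\<^sup>2 * (2 * U x / l)\<^sup>2) * (norm (GU x))\<^sup>2) \<le> (snd x)\<^sup>2 * ((M\<^sup>2 * (8 / l)) * (norm (GU x))\<^sup>2)"
            by (intro mult_left_mono mult_right_mono) auto
          have "(snd x)\<^sup>2 * (norm (GV x))\<^sup>2 \<le> 8 * M\<^sup>2 / l * ((snd x)\<^sup>2 * (norm (GU x))\<^sup>2)"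
          proof -
            have e1: "(norm (GV x))\<^sup>2 = ((\<tau>' ((U x)\<^sup>2 / l))\<^sup>2 * (2 * U x / l)\<^sup>2) * (norm (GU x))\<^sup>2"
              by (simp only: GV_def norm_scaleR power_mult_distrib power2_abs)
            have e2: "(snd x)\<^sup>2 * ((M\<^sup>2 * (8 / l)) * (norm (GU x))\<^sup>2) = 8 * M\<^sup>2 / l * ((snd x)\<^sup>2 * (norm (GU x))\<^sup>2)"
              by simp
            show ?thesis using * unfolding e1 e2 .
          qed
          then have "ennreal ((snd x)\<^sup>2 * (norm (GV x))\<^sup>2) \<le> ennreal (8 * M\<^sup>2 / l * ((snd x)\<^sup>2 * (norm (GU x))\<^sup>2))" by (rule ennreal_leI)
          moreover have "ennreal (8 * M\<^sup>2 / l * ((snd x)\<^sup>2 * (norm (GU x))\<^sup>2)) = ennreal (8 * M\<^sup>2 / l) * ennreal ((snd x)\<^sup>2 * (norm (GU x))\<^sup>2)"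
            using l by (intro ennreal_mult) auto
          ultimately show ?thesis using True by (simp only: indicator_simps mult_1_right)
        next
          case False
          then have "(U x)\<^sup>2 / l \<notin> {1<..2}" using x l by (auto simp: L_def field_simps)
          then have "GV x = 0" using \<tau>(5) by (simp add: GV_def)
          then show ?thesis by simp
        qed
      qed
      also have "\<dots> = ennreal (8 * M\<^sup>2 / l) * ?X1" by (rule nn_integral_cmult) measurable
      also have "ennreal (2 ^ (?N + 4) * r\<^sup>2) * (ennreal (8 * M\<^sup>2 / l) * ?X1) = ennreal (2 ^ (?N + 4) * r\<^sup>2 * (8 * M\<^sup>2 / l)) * ?X1"
        using l by (subst ennreal_mult) (auto simp: mult.assoc simp del: DIM_prod)
      also have "\<dots> \<le> ennreal (C1 * \<kappa> powr \<theta> / l) * (?X1 + ?X2)"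
      proof (rule mult_mono)
        have "2 ^ (?N + 4) * r\<^sup>2 * (8 * M\<^sup>2 / l) \<le> (2 ^ (?N + 4) * (8 * M\<^sup>2)) * \<kappa> powr \<theta> / l"
          using mult_left_mono[OF rr, of "2 ^ (?N + 4) * (8 * M\<^sup>2) / l"] l by (simp add: mult_ac del: DIM_prod)
        also have "\<dots> \<le> C1 * \<kappa> powr \<theta> / l"
          unfolding C1_def using l by (intro divide_right_mono mult_right_mono) auto
        finally show "ennreal (2 ^ (?N + 4) * r\<^sup>2 * (8 * M\<^sup>2 / l)) \<le> ennreal (C1 * \<kappa> powr \<theta> / l)" by (rule ennreal_leI)
      qed auto
      finally have "emeasure hyp (A (2 * l)) \<le> ennreal (C1 * \<kappa> powr \<theta> / l) * (?X1 + ?X2)"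
        by (simp add: mult_left_mono del: DIM_prod)
      moreover have "emeasure hyp (L (2 * l)) \<le> emeasure hyp (A (2 * l))"
        by (rule emeasure_mono) (auto simp: A_def L_def)
      ultimately show ?thesis by (rule order_trans[rotated])
    next
      case False
      have "ennreal (2 * l) * emeasure hyp (L (2 * l)) = (\<integral>\<^sup>+x. ennreal (2 * l) * indicator (L (2 * l)) x \<partial>hyp)"
        by (subst nn_integral_cmult_indicator) auto
      also have "\<dots> \<le> ?X2"
        by (intro nn_integral_mono) (auto simp: L_def indicator_def intro!: ennreal_leI)
      finally have "ennreal (1 / (2 * l)) * (ennreal (2 * l) * emeasure hyp (L (2 * l))) \<le> ennreal (1 / (2 * l)) * ?X2"
        by (rule mult_left_mono) simp
      moreover have "ennreal (1 / (2 * l)) * ennreal (2 * l) = 1"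
        using l by (subst ennreal_mult[symmetric]) auto
      ultimately have "emeasure hyp (L (2 * l)) \<le> ennreal (1 / (2 * l)) * ?X2"
        by (simp only: mult.assoc[symmetric] mult_1_left)
      also have "\<dots> \<le> ennreal (C1 * \<kappa> powr \<theta> / l) * (?X1 + ?X2)"
      proof (rule mult_mono)
        \<comment> \<open>Now \<kappa> exceeds 2^(-N), so \<kappa> powr \<theta> is bounded below
          and can be inserted at the price of the factor 2^N.\<close>
        have "1 \<le> 2 ^ ?N * \<kappa>" using False by (simp add: power_one_over field_simps del: DIM_prod)
        then have "1 \<le> (2 ^ ?N * \<kappa>) powr \<theta>" using \<theta> by (simp add: ge_one_powr_ge_zero)
        also have "\<dots> = (2 ^ ?N) powr \<theta> * \<kappa> powr \<theta>" using \<kappa> by (simp add: powr_mult del: DIM_prod)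
        also have "\<dots> \<le> (2 ^ ?N) powr 1 * \<kappa> powr \<theta>"
          using \<theta> one_le_power[of "2::real" ?N] by (intro mult_right_mono powr_mono) (auto simp del: DIM_prod)
        also have "\<dots> \<le> C1 * \<kappa> powr \<theta>" unfolding C1_def by (intro mult_right_mono) auto
        finally have "1 / (2 * l) \<le> C1 * \<kappa> powr \<theta> / l" using l by (simp add: field_simps)
        then show "ennreal (1 / (2 * l)) \<le> ennreal (C1 * \<kappa> powr \<theta> / l)" by (rule ennreal_leI)
      qed auto
      finally show ?thesis .
    qed
    have "(\<integral>\<^sup>+x. ennreal (\<bar>U x\<bar> powr p) * indicator (L (2 * l)) x \<partial>hyp) \<le> (\<integral>\<^sup>+x. ennreal ((4 * l) powr q) * indicator (L (2 * l)) x \<partial>hyp)"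
      unfolding powq using q by (intro nn_integral_mono) (auto simp: L_def indicator_def intro!: ennreal_leI powr_mono2)
    also have "\<dots> = ennreal ((4 * l) powr q) * emeasure hyp (L (2 * l))"
      by (rule nn_integral_cmult_indicator) auto
    also have "\<dots> \<le> ennreal ((4 * l) powr q) * (ennreal (C1 * \<kappa> powr \<theta> / l) * (?X1 + ?X2))"
      by (rule mult_left_mono[OF main]) simp
    also have "\<dots> = ennreal ((4 * l) powr q * (C1 * \<kappa> powr \<theta> / l)) * (?X1 + ?X2)"
      using l C1 by (subst ennreal_mult) (auto simp: mult.assoc)
    \<comment> \<open>Since q \<theta> = q - 1, all powers of l cancel. This uniformity in l is what
      permits summation over the levels.\<close>
    also have "(4 * l) powr q * (C1 * \<kappa> powr \<theta> / l) = C * \<phi> powr \<theta>"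
    proof -
      have "\<kappa> powr \<theta> = K powr \<theta> * (\<phi> powr \<theta> / (l powr q) powr \<theta>)"
        using K \<phi> l by (simp add: \<kappa>_def m_def powr_mult powr_divide)
      also have "\<dots> = K powr \<theta> * (\<phi> powr \<theta> * l powr (- (q * \<theta>)))"
        unfolding powr_powr by (simp add: powr_minus_divide)
      also have "l powr (- (q * \<theta>)) = l * l powr (- q)"
        unfolding q\<theta> using l by (simp add: powr_diff powr_minus divide_inverse)
      finally have "\<kappa> powr \<theta> / l = K powr \<theta> * \<phi> powr \<theta> * l powr (- q)" using l by simp
      moreover have "(4 * l) powr q * l powr (- q) = 4 powr q"
        using l by (simp add: powr_mult powr_minus)
      ultimately show ?thesis unfolding C_def by (metis (no_types, lifting) mult.assoc mult.commute times_divide_eq_right)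
    qed
    finally show "(\<integral>\<^sup>+x. ennreal (\<bar>U x\<bar> powr p) * indicator {x. snd x > 0 \<and> 2 * l < (U x)\<^sup>2 \<and> (U x)\<^sup>2 \<le> 2 * (2 * l)} x \<partial>hyp)
      \<le> ennreal (C * \<phi> powr (1 - 2 / p)) *
       ((\<integral>\<^sup>+x. ennreal ((snd x)\<^sup>2 * (norm (GU x))\<^sup>2) * indicator {x. snd x > 0 \<and> l < (U x)\<^sup>2 \<and> (U x)\<^sup>2 \<le> 2 * l} x \<partial>hyp)
        + (\<integral>\<^sup>+x. ennreal ((U x)\<^sup>2) * indicator {x. snd x > 0 \<and> 2 * l < (U x)\<^sup>2 \<and> (U x)\<^sup>2 \<le> 2 * (2 * l)} x \<partial>hyp))"
      unfolding L_def \<theta>_def by simp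
  qed
qed

text \<open>The exponents run over all integers, because U may be arbitrarily small or large;
  \<open>int_decode\<close> enumerates them by natural numbers for \<open>suminf\<close>.\<close>

lemma dyadic_shells:
  fixes U :: "'b::euclidean_space \<times> real \<Rightarrow> real" and c :: real
  assumes c: "c > 0"
  defines "L \<equiv> \<lambda>j::nat. {x. snd x > 0 \<and> c * 2 powr int_decode j < (U x)\<^sup>2 \<and> (U x)\<^sup>2 \<le> 2 * (c * 2 powr int_decode j)}"
  shows "disjoint_family L" "(\<Union>j. L j) = {x. snd x > 0 \<and> U x \<noteq> 0}"
proof -
  have two: "2 * (c * 2 powr real_of_int e) = c * 2 powr real_of_int (e + 1)" for e by (simp add: powr_add)
  have L: "L j = {x. snd x > 0 \<and> c * 2 powr int_decode j < (U x)\<^sup>2 \<and> (U x)\<^sup>2 \<le> c * 2 powr real_of_int (int_decode j + 1)}" for j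
    unfolding L_def two ..
  have less: False if "x \<in> L i" "x \<in> L j" "int_decode i < int_decode j" for x i j
  proof -
    have "real_of_int (int_decode i + 1) \<le> real_of_int (int_decode j)" using that(3) by linarith
    then have "c * 2 powr real_of_int (int_decode i + 1) \<le> c * 2 powr real_of_int (int_decode j)"
      using c by (intro mult_left_mono powr_mono) auto
    then show False using that(1,2) unfolding L by auto
  qed
  show "disjoint_family L"
    unfolding disjoint_family_on_def
  proof (intro ballI impI)
    fix i j :: nat assume "i \<noteq> j"
    then have "int_decode i \<noteq> int_decode j" using inj_int_decode by (auto dest: injD)
    then show "L i \<inter> L j = {}" using less by (meson disjoint_iff linorder_neqE_linordered_idom)
  qed
  show "(\<Union>j. L j) = {x. snd x > 0 \<and> U x \<noteq> 0}"
  proof (intro set_eqI iffI)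
    fix x assume "x \<in> (\<Union>j. L j)"
    then obtain j where j: "x \<in> L j" by auto
    have "c * 2 powr int_decode j > 0" using c by simp
    then have "(U x)\<^sup>2 > 0" using j unfolding L by auto
    then show "x \<in> {x. snd x > 0 \<and> U x \<noteq> 0}" using j by (auto simp: L)
  next
    fix x assume x: "x \<in> {x. snd x > 0 \<and> U x \<noteq> 0}"
    define y where "y = (U x)\<^sup>2 / c"
    have y: "y > 0" using x c by (simp add: y_def)
    \<comment> \<open>The ceiling minus one, so that the lower bound is strict and the upper one is
      not, as in the definition of the shells.\<close>
    define e where "e = \<lceil>log 2 y\<rceil> - 1"
    have "real_of_int e < log 2 y" "log 2 y \<le> real_of_int (e + 1)" unfolding e_def by linarith+
    then have "2 powr real_of_int e < y" "y \<le> 2 powr real_of_int (e + 1)"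
      using y by (simp_all add: powr_less_iff le_powr_iff)
    then have "c * 2 powr real_of_int e < (U x)\<^sup>2" "(U x)\<^sup>2 \<le> c * 2 powr real_of_int (e + 1)"
      using c by (simp_all add: y_def field_simps)
    then have "x \<in> L (int_encode e)" using x by (simp add: L)
    then show "x \<in> (\<Union>j. L j)" by blast
  qed
qed

lemma suminf_disjoint_indicator:
  fixes f :: ennreal
  assumes "disjoint_family L"
  shows "(\<Sum>j. f * indicator (L j) x) = f * indicator (\<Union>j. L j) x"
proof (cases "x \<in> (\<Union>j. L j)")
  case True
  then obtain i where "x \<in> L i" by auto
  then show ?thesis using suminf_cmult_indicator[OF assms \<open>x \<in> L i\<close>, of "\<lambda>_. f"] True by simp
qed auto

text \<open>Summing the level set estimate over l = 2^j gives \<phi> \<le> C \<phi>^(1 - 2/p) \<xi>.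
  As \<phi> is a real number, hence finite, the power can be divided out when \<phi> > 0.\<close>

lemma hyperbolic_sobolev:
  fixes p :: real
  assumes p: "p \<ge> 2" and pN: "p * (real DIM('b::euclidean_space \<times> real) - 2) \<le> 2 * real DIM('b \<times> real)"
  obtains C where "C > 0"
    "\<And>(U :: 'b \<times> real \<Rightarrow> real) GU (\<phi>::real) (\<xi>::real). U \<in> borel_measurable borel \<Longrightarrow> GU \<in> borel_measurable borel \<Longrightarrow>
      (\<And>x. snd x > 0 \<Longrightarrow> (U has_derivative (\<lambda>k. GU x \<bullet> k)) (at x)) \<Longrightarrow> (\<And>x. snd x > 0 \<Longrightarrow> isCont GU x) \<Longrightarrow>
      \<phi> \<ge> 0 \<Longrightarrow> \<xi> \<ge> 0 \<Longrightarrow> (\<integral>\<^sup>+x. ennreal (\<bar>U x\<bar> powr p) \<partial>hyp) = ennreal \<phi> \<Longrightarrow>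
      (\<integral>\<^sup>+x. ennreal ((snd x)\<^sup>2 * (norm (GU x))\<^sup>2) \<partial>hyp) + (\<integral>\<^sup>+x. ennreal ((U x)\<^sup>2) \<partial>hyp) \<le> ennreal \<xi> \<Longrightarrow>
      \<phi> powr (2 / p) \<le> C * \<xi>"
proof (rule level_set_estimate[OF p pN])
  fix C :: real
  assume C: "C > 0" and level: "\<And>(U :: 'b \<times> real \<Rightarrow> real) GU (\<phi>::real) (l::real). U \<in> borel_measurable borel \<Longrightarrow> GU \<in> borel_measurable borel \<Longrightarrow>
      (\<And>x. snd x > 0 \<Longrightarrow> (U has_derivative (\<lambda>k. GU x \<bullet> k)) (at x)) \<Longrightarrow> (\<And>x. snd x > 0 \<Longrightarrow> isCont GU x) \<Longrightarrow>
      \<phi> > 0 \<Longrightarrow> (\<integral>\<^sup>+x. ennreal (\<bar>U x\<bar> powr p) \<partial>hyp) \<le> ennreal \<phi> \<Longrightarrow> l > 0 \<Longrightarrow>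
      (\<integral>\<^sup>+x. ennreal (\<bar>U x\<bar> powr p) * indicator {x. snd x > 0 \<and> 2 * l < (U x)\<^sup>2 \<and> (U x)\<^sup>2 \<le> 2 * (2 * l)} x \<partial>hyp)
      \<le> ennreal (C * \<phi> powr (1 - 2 / p)) *
       ((\<integral>\<^sup>+x. ennreal ((snd x)\<^sup>2 * (norm (GU x))\<^sup>2) * indicator {x. snd x > 0 \<and> l < (U x)\<^sup>2 \<and> (U x)\<^sup>2 \<le> 2 * l} x \<partial>hyp)
        + (\<integral>\<^sup>+x. ennreal ((U x)\<^sup>2) * indicator {x. snd x > 0 \<and> 2 * l < (U x)\<^sup>2 \<and> (U x)\<^sup>2 \<le> 2 * (2 * l)} x \<partial>hyp))"
  show thesis
  proof (rule that[OF C])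
    fix U :: "'b \<times> real \<Rightarrow> real" and GU and \<phi> \<xi> :: real
    assume U[measurable]: "U \<in> borel_measurable borel" "GU \<in> borel_measurable borel"
      and der: "\<And>x. snd x > 0 \<Longrightarrow> (U has_derivative (\<lambda>k. GU x \<bullet> k)) (at x)"
      and cont: "\<And>x. snd x > 0 \<Longrightarrow> isCont GU x"
      and \<phi>0: "\<phi> \<ge> 0" and \<xi>0: "\<xi> \<ge> 0" and \<Phi>: "(\<integral>\<^sup>+x. ennreal (\<bar>U x\<bar> powr p) \<partial>hyp) = ennreal \<phi>"
      and X: "(\<integral>\<^sup>+x. ennreal ((snd x)\<^sup>2 * (norm (GU x))\<^sup>2) \<partial>hyp) + (\<integral>\<^sup>+x. ennreal ((U x)\<^sup>2) \<partial>hyp) \<le> ennreal \<xi>"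
    show "\<phi> powr (2 / p) \<le> C * \<xi>"
    proof (cases "\<phi> = 0")
      case False
      then have \<phi>: "\<phi> > 0" using \<phi>0 by simp
      \<comment> \<open>At level l the estimate bounds the potential on the shell that starts at 2 l
        by the gradient on the shell that starts at l. Thus the family with c = 1 is used for the
        gradient and the one with c = 2 for the other two integrals.\<close>
      define S where "S c j = {x::'b \<times> real. snd x > 0 \<and> c * 2 powr int_decode j < (U x)\<^sup>2 \<and> (U x)\<^sup>2 \<le> 2 * (c * 2 powr int_decode j)}" for c j
      have [measurable]: "S c j \<in> sets borel" for c j unfolding S_def by measurable
      have disj: "disjoint_family (S c)" and un: "(\<Union>j. S c j) = {x. snd x > 0 \<and> U x \<noteq> 0}" if "c > 0" for c
        using dyadic_shells[OF that, of U] unfolding S_def by simp_all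
      have swap: "(\<Sum>j. \<integral>\<^sup>+x. f x * indicator (S c j) x \<partial>hyp) = (\<integral>\<^sup>+x. f x * indicator {x. snd x > 0 \<and> U x \<noteq> 0} x \<partial>hyp)"
        if "f \<in> borel_measurable borel" "c > 0" for f c
      proof -
        have "(\<Sum>j. \<integral>\<^sup>+x. f x * indicator (S c j) x \<partial>hyp) = (\<integral>\<^sup>+x. (\<Sum>j. f x * indicator (S c j) x) \<partial>hyp)"
          by (rule nn_integral_suminf[symmetric]) (use that(1) in measurable)
        then show ?thesis by (simp only: suminf_disjoint_indicator[OF disj[OF that(2)]] un[OF that(2)])
      qed
      have le: "(\<Sum>j. \<integral>\<^sup>+x. f x * indicator (S c j) x \<partial>hyp) \<le> (\<integral>\<^sup>+x. f x \<partial>hyp)"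
        if "f \<in> borel_measurable borel" "c > 0" for f c
        unfolding swap[OF that] by (intro nn_integral_mono) (auto simp: indicator_def)
      let ?f = "\<lambda>x. ennreal (\<bar>U x\<bar> powr p)" and ?g = "\<lambda>x. ennreal ((snd x)\<^sup>2 * (norm (GU x))\<^sup>2)" and ?h = "\<lambda>x. ennreal ((U x)\<^sup>2)"
      let ?c = "ennreal (C * \<phi> powr (1 - 2 / p))"
      have "ennreal \<phi> = (\<integral>\<^sup>+x. ?f x * indicator {x. snd x > 0 \<and> U x \<noteq> 0} x \<partial>hyp)"
        unfolding \<Phi>[symmetric]
        by (rule nn_integral_cong_AE, rule eventually_mono[OF AE_hyp_pos]) (auto simp: indicator_def)
      also have "\<dots> = (\<Sum>j. \<integral>\<^sup>+x. ?f x * indicator (S 2 j) x \<partial>hyp)" by (subst swap) auto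
      also have "\<dots> \<le> (\<Sum>j. ?c * ((\<integral>\<^sup>+x. ?g x * indicator (S 1 j) x \<partial>hyp) + (\<integral>\<^sup>+x. ?h x * indicator (S 2 j) x \<partial>hyp)))"
      proof (rule suminf_le)
        fix j
        have "2 powr real_of_int (int_decode j) > 0" by simp
        from level[OF U der cont \<phi> eq_refl[OF \<Phi>] this]
        show "(\<integral>\<^sup>+x. ?f x * indicator (S 2 j) x \<partial>hyp) \<le> ?c * ((\<integral>\<^sup>+x. ?g x * indicator (S 1 j) x \<partial>hyp) + (\<integral>\<^sup>+x. ?h x * indicator (S 2 j) x \<partial>hyp))"
          unfolding S_def by (simp only: mult_1_left)
      qed auto
      also have "\<dots> = ?c * ((\<Sum>j. \<integral>\<^sup>+x. ?g x * indicator (S 1 j) x \<partial>hyp) + (\<Sum>j. \<integral>\<^sup>+x. ?h x * indicator (S 2 j) x \<partial>hyp))"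
        by (simp add: suminf_add)
      also have "\<dots> \<le> ?c * ((\<integral>\<^sup>+x. ?g x \<partial>hyp) + (\<integral>\<^sup>+x. ?h x \<partial>hyp))"
        by (intro mult_left_mono add_mono le) auto
      also have "\<dots> \<le> ?c * ennreal \<xi>" by (rule mult_left_mono[OF X]) simp
      also have "\<dots> = ennreal (C * \<phi> powr (1 - 2 / p) * \<xi>)" using C \<xi>0 by (intro ennreal_mult[symmetric]) auto
      finally have ineq: "\<phi> \<le> C * \<phi> powr (1 - 2 / p) * \<xi>" using C \<xi>0 by (simp add: ennreal_le_iff)
      have "\<phi> powr (1 - 2 / p) * \<phi> powr (2 / p) = \<phi>" using \<phi> by (simp add: powr_add[symmetric])
      then have "\<phi> powr (1 - 2 / p) * \<phi> powr (2 / p) \<le> \<phi> powr (1 - 2 / p) * (C * \<xi>)"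
        using ineq by (simp only: mult_ac)
      then show ?thesis using \<phi> by (simp add: mult_le_cancel_left)
    qed (use C \<xi>0 in auto)
  qed
qed

section \<open>Positivity of the infimum\<close>

lemma test_functions_square_integrable:
  fixes u :: "'a::euclidean_space \<Rightarrow> real"
  assumes "u \<in> test_functions \<Omega>"
  shows "integrable lborel (\<lambda>x. (norm (grad u x))\<^sup>2)" and "integrable lborel (\<lambda>x. (u x)\<^sup>2)"
proof -
  obtain K where K: "compact K" "\<And>x. x \<notin> K \<Longrightarrow> u x = 0" "\<And>x. x \<notin> K \<Longrightarrow> grad u x = 0" and s: "smooth_on UNIV u"
    using test_functionsE[OF assms] by metis
  have c: "continuous_on K u" "continuous_on K (grad u)"
    using continuous_on_subset[OF smooth_on_continuous[OF s]] continuous_on_subset[OF smooth_on_continuous_grad[OF s]] by auto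
  show "integrable lborel (\<lambda>x. (norm (grad u x))\<^sup>2)"
    by (rule integrable_compact_support[OF K(1)]) (use c K(3) in \<open>auto intro!: continuous_intros\<close>)
  show "integrable lborel (\<lambda>x. (u x)\<^sup>2)"
    by (rule integrable_compact_support[OF K(1)]) (use c K(2) in \<open>auto intro!: continuous_intros\<close>)
qed

text \<open>With t the height, the vertical derivative of u^2 / t has integral 0. Young's inequality
  bounds the cross term 2 u u_t / t by half of u^2 / t^2 plus 2 u_t^2; half of u^2 / t^2 survives,
  whence the constant 4.\<close>

lemma hardy_inequality:
  fixes u :: "'b::euclidean_space \<times> real \<Rightarrow> real"
  assumes u: "u \<in> test_functions {x. snd x > 0}"
  shows "integrable lborel (\<lambda>x. (u x)\<^sup>2 / (snd x)\<^sup>2)"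
    and "(\<integral>x. (u x)\<^sup>2 / (snd x)\<^sup>2 \<partial>lborel) \<le> 4 * energy u"
proof -
  obtain K where K: "compact K" "K \<subseteq> {x. snd x > 0}" "\<And>x. x \<notin> K \<Longrightarrow> u x = 0" "\<And>x. x \<notin> K \<Longrightarrow> grad u x = 0"
    and s: "smooth_on UNIV u"
    using test_functionsE[OF u] by metis
  have o: "open {x::'b \<times> real. snd x > 0}" by (intro open_Collect_less continuous_intros)
  define e :: "'b \<times> real" where "e = (0, 1)"
  have e: "e \<in> Basis" by (simp add: e_def Basis_prod_def)
  have xe: "x \<bullet> e = snd x" for x by (simp add: e_def inner_prod_def)
  define f where "f x = (u x * u x) * inverse (snd x)" for x
  have f0: "f x = 0" if "x \<notin> K" for x using K(3)[OF that] by (simp add: f_def)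
  have "smooth_on {x. snd x > 0} f" unfolding f_def
    by (intro smooth_on_mult smooth_on_subset[OF s] smooth_on_inverse smooth_on_linear bounded_linear_snd o) auto
  then have f: "f \<in> test_functions {x. snd x > 0}"
    using K f0 o by (intro test_functionsI[of "{x. snd x > 0}" f K]) auto
  have fs: "smooth_on UNIV f" by (rule test_functions_smooth[OF f])
  have gf0: "grad f x = 0" if "x \<notin> K" for x
    by (rule grad_eq_0_if_constant[of "-K" _ _ 0])
      (use that f0 K(1) in \<open>auto simp: compact_imp_closed open_Compl\<close>)
  have df: "partial_deriv e f x \<le> 2 * (norm (grad u x))\<^sup>2 - (1 / 2) * ((u x)\<^sup>2 / (snd x)\<^sup>2)" for x
  proof (cases "x \<in> K")
    case False
    then show ?thesis using gf0[OF False] K(3,4)[OF False] grad_inner_Basis[OF e, of f x] by simp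
  next
    case True
    then have t: "snd x > 0" using K by auto
    have "(f has_derivative (\<lambda>h. u x * u x * (- (snd h * inverse (snd x) * inverse (snd x))) + 2 * u x * (grad u x \<bullet> h) * inverse (snd x))) (at x)"
      unfolding f_def using t
      by (auto intro!: derivative_eq_intros smooth_on_has_derivative[OF s] simp: fun_eq_iff algebra_simps)
    then have "partial_deriv e f x = - (u x / snd x)\<^sup>2 + 2 * (u x / snd x) * (grad u x \<bullet> e)"
      by (simp add: partial_deriv_eq e_def divide_inverse power2_eq_square algebra_simps)
    moreover have "2 * (u x / snd x) * (grad u x \<bullet> e) \<le> (1 / 2) * (u x / snd x)\<^sup>2 + 2 * (grad u x \<bullet> e)\<^sup>2"
    proof -
      have "2 * y * d \<le> (1 / 2) * y\<^sup>2 + 2 * d\<^sup>2" for y d :: real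
        using zero_le_power2[of "y - 2 * d"] by (simp add: power2_eq_square algebra_simps)
      then show ?thesis .
    qed
    moreover have "(grad u x \<bullet> e)\<^sup>2 \<le> (norm (grad u x))\<^sup>2"
      using Basis_le_norm[OF e, of "grad u x"] by (metis abs_le_square_iff abs_norm_cancel)
    ultimately show ?thesis by (simp add: power_divide)
  qed
  show i: "integrable lborel (\<lambda>x. (u x)\<^sup>2 / (snd x)\<^sup>2)"
  proof (rule integrable_compact_support[OF K(1)])
    show "continuous_on K (\<lambda>x. (u x)\<^sup>2 / (snd x)\<^sup>2)"
      using K(2) by (intro continuous_intros continuous_on_subset[OF smooth_on_continuous[OF s]]) auto
  qed (use K(3) in simp)
  have "0 = (\<integral>x. partial_deriv e f x \<partial>lborel)"
    by (rule integral_partial_deriv_zero[OF fs K(1) f0 gf0 e, symmetric])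
  also have "\<dots> \<le> (\<integral>x. 2 * (norm (grad u x))\<^sup>2 - (1 / 2) * ((u x)\<^sup>2 / (snd x)\<^sup>2) \<partial>lborel)"
  proof (rule integral_mono[OF _ _ df])
    show "integrable lborel (partial_deriv e f)"
    proof (rule integrable_compact_support[OF K(1)])
      show "continuous_on K (partial_deriv e f)"
        using smooth_on_continuous[OF smooth_on_partial_deriv[OF fs e]] by (rule continuous_on_subset) simp
      show "partial_deriv e f x = 0" if "x \<notin> K" for x
        using gf0[OF that] grad_inner_Basis[OF e, of f x] by simp
    qed
  qed (intro Bochner_Integration.integrable_diff integrable_mult_right i test_functions_square_integrable(1)[OF u])
  also have "\<dots> = 2 * energy u - (1 / 2) * (\<integral>x. (u x)\<^sup>2 / (snd x)\<^sup>2 \<partial>lborel)"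
    using i test_functions_square_integrable(1)[OF u]
    by (subst Bochner_Integration.integral_diff) (auto simp del: times_divide_eq_left times_divide_eq_right)
  finally show "(\<integral>x. (u x)\<^sup>2 / (snd x)\<^sup>2 \<partial>lborel) \<le> 4 * energy u" by simp
qed

lemma hardy_sobolev:
  fixes p g :: real
  assumes p: "p \<ge> 2" and pN: "p * (real DIM('b::euclidean_space \<times> real) - 2) \<le> 2 * real DIM('b \<times> real)"
    and g: "g = (real DIM('b \<times> real) - 2) / 2 * p - real DIM('b \<times> real)"
  obtains C where "C > 0" "\<And>u :: 'b \<times> real \<Rightarrow> real. u \<in> test_functions {x. snd x > 0} \<Longrightarrow>
    (\<integral>x. snd x powr g * \<bar>u x\<bar> powr p \<partial>lborel) powr (2 / p) \<le> C * energy u"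
proof (rule hyperbolic_sobolev[OF p pN])
  fix C :: real assume C: "C > 0" and sob: "\<And>(U :: 'b \<times> real \<Rightarrow> real) GU (\<phi>::real) (\<xi>::real). U \<in> borel_measurable borel \<Longrightarrow> GU \<in> borel_measurable borel \<Longrightarrow>
      (\<And>x. snd x > 0 \<Longrightarrow> (U has_derivative (\<lambda>k. GU x \<bullet> k)) (at x)) \<Longrightarrow> (\<And>x. snd x > 0 \<Longrightarrow> isCont GU x) \<Longrightarrow>
      \<phi> \<ge> 0 \<Longrightarrow> \<xi> \<ge> 0 \<Longrightarrow> (\<integral>\<^sup>+x. ennreal (\<bar>U x\<bar> powr p) \<partial>hyp) = ennreal \<phi> \<Longrightarrow>
      (\<integral>\<^sup>+x. ennreal ((snd x)\<^sup>2 * (norm (GU x))\<^sup>2) \<partial>hyp) + (\<integral>\<^sup>+x. ennreal ((U x)\<^sup>2) \<partial>hyp) \<le> ennreal \<xi> \<Longrightarrow>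
      \<phi> powr (2 / p) \<le> C * \<xi>"
  define N where "N = real DIM('b \<times> real)"
  define a where "a = (N - 2) / 2"
  have ga: "g = a * p - N" by (simp add: g a_def N_def)
  have p0: "p > 0" using p by simp
  \<comment> \<open>The 2 and the 2 a^2 come from squaring a sum of two terms in \<open>GU\<close>,
    the 1 from the square of \<open>U\<close>, and the 4 from Hardy's inequality.\<close>
  define C' where "C' = C * (2 + (2 * a\<^sup>2 + 1) * 4)"
  have C': "C' > 0" using C unfolding C'_def by (intro mult_pos_pos add_pos_nonneg) auto
  show thesis
  proof (rule that[OF C'])
    fix u :: "'b \<times> real \<Rightarrow> real" assume u: "u \<in> test_functions {x. snd x > 0}"
    note [measurable] = test_functions_measurable[OF u]
    have s: "smooth_on UNIV u" by (rule test_functions_smooth[OF u])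
    define e :: "'b \<times> real" where "e = (0, 1)"
    have ee: "norm e = 1" by (simp add: e_def norm_prod_def)
    define U where "U x = snd x powr a * u x" for x
    define GU where "GU x = snd x powr a *\<^sub>R grad u x + (a * snd x powr (a - 1) * u x) *\<^sub>R e" for x
    let ?E = "\<integral>x. (norm (grad u x))\<^sup>2 \<partial>lborel"
    let ?P = "\<integral>x. snd x powr g * \<bar>u x\<bar> powr p \<partial>lborel"
    define \<xi> where "\<xi> = 2 * ?E + (2 * a\<^sup>2 + 1) * (\<integral>x. (u x)\<^sup>2 / (snd x)\<^sup>2 \<partial>lborel)"
    have E0: "?E \<ge> 0" by (intro Bochner_Integration.integral_nonneg) simp
    have H0: "(\<integral>x. (u x)\<^sup>2 / (snd x)\<^sup>2 \<partial>lborel) \<ge> 0" by (intro Bochner_Integration.integral_nonneg) simp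
    have u0: "u x = 0" if "\<not> snd x > 0" for x using test_functions_zero_outside[OF u, of x] that by simp
    have "?P powr (2 / p) \<le> C * \<xi>"
    proof (rule sob[of U GU])
      show "U \<in> borel_measurable borel" "GU \<in> borel_measurable borel" unfolding U_def GU_def by measurable
      show "(U has_derivative (\<lambda>k. GU x \<bullet> k)) (at x)" if x: "snd x > 0" for x
      proof -
        have "((\<lambda>x. snd x powr a) has_derivative (\<lambda>k. a * snd x powr (a - 1) * snd k)) (at x)"
          using x by (auto intro!: derivative_eq_intros simp: fun_eq_iff powr_diff)
        from has_derivative_mult[OF this smooth_on_has_derivative[OF s UNIV_I]]
        show ?thesis by (simp add: U_def[abs_def] GU_def e_def inner_add_left inner_prod_def algebra_simps)
      qed
      show "isCont GU x" if x: "snd x > 0" for x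
      proof -
        have "isCont (grad u) x" "isCont u x"
          using smooth_on_continuous_grad[OF s] smooth_on_continuous[OF s]
          by (simp_all add: continuous_on_eq_continuous_at del: split_paired_All)
        then show ?thesis unfolding GU_def using x by (intro continuous_intros) auto
      qed
      show "?P \<ge> 0" by (intro Bochner_Integration.integral_nonneg) simp
      show "\<xi> \<ge> 0" using E0 H0 by (simp add: \<xi>_def)
      have int: "integrable lborel (\<lambda>x. snd x powr g * \<bar>u x\<bar> powr p)"
        by (rule integrable_potential[OF u _ _ p0, where W=snd]) (auto intro!: continuous_intros)
      have "(\<integral>\<^sup>+x. ennreal (\<bar>U x\<bar> powr p) \<partial>hyp) = (\<integral>\<^sup>+x. hyp_weight x * ennreal (\<bar>U x\<bar> powr p) \<partial>lborel)"
        unfolding U_def by (rule nn_integral_hyp) measurable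
      also have "\<dots> = (\<integral>\<^sup>+x. ennreal (snd x powr g * \<bar>u x\<bar> powr p) \<partial>lborel)"
      proof (rule nn_integral_cong)
        fix x :: "'b \<times> real"
        show "hyp_weight x * ennreal (\<bar>U x\<bar> powr p) = ennreal (snd x powr g * \<bar>u x\<bar> powr p)"
        proof (cases "snd x > 0")
          case True
          have "snd x powr (- N) * \<bar>U x\<bar> powr p = (snd x powr (- N) * snd x powr (a * p)) * \<bar>u x\<bar> powr p"
            by (simp add: U_def abs_mult powr_mult powr_powr)
          also have "snd x powr (- N) * snd x powr (a * p) = snd x powr g" by (simp add: powr_add[symmetric] ga)
          finally show ?thesis using True by (simp add: hyp_weight_def N_def[symmetric] ennreal_mult[symmetric] del: DIM_prod)
        qed (simp add: hyp_weight_def u0)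
      qed
      also have "\<dots> = ennreal ?P" using int by (intro nn_integral_eq_integral) auto
      finally show "(\<integral>\<^sup>+x. ennreal (\<bar>U x\<bar> powr p) \<partial>hyp) = ennreal ?P" .
      have "(\<integral>\<^sup>+x. ennreal ((snd x)\<^sup>2 * (norm (GU x))\<^sup>2) \<partial>hyp) + (\<integral>\<^sup>+x. ennreal ((U x)\<^sup>2) \<partial>hyp) =
          (\<integral>\<^sup>+x. ennreal ((snd x)\<^sup>2 * (norm (GU x))\<^sup>2) + ennreal ((U x)\<^sup>2) \<partial>hyp)"
        unfolding U_def GU_def by (rule nn_integral_add[symmetric]) measurable
      also have "\<dots> = (\<integral>\<^sup>+x. hyp_weight x * (ennreal ((snd x)\<^sup>2 * (norm (GU x))\<^sup>2) + ennreal ((U x)\<^sup>2)) \<partial>lborel)"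
        unfolding U_def GU_def by (rule nn_integral_hyp) measurable
      also have "\<dots> \<le> (\<integral>\<^sup>+x. ennreal (2 * (norm (grad u x))\<^sup>2 + (2 * a\<^sup>2 + 1) * ((u x)\<^sup>2 / (snd x)\<^sup>2)) \<partial>lborel)"
      proof (rule nn_integral_mono)
        fix x :: "'b \<times> real"
        show "hyp_weight x * (ennreal ((snd x)\<^sup>2 * (norm (GU x))\<^sup>2) + ennreal ((U x)\<^sup>2)) \<le>
          ennreal (2 * (norm (grad u x))\<^sup>2 + (2 * a\<^sup>2 + 1) * ((u x)\<^sup>2 / (snd x)\<^sup>2))"
        proof (cases "snd x > 0")
          case True
          define t where "t = snd x"
          have t: "t > 0" using True by (simp add: t_def)
          define T where "T = t powr a"
          have GUx: "GU x = T *\<^sub>R (grad u x + (a * (u x / t)) *\<^sub>R e)"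
            using t by (simp add: GU_def T_def t_def[symmetric] powr_diff algebra_simps)
          \<comment> \<open>The exponent 2 + 2 a - N is 0: passing from u to U and from Lebesgue to
            hyperbolic measure leaves no power of the height in the gradient term.\<close>
          have T: "t\<^sup>2 * T\<^sup>2 * t powr (- N) = 1"
          proof -
            have "t\<^sup>2 * T\<^sup>2 * t powr (- N) = t powr 2 * (t powr a) powr 2 * t powr (- N)" using t by (simp add: T_def)
            also have "\<dots> = t powr (2 + a * 2 + - N)" by (simp only: powr_powr powr_add)
            also have "2 + a * 2 + - N = 0" by (simp add: a_def field_simps)
            finally show ?thesis using t by simp
          qed
          have "norm (grad u x + (a * (u x / t)) *\<^sub>R e) \<le> norm (grad u x) + \<bar>a * (u x / t)\<bar>"
            using norm_triangle_ineq[of "grad u x" "(a * (u x / t)) *\<^sub>R e"] ee by simp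
          then have "(norm (grad u x + (a * (u x / t)) *\<^sub>R e))\<^sup>2 \<le> (norm (grad u x) + \<bar>a * (u x / t)\<bar>)\<^sup>2"
            by (intro power_mono) auto
          also have "\<dots> \<le> 2 * (norm (grad u x))\<^sup>2 + 2 * (a * (u x / t))\<^sup>2"
            using zero_le_power2[of "norm (grad u x) - \<bar>a * (u x / t)\<bar>"]
            by (simp only: power2_sum power2_diff power2_abs)
          finally have g2: "(norm (grad u x + (a * (u x / t)) *\<^sub>R e))\<^sup>2 \<le> 2 * (norm (grad u x))\<^sup>2 + 2 * a\<^sup>2 * ((u x)\<^sup>2 / t\<^sup>2)"
            by (simp add: power_mult_distrib power_divide)
          have "t powr (- N) * (t\<^sup>2 * (norm (GU x))\<^sup>2 + (U x)\<^sup>2) =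
              (t\<^sup>2 * T\<^sup>2 * t powr (- N)) * ((norm (grad u x + (a * (u x / t)) *\<^sub>R e))\<^sup>2 + (u x)\<^sup>2 / t\<^sup>2)"
          proof -
            have n1: "(norm (GU x))\<^sup>2 = T\<^sup>2 * (norm (grad u x + (a * (u x / t)) *\<^sub>R e))\<^sup>2"
              by (simp only: GUx norm_scaleR power_mult_distrib power2_abs)
            have n2: "(U x)\<^sup>2 = T\<^sup>2 * (u x)\<^sup>2"
              by (simp add: U_def T_def t_def power_mult_distrib)
            show ?thesis unfolding n1 n2 using t by (simp add: field_simps)
          qed
          also have "\<dots> \<le> 2 * (norm (grad u x))\<^sup>2 + (2 * a\<^sup>2 + 1) * ((u x)\<^sup>2 / t\<^sup>2)"
          proof -
            have "(2 * a\<^sup>2 + 1) * ((u x)\<^sup>2 / t\<^sup>2) = 2 * a\<^sup>2 * ((u x)\<^sup>2 / t\<^sup>2) + (u x)\<^sup>2 / t\<^sup>2"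
              by (simp only: distrib_right mult_1_left)
            then show ?thesis unfolding T mult_1_left using g2 by linarith
          qed
          finally have "ennreal (t powr (- N) * (t\<^sup>2 * (norm (GU x))\<^sup>2 + (U x)\<^sup>2)) \<le> ennreal (2 * (norm (grad u x))\<^sup>2 + (2 * a\<^sup>2 + 1) * ((u x)\<^sup>2 / t\<^sup>2))"
            by (rule ennreal_leI)
          moreover have "hyp_weight x = ennreal (t powr (- N))"
            using t by (simp add: hyp_weight_def t_def N_def del: DIM_prod)
          ultimately show ?thesis by (simp add: ennreal_mult ennreal_plus t_def[symmetric] del: DIM_prod)
        qed (simp add: hyp_weight_def)
      qed
      also have "\<dots> = ennreal \<xi>"
      proof -
        have I1: "integrable lborel (\<lambda>x. 2 * (norm (grad u x))\<^sup>2)"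
          by (intro integrable_mult_right test_functions_square_integrable(1)[OF u])
        have I2: "integrable lborel (\<lambda>x. (2 * a\<^sup>2 + 1) * ((u x)\<^sup>2 / (snd x)\<^sup>2))"
          by (intro integrable_mult_right hardy_inequality(1)[OF u])
        show ?thesis
          unfolding \<xi>_def
          by (subst nn_integral_eq_integral[OF Bochner_Integration.integrable_add[OF I1 I2]])
            (simp_all only: Bochner_Integration.integral_add[OF I1 I2] integral_mult_right_zero, auto)
      qed
      finally show "(\<integral>\<^sup>+x. ennreal ((snd x)\<^sup>2 * (norm (GU x))\<^sup>2) \<partial>hyp) + (\<integral>\<^sup>+x. ennreal ((U x)\<^sup>2) \<partial>hyp) \<le> ennreal \<xi>" .
    qed
    also have "\<dots> \<le> C * (2 * ?E + (2 * a\<^sup>2 + 1) * (4 * ?E))"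
      unfolding \<xi>_def using C hardy_inequality(2)[OF u] by (intro mult_left_mono add_left_mono) auto
    finally show "?P powr (2 / p) \<le> C' * ?E" by (simp add: C'_def algebra_simps)
  qed
qed

lemma mu_half_space_pos:
  fixes ty :: "'n::finite itself"
  assumes \<beta>: "\<beta> \<ge> 0" and n: "n = real CARD('n)"
    and p: "p = 2 + 2 * \<beta> / (n + 1)" and g: "g = - 2 + (n - 1) / (n + 1) * \<beta>" and g0: "g \<le> 0"
  shows "mu \<beta> (half_space :: 'n upper set) > 0"
proof -
  note p2 = p_ge_2[OF \<beta> n p g g0]
  note gc = g_conv[OF \<beta> n p g g0]
  have pN: "p * (real DIM('n upper) - 2) \<le> 2 * real DIM('n upper)"
    using gc g0 by (simp add: mult.commute)
  have half: "(half_space :: 'n upper set) = {x. snd x > 0}" by (auto simp: half_space_def)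
  show ?thesis
  proof (rule hardy_sobolev[OF p2 pN gc])
    fix C :: real assume C: "C > 0" and hs: "\<And>u :: 'n upper \<Rightarrow> real. u \<in> test_functions {x. snd x > 0} \<Longrightarrow>
      (\<integral>x. snd x powr g * \<bar>u x\<bar> powr p \<partial>lborel) powr (2 / p) \<le> C * energy u"
    have "1 / C \<le> mu \<beta> (half_space :: 'n upper set)"
      unfolding mu_def
    proof (rule cINF_greatest[OF nonzero_test_functions(2)[OF \<beta> n p g g0]])
      fix u :: "'n upper \<Rightarrow> real" assume "u \<in> test_functions half_space - {\<lambda>x. 0}"
      then have u: "u \<in> test_functions half_space" "u \<noteq> (\<lambda>x. 0)" by auto
      have eq: "x \<bullet> (0, 1) = snd x" for x :: "'n upper" by (simp add: inner_prod_def)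
      have "(\<integral>x. snd x powr g * \<bar>u x\<bar> powr p \<partial>lborel) > 0"
        using half_space_potential_pos[OF \<beta> n p g g0 u] by (simp only: eq)
      then have "(\<integral>x. snd x powr g * \<bar>u x\<bar> powr p \<partial>lborel) powr (2 / p) > 0" by simp
      then show "1 / C \<le> J_quot \<beta> half_space u (grad u)"
        unfolding J_quot_half_space[OF \<beta> n p g g0 u(1)] eq using hs[OF u(1)[unfolded half]] C
        by (simp add: field_simps)
    qed
    then show "mu \<beta> (half_space :: 'n upper set) > 0" using C by (metis less_le_trans zero_less_divide_1_iff)
  qed
qed

section \<open>Approximation in the Sobolev space\<close>

lemma borel_measurable_lebesgue_onI:
  "f \<in> borel_measurable borel \<Longrightarrow> f \<in> borel_measurable (lebesgue_on \<Omega>)"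
  by (intro measurable_restrict_space1 measurable_completion) simp

lemma integrable_lebesgue_on:
  fixes f :: "'a::euclidean_space \<Rightarrow> 'b::euclidean_space"
  assumes "integrable lborel f" "\<Omega> \<in> sets lebesgue"
  shows "integrable (lebesgue_on \<Omega>) f"
proof -
  have "integrable lebesgue f" using assms(1) by (simp add: integrable_completion)
  then have "integrable lebesgue (\<lambda>x. indicator \<Omega> x *\<^sub>R f x)"
    using assms(2) by (rule integrable_mult_indicator[rotated])
  then show ?thesis using assms(2) by (simp add: integrable_restrict_space)
qed

lemma test_functions_partial_deriv:
  assumes u: "u \<in> test_functions \<Omega>" and b: "b \<in> Basis"
  shows "partial_deriv b u \<in> test_functions \<Omega>"
proof (rule test_functionsE[OF u])
  fix K assume K: "compact K" "K \<subseteq> \<Omega>" "\<And>x. x \<notin> K \<Longrightarrow> grad u x = 0" and s: "smooth_on UNIV u"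
  show ?thesis
  proof (rule test_functionsI[of UNIV _ K])
    show "smooth_on UNIV (partial_deriv b u)" by (rule smooth_on_partial_deriv[OF s b])
    show "partial_deriv b u x = 0" if "x \<notin> K" for x
      using K(3)[OF that] grad_inner_Basis[OF b, of u x] by simp
  qed (use K in auto)
qed

lemma grad_zero_outside:
  assumes "u \<in> test_functions \<Omega>" "x \<notin> \<Omega>"
  shows "grad u x = 0"
proof (rule test_functionsE[OF assms(1)])
  fix K assume "K \<subseteq> \<Omega>" "\<And>x. x \<notin> K \<Longrightarrow> grad u x = 0"
  then show "grad u x = 0" using assms(2) by auto
qed

lemma L2_on_grad:
  fixes u :: "'a::euclidean_space \<Rightarrow> real"
  assumes "u \<in> test_functions \<Omega>" "\<Omega> \<in> sets lebesgue"
  shows "L2_on \<Omega> (grad u)" "L2_on \<Omega> u"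
  unfolding L2_on_def
  using test_functions_square_integrable[OF assms(1)] test_functions_measurable[OF assms(1)] assms(2)
  by (auto intro!: borel_measurable_lebesgue_onI integrable_lebesgue_on)

lemma L2_on_diff:
  assumes "L2_on \<Omega> f" "L2_on \<Omega> h"
  shows "L2_on \<Omega> (\<lambda>x. f x - h x)"
  unfolding L2_on_def
proof
  have [measurable]: "f \<in> borel_measurable (lebesgue_on \<Omega>)" "h \<in> borel_measurable (lebesgue_on \<Omega>)"
    using assms by (auto simp: L2_on_def)
  show "(\<lambda>x. f x - h x) \<in> borel_measurable (lebesgue_on \<Omega>)" by measurable
  show "integrable (lebesgue_on \<Omega>) (\<lambda>x. (norm (f x - h x))\<^sup>2)"
  proof (rule Bochner_Integration.integrable_bound)
    show "integrable (lebesgue_on \<Omega>) (\<lambda>x. 2 * (norm (f x))\<^sup>2 + 2 * (norm (h x))\<^sup>2)"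
      using assms by (auto simp: L2_on_def)
    have "(norm (f x - h x))\<^sup>2 \<le> 2 * (norm (f x))\<^sup>2 + 2 * (norm (h x))\<^sup>2" for x
    proof -
      have "(norm (f x - h x))\<^sup>2 \<le> (norm (f x) + norm (h x))\<^sup>2"
        by (intro power_mono norm_triangle_ineq4) auto
      also have "\<dots> \<le> 2 * (norm (f x))\<^sup>2 + 2 * (norm (h x))\<^sup>2"
        using zero_le_power2[of "norm (f x) - norm (h x)"] by (simp only: power2_sum power2_diff)
      finally show ?thesis .
    qed
    then show "AE x in lebesgue_on \<Omega>. norm ((norm (f x - h x))\<^sup>2) \<le> norm (2 * (norm (f x))\<^sup>2 + 2 * (norm (h x))\<^sup>2)"
      by simp
  qed measurable
qed

lemma integrable_inner_L2:
  assumes "L2_on \<Omega> f" "L2_on \<Omega> h"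
  shows "integrable (lebesgue_on \<Omega>) (\<lambda>x. f x \<bullet> h x)"
proof (rule Bochner_Integration.integrable_bound)
  have [measurable]: "f \<in> borel_measurable (lebesgue_on \<Omega>)" "h \<in> borel_measurable (lebesgue_on \<Omega>)"
    using assms by (auto simp: L2_on_def)
  show "(\<lambda>x. f x \<bullet> h x) \<in> borel_measurable (lebesgue_on \<Omega>)" by measurable
  show "integrable (lebesgue_on \<Omega>) (\<lambda>x. (norm (f x))\<^sup>2 + (norm (h x))\<^sup>2)"
    using assms by (auto simp: L2_on_def)
  have "\<bar>f x \<bullet> h x\<bar> \<le> (norm (f x))\<^sup>2 + (norm (h x))\<^sup>2" for x
  proof -
    have "\<bar>f x \<bullet> h x\<bar> \<le> norm (f x) * norm (h x)" by (rule Cauchy_Schwarz_ineq2)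
    also have "\<dots> \<le> (norm (f x))\<^sup>2 + (norm (h x))\<^sup>2"
    proof -
      have "2 * (norm (f x) * norm (h x)) \<le> (norm (f x))\<^sup>2 + (norm (h x))\<^sup>2"
        using zero_le_power2[of "norm (f x) - norm (h x)"] by (simp add: power2_diff mult.assoc)
      moreover have "norm (f x) * norm (h x) \<ge> 0" by simp
      ultimately show ?thesis by linarith
    qed
    finally show ?thesis .
  qed
  then show "AE x in lebesgue_on \<Omega>. norm (f x \<bullet> h x) \<le> norm ((norm (f x))\<^sup>2 + (norm (h x))\<^sup>2)" by simp
qed

text \<open>The components of grad \<phi> are test functions themselves, so the definition of the
  weak gradient applies to each of them. The right-hand side depends on \<open>u\<close>
  only.\<close>

lemma W12_gradient_inner_grad:
  fixes u :: "'a::euclidean_space \<Rightarrow> real"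
  assumes G: "W12_gradient \<Omega> u G" and \<phi>: "\<phi> \<in> test_functions \<Omega>" and \<Omega>: "\<Omega> \<in> sets lebesgue"
  shows "(\<integral>x. G x \<bullet> grad \<phi> x \<partial>lebesgue_on \<Omega>) =
    - (\<Sum>b\<in>Basis. \<integral>x. u x * partial_deriv b (partial_deriv b \<phi>) x \<partial>lebesgue_on \<Omega>)"
proof -
  have L2: "L2_on \<Omega> G" using G by (simp add: W12_gradient_def)
  have L2b: "L2_on \<Omega> (\<lambda>x. G x \<bullet> b)" if b: "b \<in> Basis" for b
    unfolding L2_on_def
  proof
    have [measurable]: "G \<in> borel_measurable (lebesgue_on \<Omega>)" using L2 by (simp add: L2_on_def)
    show "(\<lambda>x. G x \<bullet> b) \<in> borel_measurable (lebesgue_on \<Omega>)" by measurable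
    have "norm ((norm (G x \<bullet> b))\<^sup>2) \<le> norm ((norm (G x))\<^sup>2)" for x
      using power_mono[OF Basis_le_norm[OF b, of "G x"], of 2] by simp
    then have ae: "AE x in lebesgue_on \<Omega>. norm ((norm (G x \<bullet> b))\<^sup>2) \<le> norm ((norm (G x))\<^sup>2)" by simp
    show "integrable (lebesgue_on \<Omega>) (\<lambda>x. (norm (G x \<bullet> b))\<^sup>2)"
    proof (rule Bochner_Integration.integrable_bound[OF _ _ ae])
      show "integrable (lebesgue_on \<Omega>) (\<lambda>x. (norm (G x))\<^sup>2)" using L2 by (simp add: L2_on_def)
    qed measurable
  qed
  have int: "integrable (lebesgue_on \<Omega>) (\<lambda>x. (G x \<bullet> b) * partial_deriv b \<phi> x)" if b: "b \<in> Basis" for b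
    using integrable_inner_L2[OF L2b[OF b] L2_on_grad(2)[OF test_functions_partial_deriv[OF \<phi> b] \<Omega>]] by simp
  have inner: "G x \<bullet> grad \<phi> x = (\<Sum>b\<in>Basis. (G x \<bullet> b) * partial_deriv b \<phi> x)" for x
    by (subst euclidean_inner) (simp add: grad_inner_Basis)
  have "(\<integral>x. G x \<bullet> grad \<phi> x \<partial>lebesgue_on \<Omega>) = (\<integral>x. (\<Sum>b\<in>Basis. (G x \<bullet> b) * partial_deriv b \<phi> x) \<partial>lebesgue_on \<Omega>)"
    by (simp only: inner)
  also have "\<dots> = (\<Sum>b\<in>Basis. \<integral>x. (G x \<bullet> b) * partial_deriv b \<phi> x \<partial>lebesgue_on \<Omega>)"
    using int by (rule Bochner_Integration.integral_sum)
  also have "\<dots> = (\<Sum>b\<in>Basis. - (\<integral>x. u x * partial_deriv b (partial_deriv b \<phi>) x \<partial>lebesgue_on \<Omega>))"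
  proof (rule sum.cong[OF refl])
    fix b :: 'a assume b: "b \<in> Basis"
    then show "(\<integral>x. (G x \<bullet> b) * partial_deriv b \<phi> x \<partial>lebesgue_on \<Omega>) =
        - (\<integral>x. u x * partial_deriv b (partial_deriv b \<phi>) x \<partial>lebesgue_on \<Omega>)"
      using G test_functions_partial_deriv[OF \<phi> b] by (simp add: W12_gradient_def)
  qed
  finally show ?thesis by (simp add: sum_negf)
qed

text \<open>Any two weak gradients \<open>G\<close>, \<open>Du\<close> of \<open>u\<close> have the same inner product with \<open>grad \<phi>\<close>, which
  spares us the proof that weak gradients are unique.\<close>

lemma eventually_energy_le:
  fixes u :: "'a::euclidean_space \<Rightarrow> real"
  assumes \<Omega>: "\<Omega> \<in> sets lebesgue" and G: "W12_gradient \<Omega> u G" and Du: "W12_gradient \<Omega> u Du"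
    and \<phi>: "\<And>k. \<phi> k \<in> test_functions \<Omega>"
    and lim: "(\<lambda>k. \<integral>x. (norm (grad (\<phi> k) x - G x))\<^sup>2 \<partial>lebesgue_on \<Omega>) \<longlonglongrightarrow> 0"
    and c: "c > (\<integral>x. (norm (Du x))\<^sup>2 \<partial>lebesgue_on \<Omega>)"
  shows "\<forall>\<^sub>F k in sequentially. energy (\<phi> k) \<le> c"
proof -
  let ?M = "lebesgue_on \<Omega>"
  define E where "E = (\<integral>x. (norm (Du x))\<^sup>2 \<partial>?M)"
  have E: "E \<ge> 0" unfolding E_def by (intro Bochner_Integration.integral_nonneg) simp
  \<comment> \<open>The solution of (E + s) / (1 - s) = c.\<close>
  define s where "s = (c - E) / (1 + c)"
  have s: "0 < s" "s < 1" and sc: "(E + s) / (1 - s) \<le> c"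
  proof -
    have cE: "c > E" using c by (simp add: E_def)
    then show "0 < s" "s < 1" using E by (simp_all add: s_def field_simps)
    have "s * (1 + c) = c - E" using cE E by (simp add: s_def)
    then have "E + s \<le> c * (1 - s)" by (simp add: algebra_simps)
    then show "(E + s) / (1 - s) \<le> c" using \<open>s < 1\<close> by (simp add: pos_divide_le_eq)
  qed
  have "\<forall>\<^sub>F k in sequentially. (\<integral>x. (norm (grad (\<phi> k) x - G x))\<^sup>2 \<partial>?M) < s\<^sup>2"
    using lim s by (intro order_tendstoD) auto
  then show ?thesis
  proof (rule eventually_mono)
    fix k assume k: "(\<integral>x. (norm (grad (\<phi> k) x - G x))\<^sup>2 \<partial>?M) < s\<^sup>2"
    let ?a = "grad (\<phi> k)"
    define e where "e = (\<integral>x. (norm (?a x))\<^sup>2 \<partial>?M)"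
    define \<eta> where "\<eta> = (\<integral>x. (norm (?a x - G x))\<^sup>2 \<partial>?M)"
    have La: "L2_on \<Omega> ?a" by (rule L2_on_grad[OF \<phi> \<Omega>])
    have LG: "L2_on \<Omega> G" and LD: "L2_on \<Omega> Du" using G Du by (auto simp: W12_gradient_def)
    have Ld: "L2_on \<Omega> (\<lambda>x. ?a x - G x)" by (rule L2_on_diff[OF La LG])
    have eq: "(\<integral>x. G x \<bullet> ?a x \<partial>?M) = (\<integral>x. Du x \<bullet> ?a x \<partial>?M)"
      unfolding W12_gradient_inner_grad[OF G \<phi> \<Omega>] W12_gradient_inner_grad[OF Du \<phi> \<Omega>] ..
    \<comment> \<open>Write a for grad \<phi> and split |a|^2 as a \<bullet> (a - G) + a \<bullet>
      Du + (G \<bullet> a - Du \<bullet> a). Young's inequality with parameter s handles the first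
      product and with parameter 1 the second; the last bracket integrates to 0 by
      \<open>eq\<close>. The remaining multiple of |a|^2 is absorbed on the left.\<close>
    have "(\<integral>x. (norm (?a x))\<^sup>2 \<partial>?M) \<le> (\<integral>x. ((s + 1) / 2 * (norm (?a x))\<^sup>2 + 1 / (2 * s) * (norm (?a x - G x))\<^sup>2
        + 1 / 2 * (norm (Du x))\<^sup>2) + (G x \<bullet> ?a x - Du x \<bullet> ?a x) \<partial>?M)"
    proof (rule integral_mono)
      show "integrable ?M (\<lambda>x. (norm (?a x))\<^sup>2)" using La by (simp add: L2_on_def)
      show "integrable ?M (\<lambda>x. ((s + 1) / 2 * (norm (?a x))\<^sup>2 + 1 / (2 * s) * (norm (?a x - G x))\<^sup>2
        + 1 / 2 * (norm (Du x))\<^sup>2) + (G x \<bullet> ?a x - Du x \<bullet> ?a x))"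
        using La LD Ld integrable_inner_L2[OF LG La] integrable_inner_L2[OF LD La]
        unfolding L2_on_def by (intro Bochner_Integration.integrable_add Bochner_Integration.integrable_diff integrable_mult_right) auto
      fix x
      have young: "y \<bullet> z \<le> t / 2 * (norm y)\<^sup>2 + 1 / (2 * t) * (norm z)\<^sup>2" if t: "t > 0" for y z :: 'a and t :: real
      proof -
        have "0 \<le> (norm (t *\<^sub>R y - z))\<^sup>2" by simp
        also have "\<dots> = t\<^sup>2 * (norm y)\<^sup>2 - 2 * t * (y \<bullet> z) + (norm z)\<^sup>2"
          unfolding power2_norm_eq_inner
          by (simp add: inner_diff_left inner_diff_right inner_commute power2_eq_square algebra_simps)
        finally have "2 * t * (y \<bullet> z) \<le> t\<^sup>2 * (norm y)\<^sup>2 + (norm z)\<^sup>2" by simp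
        then have "y \<bullet> z \<le> (t\<^sup>2 * (norm y)\<^sup>2 + (norm z)\<^sup>2) / (2 * t)" using t by (simp add: field_simps)
        also have "\<dots> = t / 2 * (norm y)\<^sup>2 + 1 / (2 * t) * (norm z)\<^sup>2" using t by (simp add: field_simps power2_eq_square)
        finally show ?thesis .
      qed
      have "(norm (?a x))\<^sup>2 = ?a x \<bullet> (?a x - G x) + ?a x \<bullet> Du x + (G x \<bullet> ?a x - Du x \<bullet> ?a x)"
        by (simp add: power2_norm_eq_inner inner_diff_right inner_commute)
      also have "\<dots> \<le> (s / 2 * (norm (?a x))\<^sup>2 + 1 / (2 * s) * (norm (?a x - G x))\<^sup>2) + (1 / 2 * (norm (?a x))\<^sup>2 + 1 / (2 * 1) * (norm (Du x))\<^sup>2)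
          + (G x \<bullet> ?a x - Du x \<bullet> ?a x)"
        by (intro add_right_mono add_mono young) (use s in auto)
      finally show "(norm (?a x))\<^sup>2 \<le> ((s + 1) / 2 * (norm (?a x))\<^sup>2 + 1 / (2 * s) * (norm (?a x - G x))\<^sup>2
        + 1 / 2 * (norm (Du x))\<^sup>2) + (G x \<bullet> ?a x - Du x \<bullet> ?a x)"
        by (simp add: algebra_simps add_divide_distrib)
    qed
    also have "\<dots> = (s + 1) / 2 * e + 1 / (2 * s) * \<eta> + 1 / 2 * E + ((\<integral>x. G x \<bullet> ?a x \<partial>?M) - (\<integral>x. Du x \<bullet> ?a x \<partial>?M))"
      using La LD Ld integrable_inner_L2[OF LG La] integrable_inner_L2[OF LD La]
      unfolding L2_on_def e_def \<eta>_def E_def by simp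
    finally have "e \<le> (s + 1) / 2 * e + 1 / (2 * s) * \<eta> + 1 / 2 * E" by (simp add: eq e_def)
    moreover have "1 / (2 * s) * \<eta> \<le> 1 / (2 * s) * s\<^sup>2" using k s by (intro mult_left_mono) (auto simp: \<eta>_def)
    moreover have "1 / (2 * s) * s\<^sup>2 = s / 2" using s by (simp add: power2_eq_square)
    ultimately have "e \<le> (s + 1) / 2 * e + s / 2 + 1 / 2 * E" by linarith
    then have "e * (1 - s) \<le> E + s" by (simp add: field_simps)
    then have "e \<le> (E + s) / (1 - s)" using s by (simp add: pos_le_divide_eq)
    then have "e \<le> c" using sc by linarith
    moreover have "(\<integral>x. (norm (?a x))\<^sup>2 \<partial>lborel) = e"
      unfolding e_def using test_functions_measurable(2)[OF \<phi>[of k]] grad_zero_outside[OF \<phi>] \<Omega>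
      by (intro integral_lebesgue_on_eq_lborel[symmetric]) auto
    ultimately show "(\<integral>x. (norm (?a x))\<^sup>2 \<partial>lborel) \<le> c" by simp
  qed
qed

lemma fatou_eventually:
  fixes f :: "nat \<Rightarrow> 'a \<Rightarrow> real"
  assumes "\<And>k. f k \<in> borel_measurable M" "AE x in M. (\<lambda>k. f k x) \<longlonglongrightarrow> h x"
    and "\<forall>\<^sub>F k in sequentially. (\<integral>\<^sup>+x. ennreal (f k x) \<partial>M) \<le> c"
  shows "(\<integral>\<^sup>+x. ennreal (h x) \<partial>M) \<le> c"
proof -
  have "(\<integral>\<^sup>+x. ennreal (h x) \<partial>M) = (\<integral>\<^sup>+x. liminf (\<lambda>k. ennreal (f k x)) \<partial>M)"
  proof (rule nn_integral_cong_AE, rule eventually_mono[OF assms(2)])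
    fix x assume "(\<lambda>k. f k x) \<longlonglongrightarrow> h x"
    then have "(\<lambda>k. ennreal (f k x)) \<longlonglongrightarrow> ennreal (h x)" by (rule tendsto_ennrealI)
    then show "ennreal (h x) = liminf (\<lambda>k. ennreal (f k x))"
      by (simp add: lim_imp_Liminf)
  qed
  also have "\<dots> \<le> liminf (\<lambda>k. \<integral>\<^sup>+x. ennreal (f k x) \<partial>M)"
    using assms(1) by (intro nn_integral_liminf) auto
  also have "\<dots> \<le> limsup (\<lambda>k. \<integral>\<^sup>+x. ennreal (f k x) \<partial>M)" by (rule Liminf_le_Limsup) simp
  also have "\<dots> \<le> c" using assms(3) by (rule Limsup_bounded)
  finally show ?thesis .
qed

text \<open>The approximants have energy eventually below each c > E, but possibly never at most E.
  Bounds obtained for all such c are brought to E here.\<close>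

lemma ennreal_le_limit:
  fixes F :: "real \<Rightarrow> real"
  assumes "isCont F E" "\<And>c. c > E \<Longrightarrow> y \<le> ennreal (F c)"
  shows "y \<le> ennreal (F E)"
proof -
  have "((\<lambda>c. ennreal (F c)) \<longlongrightarrow> ennreal (F E)) (at_right E)"
    using assms(1) by (intro tendsto_ennrealI) (auto simp: isCont_def intro: tendsto_within_subset)
  then show ?thesis
    by (rule tendsto_lowerbound) (auto simp: eventually_at_filter intro!: always_eventually assms(2))
qed

section \<open>Non-attainment\<close>

text \<open>The tangent of a convex function lies below it; the mean value theorem gives the slope.
  For a = 0 the left-hand side is 0 even if p = 1, because \<open>0 powr 0 = 0\<close>.\<close>

lemma bernoulli_powr:
  fixes a h p :: real
  assumes "a \<ge> 0" "h \<ge> 0" "p \<ge> 1"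
  shows "a powr p + p * h * a powr (p - 1) \<le> (a + h) powr p"
proof (cases "a = 0 \<or> h = 0")
  case False
  then have a: "a > 0" and h: "a < a + h" using assms by auto
  have "\<exists>z>a. z < a + h \<and> (a + h) powr p - a powr p = (a + h - a) * (p * z powr (p - 1))"
    by (rule MVT2[OF h]) (use a in \<open>auto intro!: derivative_eq_intros simp: powr_diff\<close>)
  then obtain z where z: "z > a" "(a + h) powr p - a powr p = h * (p * z powr (p - 1))" by auto
  have "h * (p * a powr (p - 1)) \<le> h * (p * z powr (p - 1))"
    using z a assms by (intro mult_left_mono powr_mono2) auto
  then show ?thesis using z(2) by (simp add: algebra_simps)
qed auto

text \<open>The absolute value is smoothed to sqrt (\<phi>^2 + \<eta>^2) - \<eta>, which loses at
  most \<eta> = \<epsilon>/2 of the added \<epsilon> \<zeta>. The smoothing does not increase the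
  gradient. There is no cross term in the energy, since grad \<zeta> vanishes in the open unit ball
  and grad \<phi> outside it.\<close>

lemma regularized_perturbation:
  fixes \<phi> \<zeta> :: "'a::euclidean_space \<Rightarrow> real"
  assumes \<phi>: "\<phi> \<in> test_functions (ball 0 1)" and \<zeta>: "\<zeta> \<in> test_functions (cball 0 2)" "\<And>x. norm x \<le> 1 \<Longrightarrow> \<zeta> x = 1"
    and \<epsilon>: "\<epsilon> > 0"
  obtains w where "w \<in> test_functions (cball 0 2)" "\<And>x. norm x < 1 \<Longrightarrow> \<bar>\<phi> x\<bar> + \<epsilon> / 2 \<le> w x"
    "energy w \<le> energy \<phi> + \<epsilon>\<^sup>2 * energy \<zeta>"
proof -
  define \<eta> where "\<eta> = \<epsilon> / 2"
  have \<eta>: "\<eta> > 0" using \<epsilon> by (simp add: \<eta>_def)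
  define q where "q x = \<phi> x * \<phi> x + \<eta> * \<eta>" for x
  have q: "q x > 0" for x unfolding q_def using \<eta> by (intro add_nonneg_pos) auto
  define w where "w x = q x powr (1 / 2) - \<eta> + \<epsilon> * \<zeta> x" for x
  have s\<phi>: "smooth_on UNIV \<phi>" and s\<zeta>: "smooth_on UNIV \<zeta>"
    using \<phi> \<zeta>(1) by (auto intro: test_functions_smooth)
  have w: "w \<in> test_functions (cball 0 2)"
  proof (rule test_functionsI[of UNIV _ "cball 0 2"])
    show "smooth_on UNIV w" unfolding w_def
      by (intro smooth_on_add smooth_on_diff smooth_on_mult smooth_on_const smooth_on_powr s\<zeta> q)
        (auto simp: q_def[abs_def] intro!: smooth_on_add smooth_on_mult smooth_on_const s\<phi>)
    fix x :: 'a assume x: "x \<notin> cball 0 2"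
    then have "\<phi> x = 0" "\<zeta> x = 0"
      using test_functions_zero_outside[OF \<phi>, of x] test_functions_zero_outside[OF \<zeta>(1) x] by auto
    moreover have "(\<eta> * \<eta>) powr (1 / 2) = \<eta>" using \<eta> by (simp add: powr_half_sqrt)
    ultimately show "w x = 0" by (simp add: w_def q_def)
  qed auto
  have grad: "grad w x = (\<phi> x * q x powr (- (1 / 2))) *\<^sub>R grad \<phi> x + \<epsilon> *\<^sub>R grad \<zeta> x" for x
  proof (rule grad_eqI)
    have "(q has_derivative (\<lambda>h. 2 * \<phi> x * (grad \<phi> x \<bullet> h))) (at x)"
      unfolding q_def by (auto intro!: derivative_eq_intros smooth_on_has_derivative[OF s\<phi>])
    moreover have "((\<lambda>y. y powr (1 / 2)) has_real_derivative (1 / 2) * q x powr (- (1 / 2))) (at (q x))"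
      using q[of x] by (auto intro!: derivative_eq_intros simp: powr_diff powr_minus field_simps powr_half_sqrt)
    ultimately have dq: "((\<lambda>x. q x powr (1 / 2)) has_derivative (\<lambda>h. (1 / 2) * q x powr (- (1 / 2)) * (2 * \<phi> x * (grad \<phi> x \<bullet> h)))) (at x)"
      unfolding has_field_derivative_def by (rule has_derivative_compose)
    have "(w has_derivative (\<lambda>h. (1 / 2) * q x powr (- (1 / 2)) * (2 * \<phi> x * (grad \<phi> x \<bullet> h)) - 0 + \<epsilon> * (grad \<zeta> x \<bullet> h))) (at x)"
      unfolding w_def
      by (intro has_derivative_add has_derivative_diff has_derivative_const dq has_derivative_mult_right
          smooth_on_has_derivative[OF s\<zeta>] UNIV_I)
    then show "(w has_derivative (\<lambda>h. ((\<phi> x * q x powr (- (1 / 2))) *\<^sub>R grad \<phi> x + \<epsilon> *\<^sub>R grad \<zeta> x) \<bullet> h)) (at x)"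
      by (simp add: inner_add_left algebra_simps)
  qed
  have bound: "(norm (grad w x))\<^sup>2 \<le> (norm (grad \<phi> x))\<^sup>2 + \<epsilon>\<^sup>2 * (norm (grad \<zeta> x))\<^sup>2" for x
  proof (cases "norm x < 1")
    case True
    have "grad \<zeta> x = 0"
      by (rule grad_eq_0_if_constant[of "ball 0 1" _ _ 1]) (use True \<zeta>(2) in auto)
    moreover have "\<bar>\<phi> x * q x powr (- (1 / 2))\<bar> \<le> 1"
    proof -
      have "\<bar>\<phi> x\<bar> = sqrt (\<phi> x * \<phi> x)" by simp
      also have "\<dots> \<le> sqrt (q x)" by (rule real_sqrt_le_mono) (simp add: q_def)
      also have "\<dots> = q x powr (1 / 2)" using q[of x] by (simp add: powr_half_sqrt)
      finally show ?thesis using q[of x] by (simp add: abs_mult powr_minus field_simps)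
    qed
    then have "\<bar>\<phi> x * q x powr (- (1 / 2))\<bar>\<^sup>2 * (norm (grad \<phi> x))\<^sup>2 \<le> 1\<^sup>2 * (norm (grad \<phi> x))\<^sup>2"
      by (intro mult_right_mono power_mono) auto
    then have "(norm ((\<phi> x * q x powr (- (1 / 2))) *\<^sub>R grad \<phi> x))\<^sup>2 \<le> (norm (grad \<phi> x))\<^sup>2"
      by (simp only: norm_scaleR power_mult_distrib power_one mult_1_left)
    ultimately show ?thesis unfolding grad by (simp del: norm_scaleR)
  next
    case False
    then have "x \<notin> ball 0 1" by simp
    then have "grad \<phi> x = 0" by (rule grad_zero_outside[OF \<phi>])
    then show ?thesis unfolding grad by (simp add: power_mult_distrib)
  qed
  show thesis
  proof (rule that[OF w])
    show "\<bar>\<phi> x\<bar> + \<epsilon> / 2 \<le> w x" if "norm x < 1" for x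
    proof -
      have "\<bar>\<phi> x\<bar> = sqrt (\<phi> x * \<phi> x)" by simp
      also have "\<dots> \<le> sqrt (q x)" by (rule real_sqrt_le_mono) (simp add: q_def)
      also have "\<dots> = q x powr (1 / 2)" using q[of x] by (simp add: powr_half_sqrt)
      finally show ?thesis using that \<zeta>(2)[of x] by (simp add: w_def \<eta>_def)
    qed
    have "energy w \<le> (\<integral>x. (norm (grad \<phi> x))\<^sup>2 + \<epsilon>\<^sup>2 * (norm (grad \<zeta> x))\<^sup>2 \<partial>lborel)"
      by (rule integral_mono[OF _ _ bound])
        (intro test_functions_square_integrable(1)[OF w] Bochner_Integration.integrable_add integrable_mult_right
          test_functions_square_integrable(1)[OF \<phi>] test_functions_square_integrable(1)[OF \<zeta>(1)])+
    also have "\<dots> = energy \<phi> + \<epsilon>\<^sup>2 * energy \<zeta>"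
      using test_functions_square_integrable(1)[OF \<phi>] test_functions_square_integrable(1)[OF \<zeta>(1)] by simp
    finally show "energy w \<le> energy \<phi> + \<epsilon>\<^sup>2 * energy \<zeta>" .
  qed
qed

lemma L2_limit_AE_subsequence:
  fixes u :: "'a::euclidean_space \<Rightarrow> real"
  assumes \<phi>: "\<And>k::nat. \<phi> k \<in> test_functions \<Omega>" and u: "L2_on \<Omega> u" and \<Omega>: "\<Omega> \<in> sets lebesgue"
    and lim: "(\<lambda>k. \<integral>x. (\<phi> k x - u x)\<^sup>2 \<partial>lebesgue_on \<Omega>) \<longlonglongrightarrow> 0"
  obtains r where "strict_mono r" "AE x in lebesgue_on \<Omega>. (\<lambda>k. \<phi> (r k) x) \<longlonglongrightarrow> u x"
proof -
  have "integrable (lebesgue_on \<Omega>) (\<lambda>x. (\<phi> k x - u x)\<^sup>2)" for k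
    using L2_on_diff[OF L2_on_grad(2)[OF \<phi> \<Omega>] u] by (simp add: L2_on_def)
  moreover have "(\<lambda>k. \<integral>x. norm ((\<phi> k x - u x)\<^sup>2) \<partial>lebesgue_on \<Omega>) \<longlonglongrightarrow> 0" using lim by simp
  ultimately have "\<exists>r. strict_mono r \<and> (AE x in lebesgue_on \<Omega>. (\<lambda>k. (\<phi> (r k) x - u x)\<^sup>2) \<longlonglongrightarrow> 0)"
    by (rule tendsto_L1_AE_subseq)
  then obtain r where r: "strict_mono r" "AE x in lebesgue_on \<Omega>. (\<lambda>k. (\<phi> (r k) x - u x)\<^sup>2) \<longlonglongrightarrow> 0" by auto
  have "AE x in lebesgue_on \<Omega>. (\<lambda>k. \<phi> (r k) x) \<longlonglongrightarrow> u x"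
  proof (rule eventually_mono[OF r(2)])
    fix x assume "(\<lambda>k. (\<phi> (r k) x - u x)\<^sup>2) \<longlonglongrightarrow> 0"
    from tendsto_real_sqrt[OF this] have "(\<lambda>k. \<bar>\<phi> (r k) x - u x\<bar>) \<longlonglongrightarrow> 0" by simp
    then have "(\<lambda>k. \<phi> (r k) x - u x) \<longlonglongrightarrow> 0" by (rule tendsto_rabs_zero_cancel)
    then show "(\<lambda>k. \<phi> (r k) x) \<longlonglongrightarrow> u x" by (rule LIM_zero_cancel)
  qed
  with r(1) show thesis by (rule that)
qed

section \<open>The contradiction from an attaining function\<close>

context
  fixes \<beta> p g :: real and n :: real and ty :: "'n::finite itself"
  assumes \<beta>: "\<beta> \<ge> 0" and n: "n = real CARD('n)"
    and p: "p = 2 + 2 * \<beta> / (n + 1)" and g: "g = - 2 + (n - 1) / (n + 1) * \<beta>" and g0: "g \<le> 0"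
begin

text \<open>Without a weight both integrals are translation invariant, and a shift by 3 brings the
  ball of radius 2 into the half-space.\<close>

lemma whole_space_sobolev:
  fixes w :: "'n upper \<Rightarrow> real"
  assumes w: "w \<in> test_functions (cball 0 2)" and g_eq: "g = 0"
  shows "mu \<beta> (half_space :: 'n upper set) * (\<integral>x. \<bar>w x\<bar> powr p \<partial>lborel) powr (2 / p)
    \<le> energy w"
proof -
  note [measurable] = test_functions_measurable[OF w]
  let ?v = "\<lambda>x. w ((0, -3) + 1 *\<^sub>R x)"
  have v: "?v \<in> test_functions half_space"
  proof (rule test_functions_mono[OF test_functions_affine[OF w]], safe)
    fix y t assume "(0, -3) + 1 *\<^sub>R (y, t) \<in> cball (0 :: 'n upper) 2"
    then have "norm (y, t - 3) \<le> 2" by (simp add: algebra_simps)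
    then have "\<bar>t - 3\<bar> \<le> 2" using norm_snd_le[of "t - 3" y] by simp
    then show "(y, t) \<in> half_space" by (simp add: half_space_def abs_le_iff)
  qed simp
  have "(\<integral>x. (x \<bullet> (0, 1)) powr g * \<bar>?v x\<bar> powr p \<partial>lborel) = (\<integral>x. \<bar>?v x\<bar> powr p \<partial>lborel)"
  proof (rule Bochner_Integration.integral_cong[OF refl])
    fix x :: "'n upper"
    \<comment> \<open>On the bounding hyperplane the weight is \<open>0 powr 0 = 0\<close> rather
      than 1, but there \<open>?v\<close> vanishes.\<close>
    show "(x \<bullet> (0, 1)) powr g * \<bar>?v x\<bar> powr p = \<bar>?v x\<bar> powr p"
    proof (cases "x \<in> half_space")
      case True
      then show ?thesis unfolding half_space_eq by (simp add: g_eq)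
    next
      case False
      then have "?v x = 0" by (rule test_functions_zero_outside[OF v])
      then show ?thesis by simp
    qed
  qed
  also have "\<dots> = (\<integral>x. \<bar>w x\<bar> powr p \<partial>lborel)"
    using integral_lborel_affine[of "\<lambda>x. \<bar>w x\<bar> powr p" 1 "(0, -3)"] by simp
  finally have P: "(\<integral>x. (x \<bullet> (0, 1)) powr g * \<bar>?v x\<bar> powr p \<partial>lborel) = (\<integral>x. \<bar>w x\<bar> powr p \<partial>lborel)" .
  have E: "energy ?v = energy w"
    using integral_grad_affine[OF w, of 1 "(0, -3)"] by simp
  show ?thesis using half_space_inequality[OF \<beta> n p g g0 v] unfolding P E .
qed

lemma le_powr_of_quotient:
  assumes "\<mu> > 0" "\<mu> * Q powr (2 / p) \<le> c" "Q \<ge> 0"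
  shows "Q \<le> (c / \<mu>) powr (p / 2)"
proof -
  have p0: "p > 0" using p_ge_2[OF \<beta> n p g g0] by simp
  have "Q powr (2 / p) \<le> c / \<mu>" using assms by (simp add: field_simps)
  then have "(Q powr (2 / p)) powr (p / 2) \<le> (c / \<mu>) powr (p / 2)" using p0 by (intro powr_mono2) auto
  then show ?thesis using p0 assms(3) by (simp add: powr_powr)
qed

lemma not_achieved:
  fixes u :: "'n upper \<Rightarrow> real"
  assumes u: "u \<in> W12_0 (ball 0 1)" and ach: "mu_achieved_by \<beta> (ball 0 1) u"
  shows False
proof -
  let ?B = "ball 0 1 :: 'n upper set"
  let ?M = "lebesgue_on ?B"
  define \<mu> where "\<mu> = mu \<beta> (half_space :: 'n upper set)"
  have \<mu>: "\<mu> > 0" unfolding \<mu>_def by (rule mu_half_space_pos[OF \<beta> n p g g0])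
  have \<mu>B: "mu \<beta> ?B = \<mu>"
    using mu_ball_ge[OF \<beta> n p g g0] mu_ball_le[OF \<beta> n p g g0] by (simp add: \<mu>_def)
  have p2: "p \<ge> 2" by (rule p_ge_2[OF \<beta> n p g g0])
  have B: "?B \<in> sets lebesgue" by simp
  obtain G \<phi> where G: "W12_gradient ?B u G" and \<phi>: "\<And>k::nat. \<phi> k \<in> test_functions ?B"
    and lim: "(\<lambda>k. (\<integral>x. (\<phi> k x - u x)\<^sup>2 \<partial>?M) + (\<integral>x. (norm (grad (\<phi> k) x - G x))\<^sup>2 \<partial>?M)) \<longlonglongrightarrow> 0"
    using u unfolding W12_0_def by blast
  obtain Du where Du: "W12_gradient ?B u Du" and J: "J_quot \<beta> ?B u Du = \<mu>"
    using ach unfolding mu_achieved_by_def \<mu>B by blast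
  have nz: "\<not> (AE x in ?M. u x = 0)" using ach by (simp add: mu_achieved_by_def)
  have um: "u \<in> borel_measurable ?M" and uL2: "L2_on ?B u" using G by (auto simp: W12_gradient_def L2_on_def)
  have lim1: "(\<lambda>k. \<integral>x. (\<phi> k x - u x)\<^sup>2 \<partial>?M) \<longlonglongrightarrow> 0"
    by (rule tendsto_sandwich[OF _ _ tendsto_const lim]) (auto intro!: always_eventually Bochner_Integration.integral_nonneg)
  have lim2: "(\<lambda>k. \<integral>x. (norm (grad (\<phi> k) x - G x))\<^sup>2 \<partial>?M) \<longlonglongrightarrow> 0"
    by (rule tendsto_sandwich[OF _ _ tendsto_const lim]) (auto intro!: always_eventually Bochner_Integration.integral_nonneg)
  show False
  proof (rule L2_limit_AE_subsequence[OF \<phi> uL2 B lim1])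
    fix r :: "nat \<Rightarrow> nat" assume r: "strict_mono r" and AEu: "AE x in ?M. (\<lambda>k. \<phi> (r k) x) \<longlonglongrightarrow> u x"
    define \<psi> where "\<psi> k = \<phi> (r k)" for k
    have \<psi>: "\<psi> k \<in> test_functions ?B" for k using \<phi> by (simp add: \<psi>_def)
    have \<psi>m: "\<psi> k \<in> borel_measurable borel" for k by (rule test_functions_measurable(1)[OF \<psi>])
    have lim\<psi>: "(\<lambda>k. \<integral>x. (norm (grad (\<psi> k) x - G x))\<^sup>2 \<partial>?M) \<longlonglongrightarrow> 0"
      using LIMSEQ_subseq_LIMSEQ[OF lim2 r] by (simp add: \<psi>_def o_def)
    define E where "E = (\<integral>x. (norm (Du x))\<^sup>2 \<partial>?M)"
    define P where "P = (\<integral>x. bdry_dist ?B x powr g * \<bar>u x\<bar> powr p \<partial>?M)"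
    have energy: "\<forall>\<^sub>F k in sequentially. energy (\<psi> k) \<le> c" if "c > E" for c
      by (rule eventually_energy_le[OF B G Du \<psi> lim\<psi>]) (use that in \<open>simp add: E_def\<close>)
    have Jeq: "E / P powr (2 / p) = \<mu>"
      using J unfolding J_quot_conv[OF \<beta> n p g g0] E_def P_def .
    have P0: "P \<ge> 0" unfolding P_def by (intro Bochner_Integration.integral_nonneg) simp
    \<comment> \<open>If P were 0, in particular if the integral diverged, the quotient would be 0
      by \<open>0 powr a = 0\<close> and \<open>x / 0 = 0\<close>, against \<mu> > 0. A nonzero
      Bochner integral also certifies integrability, which is drawn in \<open>Pint\<close>.\<close>
    have P: "P > 0"
    proof (rule ccontr)
      assume "\<not> P > 0"
      then have "P = 0" using P0 by simp
      then show False using Jeq \<mu> by simp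
    qed
    have EP: "E = \<mu> * P powr (2 / p)" using Jeq P by (simp add: field_simps)
    have E: "E > 0" unfolding EP using \<mu> P by simp
    \<comment> \<open>Attainment says that P is the value at c = E of the bound (c / \<mu>) powr (p
      / 2), which \<open>le_powr_of_quotient\<close> provides for energy at most c.\<close>
    have PE: "(E / \<mu>) powr (p / 2) = P" unfolding EP using \<mu> P p2 by (simp add: powr_powr)
    have Pint: "integrable ?M (\<lambda>x. bdry_dist ?B x powr g * \<bar>u x\<bar> powr p)"
      using P not_integrable_integral_eq[of ?M "\<lambda>x. bdry_dist ?B x powr g * \<bar>u x\<bar> powr p"] unfolding P_def by force
    have space: "x \<in> space ?M \<longleftrightarrow> norm x < 1" for x by (simp add: space_restrict_space)
    have powr_lim: "(\<lambda>k. \<bar>v k\<bar> powr p) \<longlonglongrightarrow> \<bar>y\<bar> powr p" if "v \<longlonglongrightarrow> y" for v :: "nat \<Rightarrow> real" and y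
      using that p2 by (intro tendsto_powr' tendsto_rabs tendsto_const) auto
    show False
    proof (cases "g < 0")
      case True
      \<comment> \<open>The density with the conformal weight. Fatou's lemma carries
        \<open>conformal_ball_inequality\<close> from the approximants to u and yields that the
        integral of h is at most P.\<close>
      define h where "h x = ((1 - x \<bullet> x) / 2) powr g * \<bar>u x\<bar> powr p" for x
      have [measurable]: "u \<in> borel_measurable ?M" by (rule um)
      have "(\<lambda>x. ((1 - x \<bullet> x) / 2) powr g) \<in> borel_measurable ?M"
        by (rule borel_measurable_lebesgue_onI) measurable
      then have hm: "h \<in> borel_measurable ?M" unfolding h_def by measurable
      have "(\<integral>\<^sup>+x. ennreal (h x) \<partial>?M) \<le> ennreal ((c / \<mu>) powr (p / 2))" if c: "c > E" for c
      proof (rule fatou_eventually)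
        show "(\<lambda>x. ((1 - x \<bullet> x) / 2) powr g * \<bar>\<psi> k x\<bar> powr p) \<in> borel_measurable ?M" for k
          using \<psi>m[of k] by (intro borel_measurable_lebesgue_onI) measurable
        show "AE x in ?M. (\<lambda>k. ((1 - x \<bullet> x) / 2) powr g * \<bar>\<psi> k x\<bar> powr p) \<longlonglongrightarrow> h x"
          unfolding h_def \<psi>_def
          by (rule eventually_mono[OF AEu]) (intro tendsto_mult tendsto_const powr_lim)
        show "\<forall>\<^sub>F k in sequentially. (\<integral>\<^sup>+x. ennreal (((1 - x \<bullet> x) / 2) powr g * \<bar>\<psi> k x\<bar> powr p) \<partial>?M) \<le> ennreal ((c / \<mu>) powr (p / 2))"
        proof (rule eventually_mono[OF energy[OF c]])
          fix k assume k: "energy (\<psi> k) \<le> c"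
          let ?f = "\<lambda>x. ((1 - x \<bullet> x) / 2) powr g * \<bar>\<psi> k x\<bar> powr p"
          have sq: "x \<bullet> x < 1" if "norm x < 1" for x :: "'n upper"
            using that by (simp add: power2_norm_eq_inner[symmetric] abs_square_less_1)
          have i: "integrable lborel ?f"
            by (rule integrable_potential[OF \<psi>, where W="\<lambda>x. (1 - x \<bullet> x) / 2"])
              (use sq p2 in \<open>auto intro!: continuous_intros\<close>)
          have "(\<integral>\<^sup>+x. ennreal (?f x) \<partial>?M) = ennreal (\<integral>x. ?f x \<partial>?M)"
            using integrable_lebesgue_on[OF i B] by (intro nn_integral_eq_integral) auto
          also have "(\<integral>x. ?f x \<partial>?M) = (\<integral>x. ?f x \<partial>lborel)"
          proof (rule integral_lebesgue_on_eq_lborel[OF _ _ B])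
            show "?f \<in> borel_measurable borel" using i by auto
            show "?f x = 0" if "x \<notin> ?B" for x using test_functions_zero_outside[OF \<psi> that] by simp
          qed
          also have "ennreal \<dots> \<le> ennreal ((c / \<mu>) powr (p / 2))"
          proof (rule ennreal_leI, rule le_powr_of_quotient[OF \<mu>])
            show "\<mu> * (\<integral>x. ?f x \<partial>lborel) powr (2 / p) \<le> c"
              using order_trans[OF conformal_ball_inequality[OF \<beta> n p g g0 \<psi>] k] unfolding \<mu>_def .
            show "(\<integral>x. ?f x \<partial>lborel) \<ge> 0" by (intro Bochner_Integration.integral_nonneg) simp
          qed
          finally show "(\<integral>\<^sup>+x. ennreal (?f x) \<partial>?M) \<le> ennreal ((c / \<mu>) powr (p / 2))" .
        qed
      qed
      moreover have "isCont (\<lambda>c. (c / \<mu>) powr (p / 2)) E" using E \<mu> by (intro continuous_intros) auto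
      ultimately have le: "(\<integral>\<^sup>+x. ennreal (h x) \<partial>?M) \<le> ennreal P"
        using ennreal_le_limit[where F="\<lambda>c. (c / \<mu>) powr (p / 2)" and E=E] unfolding PE by blast
      have hint: "integrable ?M h"
        by (rule integrableI_nonneg[OF hm]) (use le in \<open>auto simp: h_def intro: le_less_trans\<close>)
      have "h x \<ge> 0" for x by (simp add: h_def)
      then have "ennreal (\<integral>x. h x \<partial>?M) \<le> ennreal P"
        using le nn_integral_eq_integral[OF hint] by simp
      then have hP: "(\<integral>x. h x \<partial>?M) \<le> P" using P by (simp add: ennreal_le_iff)
      \<comment> \<open>The surplus of the conformal density over the one in \<open>J_quot\<close>.
        It is nonnegative on the ball and has integral at most 0, so it vanishes almost everywhere;
        but by strictness of the weights it vanishes only where u does.\<close>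
      define d where "d x = h x - bdry_dist ?B x powr g * \<bar>u x\<bar> powr p" for x
      have strict: "(1 - norm x) powr g < ((1 - x \<bullet> x) / 2) powr g" if "norm x < 1" for x :: "'n upper"
      proof (rule powr_less_mono2_neg[OF True])
        have eq: "(1 - x \<bullet> x) / 2 = (1 - norm x) * ((1 + norm x) / 2)"
          by (simp add: power2_norm_eq_inner[symmetric] power2_eq_square algebra_simps)
        show "0 < (1 - x \<bullet> x) / 2" unfolding eq using that by (intro mult_pos_pos) (auto intro: add_pos_nonneg)
        have "(1 - norm x) * ((1 + norm x) / 2) < (1 - norm x) * 1"
          using that by (intro mult_strict_left_mono) auto
        then show "(1 - x \<bullet> x) / 2 < 1 - norm x" unfolding eq by simp
      qed
      have dnn: "d x \<ge> 0" "d x = 0 \<Longrightarrow> u x = 0" if "norm x < 1" for x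
      proof -
        have d_eq: "d x = (((1 - x \<bullet> x) / 2) powr g - (1 - norm x) powr g) * \<bar>u x\<bar> powr p"
          by (simp add: d_def h_def bdry_dist_ball[OF that] algebra_simps)
        show "d x \<ge> 0" unfolding d_eq using strict[OF that] by (intro mult_nonneg_nonneg) auto
        show "u x = 0" if "d x = 0" using that strict[OF \<open>norm x < 1\<close>] unfolding d_eq by simp
      qed
      have dint: "integrable ?M d" unfolding d_def using hint Pint by (rule Bochner_Integration.integrable_diff)
      have dAE: "AE x in ?M. d x \<ge> 0" by (rule AE_I2) (use dnn space in auto)
      have "(\<integral>x. d x \<partial>?M) \<le> 0" unfolding d_def using hint Pint hP by (simp add: P_def)
      moreover have "(\<integral>x. d x \<partial>?M) \<ge> 0" by (rule integral_nonneg_AE[OF dAE])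
      ultimately have "AE x in ?M. d x = 0"
        using integral_nonneg_eq_0_iff_AE[OF dint dAE] by simp
      then have "AE x in ?M. u x = 0"
        by (rule AE_mp) (rule AE_I2, use dnn space in auto)
      then show False using nz by simp
    next
      case False
      then have g_eq: "g = 0" using g0 by simp
      have [measurable]: "u \<in> borel_measurable ?M" by (rule um)
      have Pu: "P = (\<integral>x. \<bar>u x\<bar> powr p \<partial>?M)"
        unfolding P_def by (rule Bochner_Integration.integral_cong[OF refl]) (simp add: g_eq space bdry_dist_ball)
      have iu: "integrable ?M (\<lambda>x. \<bar>u x\<bar> powr p)"
        by (rule Bochner_Integration.integrable_cong[THEN iffD1, OF refl _ Pint]) (simp add: g_eq space bdry_dist_ball)
      obtain \<zeta> :: "'n upper \<Rightarrow> real" where \<zeta>: "\<zeta> \<in> test_functions (cball 0 2)"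
        "\<And>x. norm x \<le> 1 \<Longrightarrow> \<zeta> x = 1"
        by (rule obtain_cutoff) blast
      define D where "D = energy \<zeta>"
      have D: "D \<ge> 0" unfolding D_def by (intro Bochner_Integration.integral_nonneg) simp
      \<comment> \<open>The bound for the pth power integral of |u| + \<epsilon>/2: the Sobolev
        inequality applied to the perturbed approximants, with energy E + \<epsilon>^2 D in the
        limit. At \<epsilon> = 0 it is attained, which is \<open>F0\<close>.\<close>
      define F where "F \<epsilon> = ((E + \<epsilon>\<^sup>2 * D) / \<mu>) powr (p / 2)" for \<epsilon>
      have F0: "F 0 = P" using PE by (simp add: F_def)
      have pert: "(\<integral>\<^sup>+x. ennreal ((\<bar>u x\<bar> + \<epsilon> / 2) powr p) \<partial>?M) \<le> ennreal (F \<epsilon>)" if \<epsilon>: "\<epsilon> > 0" for \<epsilon>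
      proof -
        have "(\<integral>\<^sup>+x. ennreal ((\<bar>u x\<bar> + \<epsilon> / 2) powr p) \<partial>?M) \<le> ennreal (((c + \<epsilon>\<^sup>2 * D) / \<mu>) powr (p / 2))" if c: "c > E" for c
        proof (rule fatou_eventually)
          show "(\<lambda>x. (\<bar>\<psi> k x\<bar> + \<epsilon> / 2) powr p) \<in> borel_measurable ?M" for k
            using \<psi>m[of k] by (intro borel_measurable_lebesgue_onI) measurable
          show "AE x in ?M. (\<lambda>k. (\<bar>\<psi> k x\<bar> + \<epsilon> / 2) powr p) \<longlonglongrightarrow> (\<bar>u x\<bar> + \<epsilon> / 2) powr p"
            unfolding \<psi>_def
          proof (rule eventually_mono[OF AEu])
            fix x assume "(\<lambda>k. \<phi> (r k) x) \<longlonglongrightarrow> u x"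
            moreover have "\<bar>u x\<bar> + \<epsilon> / 2 \<noteq> 0" using \<epsilon> abs_ge_zero[of "u x"] by linarith
            ultimately show "(\<lambda>k. (\<bar>\<phi> (r k) x\<bar> + \<epsilon> / 2) powr p) \<longlonglongrightarrow> (\<bar>u x\<bar> + \<epsilon> / 2) powr p"
              by (intro tendsto_powr tendsto_add tendsto_rabs tendsto_const) auto
          qed
          show "\<forall>\<^sub>F k in sequentially. (\<integral>\<^sup>+x. ennreal ((\<bar>\<psi> k x\<bar> + \<epsilon> / 2) powr p) \<partial>?M) \<le> ennreal (((c + \<epsilon>\<^sup>2 * D) / \<mu>) powr (p / 2))"
          proof (rule eventually_mono[OF energy[OF c]])
            fix k assume k: "energy (\<psi> k) \<le> c"
            show "(\<integral>\<^sup>+x. ennreal ((\<bar>\<psi> k x\<bar> + \<epsilon> / 2) powr p) \<partial>?M) \<le> ennreal (((c + \<epsilon>\<^sup>2 * D) / \<mu>) powr (p / 2))"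
            proof (rule regularized_perturbation[OF \<psi> \<zeta> \<epsilon>])
              fix w assume w: "w \<in> test_functions (cball 0 2)" and lb: "\<And>x. norm x < 1 \<Longrightarrow> \<bar>\<psi> k x\<bar> + \<epsilon> / 2 \<le> w x"
                and Ew: "energy w \<le> energy (\<psi> k) + \<epsilon>\<^sup>2 * energy \<zeta>"
              have i: "integrable lborel (\<lambda>x. \<bar>w x\<bar> powr p)"
                using integrable_potential[OF w, of "\<lambda>x. 1" p 0] p2 by simp
              have "(\<integral>\<^sup>+x. ennreal ((\<bar>\<psi> k x\<bar> + \<epsilon> / 2) powr p) \<partial>?M) \<le> (\<integral>\<^sup>+x. ennreal (\<bar>w x\<bar> powr p) \<partial>?M)"
              proof (rule nn_integral_mono, rule ennreal_leI)
                fix x assume "x \<in> space ?M"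
                then have "\<bar>\<psi> k x\<bar> + \<epsilon> / 2 \<le> w x" unfolding space by (rule lb)
                then show "(\<bar>\<psi> k x\<bar> + \<epsilon> / 2) powr p \<le> \<bar>w x\<bar> powr p" using p2 \<epsilon> by (intro powr_mono2) auto
              qed
              also have "\<dots> = (\<integral>\<^sup>+x. ennreal (\<bar>w x\<bar> powr p) * indicator ?B x \<partial>lebesgue)"
                by (rule nn_integral_restrict_space) simp
              also have "\<dots> \<le> (\<integral>\<^sup>+x. ennreal (\<bar>w x\<bar> powr p) \<partial>lebesgue)"
                by (intro nn_integral_mono) (auto simp: indicator_def)
              also have "\<dots> = ennreal (\<integral>x. \<bar>w x\<bar> powr p \<partial>lborel)"
                unfolding nn_integral_completion using i by (intro nn_integral_eq_integral) auto
              also have "\<dots> \<le> ennreal (((c + \<epsilon>\<^sup>2 * D) / \<mu>) powr (p / 2))"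
              proof (rule ennreal_leI, rule le_powr_of_quotient[OF \<mu>])
                show "\<mu> * (\<integral>x. \<bar>w x\<bar> powr p \<partial>lborel) powr (2 / p) \<le> c + \<epsilon>\<^sup>2 * D"
                  using whole_space_sobolev[OF w g_eq] Ew k unfolding \<mu>_def D_def by linarith
                show "(\<integral>x. \<bar>w x\<bar> powr p \<partial>lborel) \<ge> 0" by (intro Bochner_Integration.integral_nonneg) simp
              qed
              finally show ?thesis .
            qed
          qed
        qed
        moreover have "isCont (\<lambda>c. ((c + \<epsilon>\<^sup>2 * D) / \<mu>) powr (p / 2)) E"
        proof -
          have "(E + \<epsilon>\<^sup>2 * D) / \<mu> \<noteq> 0" using E \<mu> D add_pos_nonneg[of E "\<epsilon>\<^sup>2 * D"] by auto
          then show ?thesis using \<mu> by (intro continuous_intros) auto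
        qed
        ultimately show ?thesis
          using ennreal_le_limit[where F="\<lambda>c. ((c + \<epsilon>\<^sup>2 * D) / \<mu>) powr (p / 2)" and E=E] unfolding F_def by blast
      qed
      define Q where "Q = (\<integral>x. \<bar>u x\<bar> powr (p - 1) \<partial>?M)"
      have iq: "integrable ?M (\<lambda>x. \<bar>u x\<bar> powr (p - 1))"
      proof -
        \<comment> \<open>The form \<open>2 / 2\<close> matches \<open>pert\<close> at \<epsilon> =
          2. The base |u| + 1 is at least 1, so the exponent p - 1 may be raised to p and the
          integral dominates that of |u| powr (p - 1).\<close>
        have i1: "integrable ?M (\<lambda>x. (\<bar>u x\<bar> + 2 / 2) powr p)"
          by (rule integrableI_nonneg) (use pert[of 2] in \<open>auto intro: le_less_trans\<close>)
        show ?thesis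
        proof (rule Bochner_Integration.integrable_bound[OF i1])
          show "AE x in ?M. norm (\<bar>u x\<bar> powr (p - 1)) \<le> norm ((\<bar>u x\<bar> + 2 / 2) powr p)"
          proof (rule AE_I2)
            fix x
            have "\<bar>u x\<bar> powr (p - 1) \<le> (\<bar>u x\<bar> + 1) powr (p - 1)" using p2 by (intro powr_mono2) auto
            also have "\<dots> \<le> (\<bar>u x\<bar> + 1) powr p" by (intro powr_mono) auto
            finally show "norm (\<bar>u x\<bar> powr (p - 1)) \<le> norm ((\<bar>u x\<bar> + 2 / 2) powr p)" by simp
          qed
        qed measurable
      qed
      have slope: "p / 2 * Q \<le> (F \<epsilon> - F 0) / \<epsilon>" if \<epsilon>: "\<epsilon> > 0" for \<epsilon>
      proof -
        have i2: "integrable ?M (\<lambda>x. (\<bar>u x\<bar> + \<epsilon> / 2) powr p)"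
          by (rule integrableI_nonneg) (use pert[OF \<epsilon>] in \<open>auto intro: le_less_trans\<close>)
        have "P + p * (\<epsilon> / 2) * Q = (\<integral>x. \<bar>u x\<bar> powr p + p * (\<epsilon> / 2) * \<bar>u x\<bar> powr (p - 1) \<partial>?M)"
          unfolding Pu Q_def using iu iq by simp
        also have "\<dots> \<le> (\<integral>x. (\<bar>u x\<bar> + \<epsilon> / 2) powr p \<partial>?M)"
          using iu iq i2 \<epsilon> p2 by (intro integral_mono Bochner_Integration.integrable_add integrable_mult_right bernoulli_powr) auto
        also have "\<dots> \<le> F \<epsilon>"
        proof -
          have "ennreal (\<integral>x. (\<bar>u x\<bar> + \<epsilon> / 2) powr p \<partial>?M) \<le> ennreal (F \<epsilon>)"
            using pert[OF \<epsilon>] nn_integral_eq_integral[OF i2] by simp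
          moreover have "F \<epsilon> \<ge> 0" by (simp add: F_def)
          ultimately show ?thesis by (simp add: ennreal_le_iff)
        qed
        finally show ?thesis using \<epsilon> F0 by (simp add: field_simps)
      qed
      \<comment> \<open>The perturbation enters F only through \<epsilon>^2, so F has slope 0 at the
        origin, while \<open>slope\<close> bounds its difference quotients below by p Q / 2. Letting
        \<epsilon> tend to 0 gives Q \<le> 0.\<close>
      have "(F has_real_derivative 0) (at 0)"
      proof -
        have d: "((\<lambda>\<epsilon>. (E + \<epsilon>\<^sup>2 * D) / \<mu>) has_real_derivative 0) (at 0)"
          using \<mu> by (auto intro!: derivative_eq_intros)
        have "(E + 0\<^sup>2 * D) / \<mu> > 0" using E \<mu> by simp
        from DERIV_fun_powr[OF d this, of "p / 2"] show ?thesis by (simp add: F_def[abs_def])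
      qed
      then have "((\<lambda>\<epsilon>. (F \<epsilon> - F 0) / \<epsilon>) \<longlongrightarrow> 0) (at_right 0)"
        unfolding has_field_derivative_iff by (auto intro: tendsto_within_subset)
      then have "p / 2 * Q \<le> 0"
      proof (rule tendsto_lowerbound)
        show "\<forall>\<^sub>F \<epsilon> in at_right 0. p / 2 * Q \<le> (F \<epsilon> - F 0) / \<epsilon>"
          using eventually_at_right_less[of "0 :: real"] by (rule eventually_mono) (rule slope)
      qed simp
      then have "Q \<le> 0" using p2 by (simp add: mult_le_0_iff)
      moreover have "Q \<ge> 0" unfolding Q_def by (intro Bochner_Integration.integral_nonneg) simp
      ultimately have "Q = 0" by simp
      then have "AE x in ?M. \<bar>u x\<bar> powr (p - 1) = 0"
        using integral_nonneg_eq_0_iff_AE[OF iq] unfolding Q_def by simp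
      then show False using nz by simp
    qed
  qed
qed

end

theorem proposition1p5:
  fixes \<beta> :: real
  assumes "\<beta> \<ge> 0"
    and "CARD('n::finite) \<ge> 2 \<Longrightarrow> \<beta> \<le> 2 * (real CARD('n) + 1) / (real CARD('n) - 1)"
  shows "mu \<beta> (ball 0 1 :: ((real ^ 'n) \<times> real) set) = mu \<beta> (half_space :: ((real ^ 'n) \<times> real) set)
    \<and> \<not> (\<exists>u \<in> W12_0 (ball 0 1 :: ((real ^ 'n) \<times> real) set). mu_achieved_by \<beta> (ball 0 1) u)"
proof -
  define n where "n = real CARD('n)"
  define p where "p = 2 + 2 * \<beta> / (n + 1)"
  define g where "g = - 2 + (n - 1) / (n + 1) * \<beta>"
  \<comment> \<open>For n \<ge> 2 the hypothesis on \<beta> is this inequality cleared of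
    denominators; for n = 1 the exponent g is -2.\<close>
  have g0: "g \<le> 0"
  proof (cases "CARD('n) \<ge> 2")
    case True
    then have n: "n \<ge> 2" by (simp add: n_def)
    have "\<beta> \<le> 2 * (n + 1) / (n - 1)" using assms(2)[OF True] by (simp add: n_def)
    then have "(n - 1) * \<beta> \<le> 2 * (n + 1)" using n by (simp add: field_simps)
    then show ?thesis using n by (simp add: g_def field_simps)
  next
    case False
    then have "CARD('n) = 1" using zero_less_card_finite[where 'a='n] by linarith
    then show ?thesis by (simp add: g_def n_def)
  qed
  note facts = assms(1) n_def p_def g_def g0
  show ?thesis
    using mu_ball_ge[OF facts] mu_ball_le[OF facts] not_achieved[OF facts] by (auto intro: antisym)
qed

end
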